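(* Let $q$ be a prime power and let $K_0$ be a function field over $\mathbb{F}_q$ having at least one place of degree $1$. Then there exists an everywhere ramified tower $K_0 \subset K_1 \subset K_2 \subset \dots$ of function fields over $\mathbb{F}_q$ such that $\lim_{i\to\infty} N_i/d_i > 0$, where $N_i$ is the number of degree-$1$ places of $K_i$ and $d_i=[K_i:K_0]$.
   Context: A function field over $\mathbb{F}_q$ is a finitely generated field extension $K/\mathbb{F}_q$ of transcendence degree $1$ in which $\mathbb{F}_q$ is algebraically closed. An extension of function fields $K'/K$ is a finite separable extension such that $K$ and $K'$ are both function fields over the same $\mathbb{F}_q$. A tower of function fields over $\mathbb{F}_q$ is a sequence $K_0\subset K_1\subset K_2\subset\dots$ of such extensions with $g_{K_i}\to\infty$, where $g_K$ denotes the genus. For a function field $K$, $N_K$ denotes the number of degree-$1$ (rational) places of $K$. In a tower, $N_i/d_i$ is non-increasing, so its limit exists. A tower is everywhere ramified if for every $i$ and every place $P$ of $K_i$ there exists $j>i$ such that $P$ ramifies in $K_j/K_i$. *)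

theory Defs
  imports "HOL-Algebra.Algebraic_Closure" "HOL-Algebra.Generated_Fields" "HOL-Number_Theory.Prime_Powers"
begin

text \<open>
  Fields are treated as subfields \<open>K\<close> of an ambient field \<open>R\<close>, with constant field \<open>k \<subseteq> K\<close>.
  To speak about a field on its own, take \<open>R\<close> to be that field and \<open>K = carrier R\<close>.
\<close>

context field
begin

section \<open>Function fields and their extensions\<close>

text \<open>Transcendence degree \<open>1\<close> is expressed by a transcendence basis \<open>{x}\<close>.\<close>

definition function_field :: "'a set \<Rightarrow> 'a set \<Rightarrow> bool" where
  "function_field k K \<longleftrightarrow>
     subfield k R \<and> subfield K R \<and> k \<subseteq> K \<and>
     (\<exists>S. finite S \<and> S \<subseteq> K \<and> K = generate_field R (k \<union> S)) \<and>
     (\<exists>x\<in>K. (transcendental over k) x \<and>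
        (\<forall>y\<in>K. (algebraic over (generate_field R (insert x k))) y)) \<and>
     (\<forall>y\<in>K. (algebraic over k) y \<longrightarrow> y \<in> k)"

text \<open>
  An element is separable over \<open>K\<close> if its minimal polynomial has as many distinct roots in \<open>R\<close> as
  its degree. This is the usual notion provided the ambient field \<open>R\<close> is algebraically closed.
\<close>

definition separable_over :: "'a set \<Rightarrow> 'a \<Rightarrow> bool" where
  "separable_over K x \<longleftrightarrow>
     (algebraic over K) x \<and> card {y. is_root (Irr K x) y} = degree (Irr K x)"

definition function_field_extension :: "'a set \<Rightarrow> 'a set \<Rightarrow> 'a set \<Rightarrow> bool" where
  "function_field_extension k K K' \<longleftrightarrow>
     function_field k K \<and> function_field k K' \<and> K \<subseteq> K' \<and>
     finite_dimension K K' \<and> (\<forall>x\<in>K'. separable_over K x)"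

section \<open>Places\<close>

definition valuation_ring :: "'a set \<Rightarrow> 'a set \<Rightarrow> 'a set \<Rightarrow> bool" where
  "valuation_ring k K V \<longleftrightarrow>
     subring V R \<and> k \<subset> V \<and> V \<subset> K \<and> (\<forall>z\<in>K - {\<zero>}. z \<in> V \<or> inv z \<in> V)"

definition places :: "'a set \<Rightarrow> 'a set \<Rightarrow> 'a set set" where
  "places k K = {P. \<exists>V. valuation_ring k K V \<and> maximalideal P (R\<lparr>carrier := V\<rparr>)}"

text \<open>
  The valuation ring is recovered from its maximal ideal: a nonzero \<open>z\<close> lies outside it precisely
  when its inverse is a non-unit of it.
\<close>

definition place_ring :: "'a set \<Rightarrow> 'a set \<Rightarrow> 'a set" where
  "place_ring K P = {z \<in> K. z = \<zero> \<or> inv z \<notin> P}"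

text \<open>
  The degree is \<open>[V/P : k]\<close>, where \<open>k\<close> is identified with its image in the residue field.
\<close>

definition place_degree :: "'a set \<Rightarrow> 'a set \<Rightarrow> 'a set \<Rightarrow> nat" where
  "place_degree k K P =
     (let V = R\<lparr>carrier := place_ring K P\<rparr>; F = V Quot P
      in ring.dim F ((\<lambda>a. P +>\<^bsub>V\<^esub> a) ` k) (carrier F))"

definition num_rational_places :: "'a set \<Rightarrow> 'a set \<Rightarrow> nat" where
  "num_rational_places k K = card {P \<in> places k K. place_degree k K P = 1}"

text \<open>
  The normalized valuation of a nonzero \<open>z = u t\<^sup>n\<close>, with \<open>t\<close> a generator of \<open>P\<close> and \<open>u\<close> a
  unit of the valuation ring. The value at zero is not specified.
\<close>

definition place_val :: "'a set \<Rightarrow> 'a set \<Rightarrow> 'a \<Rightarrow> int" where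
  "place_val K P z =
     (THE n. \<exists>t\<in>P. \<exists>u \<in> Units (R\<lparr>carrier := place_ring K P\<rparr>).
        P = PIdl\<^bsub>R\<lparr>carrier := place_ring K P\<rparr>\<^esub> t \<and> z = u \<otimes> t [^] n)"

section \<open>Genus\<close>

definition divisor :: "'a set \<Rightarrow> 'a set \<Rightarrow> ('a set \<Rightarrow> int) \<Rightarrow> bool" where
  "divisor k K D \<longleftrightarrow> {P. D P \<noteq> 0} \<subseteq> places k K \<and> finite {P. D P \<noteq> 0}"

definition divisor_degree :: "'a set \<Rightarrow> 'a set \<Rightarrow> ('a set \<Rightarrow> int) \<Rightarrow> int" where
  "divisor_degree k K D = (\<Sum>P | D P \<noteq> 0. D P * int (place_degree k K P))"

definition riemann_roch_space :: "'a set \<Rightarrow> 'a set \<Rightarrow> ('a set \<Rightarrow> int) \<Rightarrow> 'a set" where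
  "riemann_roch_space k K D =
     {z \<in> K. z = \<zero> \<or> (\<forall>P \<in> places k K. place_val K P z \<ge> - D P)}"

definition genus :: "'a set \<Rightarrow> 'a set \<Rightarrow> int" where
  "genus k K =
     (GREATEST g. \<exists>D. divisor k K D \<and>
        g = divisor_degree k K D - int (dim k (riemann_roch_space k K D)) + 1)"

section \<open>Ramification\<close>

text \<open>A place \<open>P'\<close> of \<open>K'\<close> lies over the place \<open>P\<close> of \<open>K\<close> iff \<open>P \<subseteq> P'\<close>.\<close>

definition ramification_index :: "'a set \<Rightarrow> 'a set \<Rightarrow> 'a set \<Rightarrow> 'a set \<Rightarrow> nat" where
  "ramification_index K K' P P' =
     (THE e. \<forall>x\<in>K - {\<zero>}. place_val K' P' x = int e * place_val K P x)"

definition ramifies :: "'a set \<Rightarrow> 'a set \<Rightarrow> 'a set \<Rightarrow> 'a set \<Rightarrow> bool" where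
  "ramifies k K K' P \<longleftrightarrow>
     (\<exists>P' \<in> places k K'. P \<subseteq> P' \<and> ramification_index K K' P P' > 1)"

section \<open>Towers\<close>

definition function_field_tower :: "'a set \<Rightarrow> (nat \<Rightarrow> 'a set) \<Rightarrow> bool" where
  "function_field_tower k K \<longleftrightarrow>
     (\<forall>i. K i \<subset> K (Suc i) \<and> function_field_extension k (K i) (K (Suc i))) \<and>
     filterlim (\<lambda>i. genus k (K i)) at_top sequentially"

definition everywhere_ramified :: "'a set \<Rightarrow> (nat \<Rightarrow> 'a set) \<Rightarrow> bool" where
  "everywhere_ramified k K \<longleftrightarrow>
     (\<forall>i. \<forall>P \<in> places k (K i). \<exists>j>i. ramifies k (K i) (K j) P)"

end

end

theory Submission
  imports Defs "HOL-Library.Countable_Set"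
begin

text \<open>
  Every step of the tower is a quadratic extension \<open>K(\<alpha>)\<close> of a function field \<open>K\<close>, with
  \<open>\<alpha>\<^sup>2 = a \<alpha> - b\<close>. Given a place \<open>P\<close>, weak approximation provides \<open>a\<close> and \<open>b\<close> such that the polynomial
  \<open>T\<^sup>2 - a T + b\<close> is Eisenstein at \<open>P\<close>, and congruent to \<open>T (T - 1)\<close> at every rational place other
  than \<open>P\<close>. Then \<open>P\<close> is totally ramified and every other rational place splits into two rational
  places. A rational place that splits also prevents new constants: \<open>K(\<alpha>)\<close> then has a rational place.

  A step thus replaces \<open>N\<close> rational places by \<open>2 N - 1\<close> if \<open>P\<close> is rational, and by \<open>2 N\<close> otherwise.
  Taking a nonrational place in the first step gives \<open>N\<^sub>1 \<ge> 2\<close>, then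
  \<open>N\<^sub>i\<^sub>+\<^sub>1 \<ge> 2\<^sup>i + 1\<close> for all \<open>i\<close>, and so \<open>N\<^sub>i / d\<^sub>i \<ge> 1 / 2\<close>. The places of all stages are countable in
  number, and a diagonal enumeration ensures that some place above each of them is ramified at a
  later stage.

  The genus tends to infinity because \<open>N \<le> 1 + q (g + 1)\<close>: if \<open>Q\<close> is rational, then by Riemann's
  theorem there is a nonconstant function whose only pole is \<open>Q\<close>, of order at most \<open>g + 1\<close>, and
  it takes each of the \<open>q\<close> constant values at most \<open>g + 1\<close> times.
\<close>

section \<open>Polynomial expressions\<close>

text \<open>Since \<open>k\<close> is finite, dimensions, residue degrees and Riemann-Roch spaces
  can be compared through cardinalities, all powers of q; injections between finite sets take the
  place of exact sequences. One bound carries the valuation theory: a ring between \<open>k\<close>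
  and \<open>K\<close> that contains a nonconstant z has at most q^[K:k(z)] classes modulo z. It
  yields discreteness of places, finite residue fields and the finiteness of the set of zeros of z.

  The trace term in T^2 - a T + b makes one construction serve every characteristic: a is a unit
  where places split, so the polynomial stays separable in characteristic 2.

  Each step needs a rational place besides the ramified one, to keep a nonzero and to exclude new
  constants. If N_0 = 1, ramifying the only rational place would leave no such witness, and 2 N - 1
  = 1 would not grow. Hence the nonrational first choice, available because there are infinitely
  many places but finitely many rational ones. From N = 2 on, N - 1 at least doubles.

  All fields are subsets of one algebraic closure, which supplies the roots \<alpha> and makes
  separability a count of roots.\<close>

context ring
begin

text \<open>Values at \<open>x\<close> of polynomials over \<open>A\<close> of degree at most the
  index, in Horner form. Recursion on the constant term suits arguments modulo \<open>x\<close>, and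
  the degree bound permits counting.\<close>

primrec polys :: "'a set \<Rightarrow> 'a \<Rightarrow> nat \<Rightarrow> 'a set" where
  "polys A x 0 = A"
| "polys A x (Suc d) = {a \<oplus> x \<otimes> g | a g. a \<in> A \<and> g \<in> polys A x d}"

lemma polysI: "a \<in> A \<Longrightarrow> g \<in> polys A x d \<Longrightarrow> a \<oplus> x \<otimes> g \<in> polys A x (Suc d)"
  by auto

end

context cring
begin

context
  fixes A x
  assumes A: "subring A R" and x: "x \<in> carrier R"
begin

lemma polys_carrier: "g \<in> polys A x d \<Longrightarrow> g \<in> carrier R"
  using subringE(1)[OF A] x by (induct d arbitrary: g) auto

lemma zero_polys: "\<zero> \<in> polys A x d"
proof (induct d)
  case (Suc d)
  then show ?case using polysI[OF subringE(2)[OF A] Suc] x by simp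
qed (use subringE(2)[OF A] in auto)

lemma base_polys:
  assumes "a \<in> A" shows "a \<in> polys A x d"
proof (cases d)
  case (Suc e)
  then show ?thesis using polysI[OF assms zero_polys, of e] subringE(1)[OF A] x assms by (simp add: subset_iff del: polys.simps)
qed (use assms in simp)

lemma polys_Suc: "g \<in> polys A x d \<Longrightarrow> g \<in> polys A x (Suc d)"
proof (induct d arbitrary: g)
  case 0
  then show ?case using base_polys[of g "Suc 0"] by (simp del: polys.simps(2))
next
  case (Suc d)
  then obtain a h where "a \<in> A" "h \<in> polys A x d" "g = a \<oplus> x \<otimes> h" by auto
  then show ?case using Suc(1)[of h] polysI[of a A h x "Suc d"] by blast
qed

lemma polys_mono: "d \<le> e \<Longrightarrow> g \<in> polys A x d \<Longrightarrow> g \<in> polys A x e"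
  by (induct rule: dec_induct) (auto simp only: polys_Suc)

lemma var_mult_polys: "g \<in> polys A x d \<Longrightarrow> x \<otimes> g \<in> polys A x (Suc d)"
  using polysI[OF subringE(2)[OF A], of g x d] polys_carrier[of g d] x by auto

lemma add_polys: "g \<in> polys A x d \<Longrightarrow> h \<in> polys A x d \<Longrightarrow> g \<oplus> h \<in> polys A x d"
proof (induct d arbitrary: g h)
  case 0
  then show ?case using subringE(7)[OF A] by simp
next
  case (Suc d)
  then obtain a g' b h' where g: "a \<in> A" "g' \<in> polys A x d" "g = a \<oplus> x \<otimes> g'"
    and h: "b \<in> A" "h' \<in> polys A x d" "h = b \<oplus> x \<otimes> h'" by auto
  have c: "a \<in> carrier R" "b \<in> carrier R" "g' \<in> carrier R" "h' \<in> carrier R"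
    using g h polys_carrier subringE(1)[OF A] by auto
  have "g \<oplus> h = (a \<oplus> b) \<oplus> x \<otimes> (g' \<oplus> h')"
    unfolding g(3) h(3) using c x by algebra
  then show ?case using polysI[of "a \<oplus> b" A "g' \<oplus> h'" x d] Suc(1)[OF g(2) h(2)] subringE(7)[OF A] g h by metis
qed

lemma smult_polys: "a \<in> A \<Longrightarrow> g \<in> polys A x d \<Longrightarrow> a \<otimes> g \<in> polys A x d"
proof (induct d arbitrary: g)
  case 0
  then show ?case using subringE(6)[OF A] by simp
next
  case (Suc d)
  then obtain b g' where g: "b \<in> A" "g' \<in> polys A x d" "g = b \<oplus> x \<otimes> g'" by auto
  have c: "a \<in> carrier R" "b \<in> carrier R" "g' \<in> carrier R"
    using g Suc polys_carrier subringE(1)[OF A] by auto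
  have "a \<otimes> g = a \<otimes> b \<oplus> x \<otimes> (a \<otimes> g')"
    unfolding g(3) using c x by algebra
  then show ?case using polysI[of "a \<otimes> b" A "a \<otimes> g'" x d] Suc(1)[OF Suc(2) g(2)] subringE(6)[OF A] g Suc(2) by metis
qed

lemma uminus_polys: "g \<in> polys A x d \<Longrightarrow> \<ominus> g \<in> polys A x d"
  using smult_polys[of "\<ominus> \<one>" g d] subringE(3,5)[OF A] polys_carrier[of g d] by (simp add: l_minus)

lemma mult_polys: "g \<in> polys A x d \<Longrightarrow> h \<in> polys A x e \<Longrightarrow> g \<otimes> h \<in> polys A x (d + e)"
proof (induct d arbitrary: g)
  case 0
  then show ?case using smult_polys by simp
next
  case (Suc d)
  then obtain b g' where g: "b \<in> A" "g' \<in> polys A x d" "g = b \<oplus> x \<otimes> g'" by auto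
  have c: "b \<in> carrier R" "g' \<in> carrier R" "h \<in> carrier R"
    using g Suc polys_carrier subringE(1)[OF A] by auto
  have "g \<otimes> h = b \<otimes> h \<oplus> x \<otimes> (g' \<otimes> h)"
    unfolding g(3) using c x by algebra
  moreover have "b \<otimes> h \<in> polys A x (Suc (d + e))"
    using smult_polys[OF g(1) Suc(3)] polys_mono[of e "Suc (d + e)"] by simp
  ultimately show ?case using add_polys var_mult_polys[OF Suc(1)[OF g(2) Suc(3)]] by (metis add_Suc)
qed

lemma pow_polys: "x [^] d \<in> polys A x d"
proof (induct d)
  case (Suc d)
  then show ?case using var_mult_polys[OF Suc] x by (simp add: m_comm)
qed (use subringE(3)[OF A] in auto)

lemma subring_polys: "subring (\<Union>d. polys A x d) R"
proof (rule subringI)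
  fix g h assume "g \<in> (\<Union>d. polys A x d)" "h \<in> (\<Union>d. polys A x d)"
  then obtain d e where de: "g \<in> polys A x d" "h \<in> polys A x e" by auto
  show "g \<otimes> h \<in> (\<Union>d. polys A x d)" using mult_polys[OF de] by auto
  have "g \<oplus> h \<in> polys A x (max d e)"
    using add_polys polys_mono[OF max.cobounded1 de(1)] polys_mono[OF max.cobounded2 de(2)] by blast
  then show "g \<oplus> h \<in> (\<Union>d. polys A x d)" by auto
next
  show "(\<Union>d. polys A x d) \<subseteq> carrier R" using polys_carrier by auto
  show "\<one> \<in> (\<Union>d. polys A x d)" using base_polys[OF subringE(3)[OF A]] by auto
  show "\<And>h. h \<in> (\<Union>d. polys A x d) \<Longrightarrow> \<ominus> h \<in> (\<Union>d. polys A x d)" using uminus_polys by auto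
qed

lemma polys_subset: "subring B R \<Longrightarrow> A \<subseteq> B \<Longrightarrow> x \<in> B \<Longrightarrow> polys A x d \<subseteq> B"
  by (induct d) (auto simp: subringE(6,7) subset_iff)

lemma polys_simple_extension: "g \<in> polys A x d \<Longrightarrow> g \<in> simple_extension A x"
proof (induct d arbitrary: g)
  case 0
  then show ?case using simple_extension_incl[OF subringE(1)[OF A] x] by auto
next
  case (Suc d)
  then obtain b g' where g: "b \<in> A" "g' \<in> polys A x d" "g = b \<oplus> x \<otimes> g'" by auto
  have c: "b \<in> carrier R" "g' \<in> carrier R"
    using g polys_carrier subringE(1)[OF A] by auto
  then show ?case using simple_extension.lin[OF Suc(1)[OF g(2)] g(1)] g(3) x by (simp add: m_comm a_comm)
qed

text \<open>Horner form gives access to the constant term only; the exchange argument for valuation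
  rings has to remove the top term.\<close>

lemma polys_top:
  assumes "g \<in> polys A x (Suc d)"
  obtains r c where "r \<in> polys A x d" "c \<in> A" "g = r \<oplus> c \<otimes> x [^] Suc d"
proof -
  have "\<exists>r c. r \<in> polys A x d \<and> c \<in> A \<and> g = r \<oplus> c \<otimes> x [^] Suc d"
    using assms
  proof (induct d arbitrary: g)
    case 0
    then obtain a b where ab: "a \<in> A" "b \<in> A" "g = a \<oplus> x \<otimes> b" by auto
    then have "g = a \<oplus> b \<otimes> x [^] Suc 0" using x subringE(1)[OF A] m_comm by (auto simp: subset_iff)
    then show ?case using ab by auto
  next
    case (Suc d)
    then obtain a h where a: "a \<in> A" "h \<in> polys A x (Suc d)" "g = a \<oplus> x \<otimes> h" by auto
    obtain r c where rc: "r \<in> polys A x d" "c \<in> A" "h = r \<oplus> c \<otimes> x [^] Suc d"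
      using Suc(1)[OF a(2)] by blast
    have C: "a \<in> carrier R" "c \<in> carrier R" "r \<in> carrier R"
      using a rc subringE(1)[OF A] polys_carrier by auto
    have "x [^] Suc (Suc d) = x [^] Suc d \<otimes> x" by simp
    have "g = (a \<oplus> x \<otimes> r) \<oplus> c \<otimes> (x [^] Suc d \<otimes> x)"
      unfolding a(3) rc(3) using C x nat_pow_closed[OF x, of "Suc d"] by algebra
    then show ?case using polysI[OF a(1) rc(1)] rc(2) by auto
  qed
  then show thesis using that by blast
qed

end

end

context field
begin

text \<open>Clearing denominators reverses the coefficients of a polynomial in 1/x.\<close>

lemma pow_mult_polys_inv:
  assumes A: "subring A R" and x: "x \<in> carrier R" "x \<noteq> \<zero>" and g: "g \<in> polys A (inv x) d"
  shows "x [^] d \<otimes> g \<in> polys A x d"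
  using g
proof (induct d arbitrary: g)
  case 0
  then show ?case using subringE(1)[OF A] by auto
next
  case (Suc d)
  have ix: "inv x \<in> carrier R" "x \<otimes> inv x = \<one>" using x by (auto simp: field_Units)
  obtain b h where g: "b \<in> A" "h \<in> polys A (inv x) d" "g = b \<oplus> inv x \<otimes> h" using Suc(2) by auto
  have c: "b \<in> carrier R" "h \<in> carrier R"
    using g polys_carrier[OF A] ix subringE(1)[OF A] by auto
  have "x [^] Suc d \<otimes> g = b \<otimes> x [^] Suc d \<oplus> (x \<otimes> inv x) \<otimes> (x [^] d \<otimes> h)"
    unfolding g(3) nat_pow_Suc using c x ix(1) nat_pow_closed[OF x(1), of d] by algebra
  then have "x [^] Suc d \<otimes> g = b \<otimes> x [^] Suc d \<oplus> x [^] d \<otimes> h" using ix x c by simp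
  then show ?case
    using add_polys[OF A x(1) smult_polys[OF A x(1) g(1) pow_polys[OF A x(1)]]
       polys_Suc[OF A x(1) Suc(1)[OF g(2)]]] by metis
qed

text \<open>Transcendence in the form used by inductions on Horner form: it is applied to one
  constant term at a time.\<close>

lemma transcendental_polysD:
  assumes k: "subring k R" and x: "x \<in> carrier R" and tr: "(transcendental over k) x"
    and a: "a \<in> k" and g: "g \<in> polys k x d" and eq: "a \<oplus> x \<otimes> g = \<zero>"
  shows "a = \<zero>"
proof (rule ccontr)
  assume a0: "a \<noteq> \<zero>"
  obtain p where p: "p \<in> carrier (k[X])" "eval p x = g"
    using polys_simple_extension[OF k x g] simple_extension_as_eval_img[OF subringE(1)[OF k] x] by auto
  have pol: "polynomial k p" using p(1) by (simp add: univ_poly_carrier)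
  have sp: "set p \<subseteq> carrier R" "a \<in> carrier R" "set p \<subseteq> k"
    using polynomial_incl[OF pol] subringE(1)[OF k] a by auto
  have gc: "g \<in> carrier R" using polys_carrier[OF k x g] .
  \<comment> \<open>Coefficient lists begin with the leading coefficient, so \<open>p @ [a]\<close>
    stands for p X + a.\<close>
  have "eval (normalize (p @ [a])) x = g \<otimes> x \<oplus> a"
    using eval_append_aux[of p a x] eval_normalize[of "p @ [a]" x] x sp p(2) by auto
  also have "\<dots> = \<zero>" using eq gc x sp by (simp add: m_comm a_comm)
  finally have z: "eval (normalize (p @ [a])) x = \<zero>" .
  have "normalize (p @ [a]) \<in> carrier (k[X])"
    using normalize_gives_polynomial[of "p @ [a]" k] a sp by (simp add: univ_poly_carrier)
  then have "normalize (p @ [a]) = []" using eval_transcendental[OF tr _ z] by blast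
  moreover have "normalize (p @ [a]) \<noteq> []" using a0
    by (induct p) auto
  ultimately show False by simp
qed

end

section \<open>Existence of valuation rings\<close>

context field
begin

lemma inv_nonzero: "x \<in> carrier R \<Longrightarrow> x \<noteq> \<zero> \<Longrightarrow> inv x \<in> carrier R \<and> inv x \<noteq> \<zero> \<and> x \<otimes> inv x = \<one> \<and> inv x \<otimes> x = \<one> \<and> inv (inv x) = x"
  by (metis field_Units Units_inv_closed Units_inv_inv Units_l_inv Units_r_inv DiffI empty_iff insert_iff l_null one_not_zero)

lemma subfield_inv_closed: "subfield K R \<Longrightarrow> x \<in> K \<Longrightarrow> x \<noteq> \<zero> \<Longrightarrow> inv x \<in> K"
  using subfield_m_inv(1) by auto

text \<open>Descent step of Chevalley's extension theorem: of two expressions for 1/x, one in w and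
  one in 1/w, the shorter is used to shorten the longer.\<close>

lemma polys_exchange:
  assumes V: "subring V R" and w: "w \<in> carrier R" "w \<noteq> \<zero>" and x: "x \<in> V" "x \<noteq> \<zero>" "inv x \<notin> V"
    and n: "inv x \<in> polys V w n" and m: "inv x \<in> polys V (inv w) m" and mn: "m \<le> n"
  obtains n' where "n' < n" "inv x \<in> polys V w n'"
proof -
  note iw = inv_nonzero[OF w]
  have xc: "x \<in> carrier R" using x subringE(1)[OF V] by auto
  note ix = inv_nonzero[OF xc x(2)]
  obtain m' where m': "m = Suc m'" using m x(3) by (cases m) auto
  obtain n' where n': "n = Suc n'" using n x(3) by (cases n) auto
  obtain d s where ds: "d \<in> V" "s \<in> polys V (inv w) m'" "inv x = d \<oplus> inv w \<otimes> s"
    using m unfolding m' by auto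
  obtain r c where rc: "r \<in> polys V w n'" "c \<in> V" "inv x = r \<oplus> c \<otimes> w [^] Suc n'"
    using polys_top[OF V w(1)] n unfolding n' by metis
  have C: "d \<in> carrier R" "s \<in> carrier R" "r \<in> carrier R" "c \<in> carrier R" "inv x \<in> carrier R"
      "w [^] n' \<in> carrier R"
    using ds rc subringE(1)[OF V] polys_carrier[OF V] iw w ix by auto
  \<comment> \<open>The second expression shows e = x s / w. Writing 1/x = d + e (1/x) and inserting
    the first expression, the factor 1/w in e lowers the top term c w^n to degree n - 1, and the
    factor x keeps coefficients in \<open>V\<close>.\<close>
  define e where "e = \<one> \<ominus> x \<otimes> d"
  have e: "e \<in> V" "e \<in> carrier R" unfolding e_def using ds x subringE[OF V] C xc by (auto simp: a_minus_def)
  have "x \<otimes> (inv w \<otimes> s) = x \<otimes> (d \<oplus> inv w \<otimes> s) \<ominus> x \<otimes> d"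
    using C xc iw[THEN conjunct1] by algebra
  then have e2: "e = x \<otimes> (inv w \<otimes> s)" unfolding e_def using ds(3) ix by simp
  have "inv x = (x \<otimes> d) \<otimes> inv x \<oplus> e \<otimes> inv x"
    unfolding e_def using C xc by algebra
  also have "(x \<otimes> d) \<otimes> inv x = (x \<otimes> inv x) \<otimes> d" using C xc by algebra
  also have "\<dots> = d" using ix C by simp
  also have "e \<otimes> inv x = e \<otimes> r \<oplus> e \<otimes> (c \<otimes> w [^] Suc n')"
    using rc(3) C e w nat_pow_closed[OF w(1), of "Suc n'"] by (simp add: r_distr)
  also have "e \<otimes> (c \<otimes> w [^] Suc n') = (x \<otimes> c) \<otimes> (w [^] n' \<otimes> ((w \<otimes> inv w) \<otimes> s))"
    unfolding e2 nat_pow_Suc using C w iw[THEN conjunct1] xc by algebra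
  also have "\<dots> = (x \<otimes> c) \<otimes> (w [^] (n' - m') \<otimes> (w [^] m' \<otimes> s))"
    using iw C w mn nat_pow_mult[OF w(1), of "n' - m'" m'] by (simp add: m_assoc[symmetric] m' n')
  finally have eq: "inv x = d \<oplus> (e \<otimes> r \<oplus> (x \<otimes> c) \<otimes> (w [^] (n' - m') \<otimes> (w [^] m' \<otimes> s)))" .
  have "w [^] m' \<otimes> s \<in> polys V w m'" using pow_mult_polys_inv[OF V w ds(2)] .
  from mult_polys[OF V w(1) pow_polys[OF V w(1)] this, of "n' - m'"]
  have "w [^] (n' - m') \<otimes> (w [^] m' \<otimes> s) \<in> polys V w n'" using mn m' n' by simp
  then have "inv x \<in> polys V w n'"
    unfolding eq using smult_polys[OF V w(1)] add_polys[OF V w(1)] base_polys[OF V w(1)]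
      e rc ds subringE(6)[OF V x(1) rc(2)] by metis
  then show thesis using that n' by blast
qed

text \<open>By Zorn there is a subring of \<open>K\<close> maximal among those that contain
  \<open>A\<close> and avoid 1/x; maximality forces it to contain z or 1/z for every z.\<close>

lemma exists_valuation_ring:
  assumes K: "subfield K R" and A: "subring A R" "A \<subseteq> K" and x: "x \<in> A" "x \<noteq> \<zero>" "inv x \<notin> A"
  obtains V where "subring V R" "A \<subseteq> V" "V \<subseteq> K" "inv x \<notin> V" "\<And>z. z \<in> K \<Longrightarrow> z \<noteq> \<zero> \<Longrightarrow> z \<in> V \<or> inv z \<in> V"
proof -
  define \<F> where "\<F> = {B. subring B R \<and> A \<subseteq> B \<and> B \<subseteq> K \<and> inv x \<notin> B}"
  have "\<exists>M\<in>\<F>. \<forall>B\<in>\<F>. M \<subseteq> B \<longrightarrow> B = M"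
  proof (rule subset_Zorn_nonempty)
    show "\<F> \<noteq> {}" using A x by (auto simp: \<F>_def)
    fix C assume C: "C \<noteq> {}" "subset.chain \<F> C"
    then have CF: "\<And>B. B \<in> C \<Longrightarrow> subring B R \<and> A \<subseteq> B \<and> B \<subseteq> K \<and> inv x \<notin> B"
      and lin: "\<And>B B'. B \<in> C \<Longrightarrow> B' \<in> C \<Longrightarrow> B \<subseteq> B' \<or> B' \<subseteq> B"
      by (auto simp: subset_chain_def \<F>_def)
    obtain B0 where B0: "B0 \<in> C" using C(1) by blast
    have "subring (\<Union>C) R"
    proof (rule subringI)
      show "\<Union>C \<subseteq> carrier R" using CF by (metis Sup_least subringE(1))
      show "\<one> \<in> \<Union>C" using CF[OF B0] B0 by (metis UnionI subringE(3))
      show "\<ominus> h \<in> \<Union>C" if "h \<in> \<Union>C" for h using that CF by (metis Union_iff subringE(5))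
      fix g h assume "g \<in> \<Union>C" "h \<in> \<Union>C"
      then obtain B where "B \<in> C" "g \<in> B" "h \<in> B" using lin by blast
      then show "g \<otimes> h \<in> \<Union>C" "g \<oplus> h \<in> \<Union>C" using CF by (metis UnionI subringE(6), metis UnionI subringE(7))
    qed
    then show "\<Union>C \<in> \<F>" using CF B0 by (auto simp: \<F>_def)
  qed
  then obtain V where V: "subring V R" "A \<subseteq> V" "V \<subseteq> K" "inv x \<notin> V"
    and max: "\<And>B. subring B R \<Longrightarrow> V \<subseteq> B \<Longrightarrow> B \<subseteq> K \<Longrightarrow> inv x \<notin> B \<Longrightarrow> B = V" by (auto simp: \<F>_def)
  have xV: "x \<in> V" using V x by auto
  \<comment> \<open>Adjoining an element outside \<open>V\<close> gives a strictly larger ring,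
    which by maximality must contain 1/x.\<close>
  have mem: "\<exists>n. inv x \<in> polys V w n" if w: "w \<in> K" "w \<notin> V" for w
  proof -
    have wc: "w \<in> carrier R" using w subfieldE(3)[OF K] by auto
    have "w \<in> polys V w (Suc 0)" using pow_polys[OF V(1) wc, of "Suc 0"] wc by (simp del: polys.simps)
    then have "(\<Union>n. polys V w n) \<noteq> V" using w by blast
    moreover have "V \<subseteq> (\<Union>n. polys V w n)" using base_polys[OF V(1) wc] by blast
    ultimately show ?thesis
      using max[OF subring_polys[OF V(1) wc]] polys_subset[OF V(1) wc subfieldE(1)[OF K] V(3) w(1)] by blast
  qed
  have "z \<in> V \<or> inv z \<in> V" if z: "z \<in> K" "z \<noteq> \<zero>" for z
  proof (rule ccontr)
    assume neg: "\<not> (z \<in> V \<or> inv z \<in> V)"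
    have zc: "z \<in> carrier R" using z subfieldE(3)[OF K] by auto
    note iz = inv_nonzero[OF zc z(2)]
    have ex: "\<exists>n. inv x \<in> polys V z n" "\<exists>n. inv x \<in> polys V (inv z) n"
      using mem z neg subfield_inv_closed[OF K z] by auto
    \<comment> \<open>Both degrees are minimal, yet the exchange lowers the larger one; if n < m it
      is applied with z and 1/z interchanged.\<close>
    define n where "n = (LEAST n. inv x \<in> polys V z n)"
    define m where "m = (LEAST n. inv x \<in> polys V (inv z) n)"
    have nm: "inv x \<in> polys V z n" "inv x \<in> polys V (inv z) m"
      unfolding n_def m_def using LeastI_ex[OF ex(1)] LeastI_ex[OF ex(2)] by auto
    show False
    proof (cases "m \<le> n")
      case True
      then obtain n' where "n' < n" "inv x \<in> polys V z n'"
        using polys_exchange[OF V(1) zc z(2) xV x(2) V(4) nm] by blast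
      then show False unfolding n_def using not_less_Least by blast
    next
      case False
      then have "n \<le> m" by simp
      moreover have "inv x \<in> polys V (inv (inv z)) n" using nm iz by simp
      ultimately obtain n' where "n' < m" "inv x \<in> polys V (inv z) n'"
        using polys_exchange[OF V(1) _ _ xV x(2) V(4) nm(2), of n] iz by blast
      then show False unfolding m_def using not_less_Least by blast
    qed
  qed
  then show thesis using that V by blast
qed

end

section \<open>Places as maximal ideals of valuation rings\<close>

context field
begin

text \<open>For a valuation ring this is its maximal ideal. The elementwise description replaces
  ideal theory in all later arguments about places.\<close>

definition nonunits :: "'a set \<Rightarrow> 'a set" where
  "nonunits V = {x \<in> V. x = \<zero> \<or> inv x \<notin> V}"

lemma mem_nonunits: "x \<in> nonunits V \<longleftrightarrow> x \<in> V \<and> (x = \<zero> \<or> inv x \<notin> V)"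
  by (simp add: nonunits_def)

lemma inv_mult:
  assumes "x \<in> carrier R" "x \<noteq> \<zero>" "y \<in> carrier R" "y \<noteq> \<zero>"
  shows "inv (x \<otimes> y) = inv x \<otimes> inv y"
proof -
  have i: "inv x \<in> carrier R" "inv y \<in> carrier R" "x \<otimes> inv x = \<one>" "y \<otimes> inv y = \<one>"
    using inv_nonzero assms by auto
  have "(x \<otimes> y) \<otimes> (inv x \<otimes> inv y) = (x \<otimes> inv x) \<otimes> (y \<otimes> inv y)"
    using assms(1,3) i(1,2) by algebra
  then show ?thesis using i assms by (intro comm_inv_char) auto
qed

lemma valuation_ringD:
  assumes "valuation_ring k K V"
  shows "subring V R" "k \<subseteq> V" "k \<noteq> V" "V \<subseteq> K" "V \<noteq> K" "\<And>z. z \<in> K \<Longrightarrow> z \<noteq> \<zero> \<Longrightarrow> z \<in> V \<or> inv z \<in> V"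
  using assms by (auto simp: valuation_ring_def)

lemma nonunits_smult:
  assumes "valuation_ring k K V" "a \<in> V" "y \<in> nonunits V"
  shows "a \<otimes> y \<in> nonunits V"
proof -
  note V = valuation_ringD(1)[OF assms(1)]
  have c: "a \<in> carrier R" "y \<in> carrier R" using assms subringE(1)[OF V] by (auto simp: mem_nonunits)
  have "inv (a \<otimes> y) \<notin> V" if "a \<otimes> y \<noteq> \<zero>"
  proof
    assume i: "inv (a \<otimes> y) \<in> V"
    have nz: "a \<noteq> \<zero>" "y \<noteq> \<zero>" using that c by auto
    note ia = inv_nonzero[OF c(1) nz(1)] and iy = inv_nonzero[OF c(2) nz(2)]
    have "inv y = a \<otimes> inv (a \<otimes> y)"
      using inv_mult[OF c(1) nz(1) c(2) nz(2)] ia iy c by (simp add: m_assoc[symmetric])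
    then have "inv y \<in> V" using subringE(6)[OF V assms(2) i] by simp
    then show False using assms(3) nz by (auto simp: mem_nonunits)
  qed
  then show ?thesis using subringE(6)[OF V assms(2)] assms(3) by (auto simp: mem_nonunits)
qed

text \<open>One of y/x and x/y is integral, so the sum is a multiple of x or of y by an element of
  \<open>V\<close>.\<close>

lemma nonunits_add:
  assumes VR: "valuation_ring k K V" and K: "subfield K R"
    and x: "x \<in> nonunits V" and y: "y \<in> nonunits V"
  shows "x \<oplus> y \<in> nonunits V"
proof -
  note V = valuation_ringD[OF VR]
  have xy: "x \<in> V" "y \<in> V" using x y by (auto simp: mem_nonunits)
  then have c: "x \<in> carrier R" "y \<in> carrier R" using subringE(1)[OF V(1)] by auto
  have *: "x \<oplus> y \<in> nonunits V"
    if "x \<in> nonunits V" "y \<in> V" "y = x \<otimes> u" "u \<in> V" for x y u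
  proof -
    have c: "x \<in> carrier R" "u \<in> carrier R" using that subringE(1)[OF V(1)] by (auto simp: mem_nonunits)
    then have "x \<oplus> y = (\<one> \<oplus> u) \<otimes> x" using that(3) by algebra
    then show ?thesis using nonunits_smult[OF VR _ that(1), of "\<one> \<oplus> u"] subringE(3,7)[OF V(1)] that by auto
  qed
  consider "x = \<zero>" | "y = \<zero>" | "x \<noteq> \<zero>" "y \<noteq> \<zero>" by blast
  then show ?thesis
  proof cases
    case 3
    have ix: "inv x \<in> carrier R" "x \<otimes> inv x = \<one>" "inv x \<in> K" "inv x \<noteq> \<zero>"
      using inv_nonzero[OF c(1) 3(1)] subfield_inv_closed[OF K _ 3(1)] xy V(4) by auto
    have iy: "inv y \<in> carrier R" "y \<otimes> inv y = \<one>" "inv y \<noteq> \<zero>" "inv (inv y) = y"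
      using inv_nonzero[OF c(2) 3(2)] by auto
    have "y \<otimes> inv x \<in> K" "y \<otimes> inv x \<noteq> \<zero>"
      using ix xy V(4) subringE(6)[OF subfieldE(1)[OF K], of y "inv x"] 3 c integral by auto
    moreover have "inv (y \<otimes> inv x) = x \<otimes> inv y"
      using inv_mult[OF c(2) 3(2) ix(1,4)] inv_nonzero[OF c(1) 3(1)] iy c by (simp add: m_comm)
    ultimately have "y \<otimes> inv x \<in> V \<or> x \<otimes> inv y \<in> V" using V(6)[of "y \<otimes> inv x"] by simp
    moreover have "y = x \<otimes> (y \<otimes> inv x)" "x = y \<otimes> (x \<otimes> inv y)"
      using ix iy c by (metis m_comm m_lcomm r_one)+
    ultimately show ?thesis using *[OF x xy(2), of "y \<otimes> inv x"] *[OF y xy(1), of "x \<otimes> inv y"] c by (metis a_comm)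
  qed (use x y c in auto)
qed

text \<open>An ideal that contains an element outside \<open>nonunits V\<close> contains a unit.
  Hence a place and its valuation ring determine each other.\<close>

lemma nonunits_maximalideal:
  assumes VR: "valuation_ring k K V" and K: "subfield K R"
  shows "maximalideal (nonunits V) (R\<lparr>carrier := V\<rparr>)" 
    and "maximalideal P (R\<lparr>carrier := V\<rparr>) \<Longrightarrow> P = nonunits V"
proof -
  note V = valuation_ringD[OF VR]
  interpret V: ring "R\<lparr>carrier := V\<rparr>" using subring_is_ring[OF V(1)] .
  have comm: "\<And>a b. a \<in> V \<Longrightarrow> b \<in> V \<Longrightarrow> a \<otimes> b = b \<otimes> a" using subringE(1)[OF V(1)] m_comm by blast
  have id: "ideal (nonunits V) (R\<lparr>carrier := V\<rparr>)"
  proof (rule idealI[OF V.ring_axioms])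
    show "subgroup (nonunits V) (add_monoid (R\<lparr>carrier := V\<rparr>))"
    proof (rule V.add.subgroupI)
      show "nonunits V \<noteq> {}" using subringE(2)[OF V(1)] by (auto simp: nonunits_def)
      fix a assume a: "a \<in> nonunits V"
      have "\<ominus>\<^bsub>R\<lparr>carrier := V\<rparr>\<^esub> a = \<ominus>\<^bsub>R\<lparr>carrier := V\<rparr>\<^esub> \<one> \<otimes> a"
        using V.l_minus[of \<one> a] V.one_closed a by (simp add: mem_nonunits subringE(1)[OF V(1), THEN subsetD])
      then show "\<ominus>\<^bsub>R\<lparr>carrier := V\<rparr>\<^esub> a \<in> nonunits V"
        using nonunits_smult[OF VR _ a, of "\<ominus>\<^bsub>R\<lparr>carrier := V\<rparr>\<^esub> \<one>"] V.a_inv_closed[OF V.one_closed]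
        by simp
    next
      fix a b assume "a \<in> nonunits V" "b \<in> nonunits V"
      then show "a \<oplus>\<^bsub>R\<lparr>carrier := V\<rparr>\<^esub> b \<in> nonunits V" using nonunits_add[OF VR K] by simp
    qed (auto simp: nonunits_def)
    fix a x assume ax: "a \<in> nonunits V" "x \<in> carrier (R\<lparr>carrier := V\<rparr>)"
    then show "x \<otimes>\<^bsub>R\<lparr>carrier := V\<rparr>\<^esub> a \<in> nonunits V" using nonunits_smult[OF VR] by simp
    then show "a \<otimes>\<^bsub>R\<lparr>carrier := V\<rparr>\<^esub> x \<in> nonunits V" using comm ax by (simp add: mem_nonunits)
  qed
  have unit: "J = V" if J: "ideal J (R\<lparr>carrier := V\<rparr>)" and u: "u \<in> J" "u \<in> V" "u \<notin> nonunits V" for J u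
  proof -
    have "inv u \<in> V" "u \<noteq> \<zero>" using u by (auto simp: mem_nonunits)
    then have "\<one> \<in> J" using ideal.I_l_closed[OF J u(1), of "inv u"] u(2) subringE(1)[OF V(1)] inv_nonzero[of u] by auto
    then show "J = V" using ideal.one_imp_carrier[OF J] by simp
  qed
  have one: "\<one> \<notin> nonunits V" "\<one> \<in> V" using subringE(3)[OF V(1)] by (auto simp: mem_nonunits)
  show m: "maximalideal (nonunits V) (R\<lparr>carrier := V\<rparr>)"
  proof (rule maximalidealI[OF id])
    show "carrier (R\<lparr>carrier := V\<rparr>) \<noteq> nonunits V" using one by auto
    fix J assume "ideal J (R\<lparr>carrier := V\<rparr>)" "nonunits V \<subseteq> J" "J \<subseteq> carrier (R\<lparr>carrier := V\<rparr>)"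
    then show "J = nonunits V \<or> J = carrier (R\<lparr>carrier := V\<rparr>)" using unit[of J] by auto
  qed
  show "P = nonunits V" if P: "maximalideal P (R\<lparr>carrier := V\<rparr>)"
  proof -
    have Pi: "ideal P (R\<lparr>carrier := V\<rparr>)" "V \<noteq> P"
      using P maximalideal.I_notcarr[OF P] by (auto simp: maximalideal_def)
    have PV: "P \<subseteq> V" using ideal.Icarr[OF Pi(1)] by auto
    then have "P \<subseteq> nonunits V" using unit[OF Pi(1)] Pi(2) by blast
    moreover have "nonunits V \<subseteq> V" by (auto simp: mem_nonunits)
    moreover have "nonunits V \<noteq> V" using one by metis
    ultimately show ?thesis using maximalideal.I_maximal[OF P id] by simp
  qed
qed

end

locale finite_function_field = field +
  fixes k K
  assumes ff: "function_field k K" and finite_k: "finite k"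
begin

lemma subfield_k: "subfield k R" and subfield_K: "subfield K R" and k_subset_K: "k \<subseteq> K"
  using ff by (auto simp: function_field_def)

lemma K_carrier [simp, intro]: "x \<in> K \<Longrightarrow> x \<in> carrier R"
  using subfieldE(3)[OF subfield_K] by auto

lemma k_K [simp, intro]: "x \<in> k \<Longrightarrow> x \<in> K"
  using k_subset_K by auto

lemma K_closed [simp, intro]:
  "\<zero> \<in> K" "\<one> \<in> K" "x \<in> K \<Longrightarrow> y \<in> K \<Longrightarrow> x \<oplus> y \<in> K" "x \<in> K \<Longrightarrow> y \<in> K \<Longrightarrow> x \<otimes> y \<in> K"
  "x \<in> K \<Longrightarrow> \<ominus> x \<in> K" "x \<in> K \<Longrightarrow> y \<in> K \<Longrightarrow> x \<ominus> y \<in> K" "x \<in> K \<Longrightarrow> x \<noteq> \<zero> \<Longrightarrow> inv x \<in> K"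
  using subringE[OF subfieldE(1)[OF subfield_K]] subfield_inv_closed[OF subfield_K] by (auto simp: a_minus_def)

lemma k_closed [simp, intro]:
  "\<zero> \<in> k" "\<one> \<in> k" "x \<in> k \<Longrightarrow> y \<in> k \<Longrightarrow> x \<oplus> y \<in> k" "x \<in> k \<Longrightarrow> y \<in> k \<Longrightarrow> x \<otimes> y \<in> k"
  "x \<in> k \<Longrightarrow> \<ominus> x \<in> k" "x \<in> k \<Longrightarrow> y \<in> k \<Longrightarrow> x \<ominus> y \<in> k" "x \<in> k \<Longrightarrow> x \<noteq> \<zero> \<Longrightarrow> inv x \<in> k"
  using subringE[OF subfieldE(1)[OF subfield_k]] subfield_inv_closed[OF subfield_k] by (auto simp: a_minus_def)

lemma K_pow [simp, intro]: "x \<in> K \<Longrightarrow> x [^] (n::nat) \<in> K"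
  by (induct n) auto

lemma card_k: "card k \<ge> 2"
proof -
  have "card {\<zero>, \<one>} \<le> card k" by (rule card_mono) (use finite_k in auto)
  then show ?thesis by simp
qed

lemma transcendental_k: "z \<in> K \<Longrightarrow> z \<notin> k \<Longrightarrow> (transcendental over k) z"
  using ff by (auto simp: function_field_def over_def)

lemma nonunits_place:
  assumes "valuation_ring k K V"
  shows "nonunits V \<in> places k K"
    and "place_ring K (nonunits V) = V"
proof -
  note V = valuation_ringD[OF assms]
  show "nonunits V \<in> places k K"
    using nonunits_maximalideal(1)[OF assms subfield_K] assms unfolding places_def by blast
  have "x \<in> place_ring K (nonunits V) \<longleftrightarrow> x \<in> V" for x
  proof (cases "x \<in> K \<and> x \<noteq> \<zero>")
    case True
    then show ?thesis using V inv_nonzero[of x] by (auto simp: place_ring_def mem_nonunits)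
  next
    case False
    then show ?thesis using V(4) subringE(2)[OF V(1)] by (auto simp: place_ring_def mem_nonunits)
  qed
  then show "place_ring K (nonunits V) = V" by blast
qed

lemma place_valuation_ring:
  assumes "P \<in> places k K"
  shows "valuation_ring k K (place_ring K P)"
    and "P = nonunits (place_ring K P)"
proof -
  obtain V where V: "valuation_ring k K V" "maximalideal P (R\<lparr>carrier := V\<rparr>)"
    using assms unfolding places_def by blast
  have "P = nonunits V" using nonunits_maximalideal(2)[OF V(1) subfield_K V(2)] .
  then show "valuation_ring k K (place_ring K P)" "P = nonunits (place_ring K P)"
    using V nonunits_place(2)[OF V(1)] by auto
qed

end

locale place = finite_function_field +
  fixes P
  assumes P: "P \<in> places k K"
begin

abbreviation "V \<equiv> place_ring K P"

lemmas V_props = valuation_ringD[OF place_valuation_ring(1)[OF P]]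

lemma V_K [simp, intro]: "x \<in> V \<Longrightarrow> x \<in> K" and k_V [simp, intro]: "x \<in> k \<Longrightarrow> x \<in> V"
  using V_props by auto

lemma V_closed [simp, intro]:
  "\<zero> \<in> V" "\<one> \<in> V" "x \<in> V \<Longrightarrow> y \<in> V \<Longrightarrow> x \<oplus> y \<in> V" "x \<in> V \<Longrightarrow> y \<in> V \<Longrightarrow> x \<otimes> y \<in> V"
  "x \<in> V \<Longrightarrow> \<ominus> x \<in> V" "x \<in> V \<Longrightarrow> y \<in> V \<Longrightarrow> x \<ominus> y \<in> V"
  using subringE[OF V_props(1)] by (auto simp: a_minus_def)

lemma P_eq: "P = nonunits V"
  using place_valuation_ring(2)[OF P] .

lemma mem_P_iff: "x \<in> P \<longleftrightarrow> x \<in> V \<and> (x = \<zero> \<or> inv x \<notin> V)"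
  using place_valuation_ring(2)[OF P] mem_nonunits by metis

lemma P_V [simp, intro]: "x \<in> P \<Longrightarrow> x \<in> V"
  unfolding mem_P_iff by simp

lemma P_smult [simp, intro]: "a \<in> V \<Longrightarrow> x \<in> P \<Longrightarrow> a \<otimes> x \<in> P"
  using nonunits_smult[OF place_valuation_ring(1)[OF P], of a x] P_eq by metis

lemma P_smult' [simp, intro]: "a \<in> V \<Longrightarrow> x \<in> P \<Longrightarrow> x \<otimes> a \<in> P"
  using P_smult[of a x] m_comm[of a x] by simp

lemma P_closed [simp, intro]:
  "\<zero> \<in> P" "x \<in> P \<Longrightarrow> y \<in> P \<Longrightarrow> x \<oplus> y \<in> P" "x \<in> P \<Longrightarrow> \<ominus> x \<in> P" "x \<in> P \<Longrightarrow> y \<in> P \<Longrightarrow> x \<ominus> y \<in> P"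
proof -
  show *: "x \<oplus> y \<in> P" if "x \<in> P" "y \<in> P" for x y
    using nonunits_add[OF place_valuation_ring(1)[OF P] subfield_K, of x y] that P_eq by metis
  show **: "\<ominus> x \<in> P" if "x \<in> P" for x using P_smult[of "\<ominus> \<one>" x] that by (simp add: l_minus)
  show "x \<ominus> y \<in> P" if "x \<in> P" "y \<in> P" for x y using * ** that by (simp add: a_minus_def)
  show "\<zero> \<in> P" unfolding mem_P_iff by simp
qed

lemma one_not_P [simp]: "\<one> \<notin> P"
  unfolding mem_P_iff by simp

lemma not_V_inv_P: "x \<in> K \<Longrightarrow> x \<notin> V \<Longrightarrow> inv x \<in> P"
  using V_props(6)[of x] inv_nonzero[of x] unfolding mem_P_iff by (cases "x = \<zero>") auto

lemma k_inter_P: "x \<in> k \<Longrightarrow> x \<in> P \<Longrightarrow> x = \<zero>"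
  using k_closed(7)[of x] unfolding mem_P_iff by auto

lemma exists_nonzero_P: "\<exists>z\<in>P. z \<noteq> \<zero>"
  using V_props(4,5) not_V_inv_P inv_nonzero by (metis K_carrier V_closed(1) subset_antisym subsetI)

lemma unit_iff: "x \<in> V \<Longrightarrow> x \<notin> P \<longleftrightarrow> x \<noteq> \<zero> \<and> inv x \<in> V"
  unfolding mem_P_iff by auto

end

section \<open>Independence over a ring of polynomial expressions\<close>

context ring
begin

primrec powers :: "'a \<Rightarrow> nat \<Rightarrow> 'a list" where
  "powers z 0 = []"
| "powers z (Suc n) = \<one> # map ((\<otimes>) z) (powers z n)"

lemma length_powers [simp]: "length (powers z n) = n"
  by (induct n) auto

end

context cring
begin

lemma combine_map_mult:
  assumes "set Ks \<subseteq> carrier R" "set Us \<subseteq> carrier R" "z \<in> carrier R"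
  shows "combine Ks (map ((\<otimes>) z) Us) = z \<otimes> combine Ks Us"
  using assms
proof (induct Ks Us rule: combine.induct)
  case (1 k Ks u Us)
  then show ?case by (simp add: r_distr m_lcomm)
qed (auto)

lemma combine_closed:
  assumes B: "\<And>x y. x \<in> B \<Longrightarrow> y \<in> B \<Longrightarrow> x \<oplus> y \<in> B" "\<zero> \<in> B"
    and "\<And>x u. x \<in> set Ks \<Longrightarrow> u \<in> set Us \<Longrightarrow> x \<otimes> u \<in> B"
  shows "combine Ks Us \<in> B"
  using assms(3) by (induct Ks Us rule: combine.induct) (auto intro!: B)

text \<open>Horner splitting of all coefficients of a linear combination simultaneously: the
  constant terms are separated from a multiple of \<open>x\<close>.\<close>

lemma combine_polys_split:
  assumes A: "subring A R" and x: "x \<in> carrier R" and Ks: "set Ks \<subseteq> polys A x (Suc d)"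
  obtains Cs Gs where "set Cs \<subseteq> A" "set Gs \<subseteq> polys A x d" "length Cs = length Ks" "length Gs = length Ks"
    "\<And>Us. set Us \<subseteq> carrier R \<Longrightarrow> combine Ks Us = combine Cs Us \<oplus> x \<otimes> combine Gs Us"
    "set Cs \<subseteq> {\<zero>} \<Longrightarrow> set Gs \<subseteq> {\<zero>} \<Longrightarrow> set Ks \<subseteq> {\<zero>}"
proof -
  have "\<exists>Cs Gs. set Cs \<subseteq> A \<and> set Gs \<subseteq> polys A x d \<and> length Cs = length Ks \<and> length Gs = length Ks \<and>
    (\<forall>Us. set Us \<subseteq> carrier R \<longrightarrow> combine Ks Us = combine Cs Us \<oplus> x \<otimes> combine Gs Us) \<and>
    (set Cs \<subseteq> {\<zero>} \<longrightarrow> set Gs \<subseteq> {\<zero>} \<longrightarrow> set Ks \<subseteq> {\<zero>})"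
    using Ks
  proof (induct Ks)
    case Nil
    then show ?case using x by auto
  next
    case (Cons a Ks)
    obtain Cs Gs where IH: "set Cs \<subseteq> A" "set Gs \<subseteq> polys A x d" "length Cs = length Ks" "length Gs = length Ks"
      "\<And>Us. set Us \<subseteq> carrier R \<Longrightarrow> combine Ks Us = combine Cs Us \<oplus> x \<otimes> combine Gs Us"
      "set Cs \<subseteq> {\<zero>} \<Longrightarrow> set Gs \<subseteq> {\<zero>} \<Longrightarrow> set Ks \<subseteq> {\<zero>}"
      using Cons by auto
    obtain c g where cg: "c \<in> A" "g \<in> polys A x d" "a = c \<oplus> x \<otimes> g" using Cons(2) by auto
    have car: "set Cs \<subseteq> carrier R" "set Gs \<subseteq> carrier R" "c \<in> carrier R" "g \<in> carrier R"
      using IH(1,2) cg subringE(1)[OF A] polys_carrier[OF A x] by auto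
    have "combine (a # Ks) Us = combine (c # Cs) Us \<oplus> x \<otimes> combine (g # Gs) Us" if Us: "set Us \<subseteq> carrier R" for Us
    proof (cases Us)
      case (Cons u Vs)
      then have C: "u \<in> carrier R" "combine Cs Vs \<in> carrier R" "combine Gs Vs \<in> carrier R"
        and e: "combine Ks Vs = combine Cs Vs \<oplus> x \<otimes> combine Gs Vs"
        using Us car IH(5)[of Vs] by auto
      show ?thesis unfolding Cons combine.simps e cg(3) using C car(3,4) x by algebra
    qed (use x in simp)
    then show ?case using IH cg x by (intro exI[of _ "c # Cs"] exI[of _ "g # Gs"]) auto
  qed
  then show thesis using that by blast
qed

lemma combine_zeros: "set Us \<subseteq> carrier R \<Longrightarrow> combine (replicate n \<zero>) Us = \<zero>"
proof (induct Us arbitrary: n)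
  case (Cons u Us)
  then show ?case by (cases n) auto
next
  case Nil
  then show ?case by (cases n) auto
qed

text \<open>Induction on the degree: \<open>step\<close> kills the constant terms, and what remains
  may be divided by \<open>x\<close>. Independence over A[x] is thereby reduced to a statement about
  constants modulo \<open>x\<close>.\<close>

lemma (in domain) polys_trivial_combine:
  assumes A: "subring A R" and x: "x \<in> carrier R" "x \<noteq> \<zero>" and Us: "set Us \<subseteq> carrier R"
    and step: "\<And>Cs Gs d. set Cs \<subseteq> A \<Longrightarrow> set Gs \<subseteq> polys A x d \<Longrightarrow> length Cs = length Us \<Longrightarrow> length Gs = length Us
      \<Longrightarrow> combine Cs Us \<oplus> x \<otimes> combine Gs Us = \<zero> \<Longrightarrow> set Cs \<subseteq> {\<zero>}"
  shows "set Ks \<subseteq> polys A x d \<Longrightarrow> length Ks = length Us \<Longrightarrow> combine Ks Us = \<zero> \<Longrightarrow> set Ks \<subseteq> {\<zero>}"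
proof (induct d arbitrary: Ks)
  case 0
  have "set (replicate (length Us) \<zero>) \<subseteq> polys A x 0" using zero_polys[OF A x(1), of 0] by auto
  moreover have "set Ks \<subseteq> carrier R" using 0 subringE(1)[OF A] by auto
  ultimately show ?case using step[of Ks "replicate (length Us) \<zero>" 0] 0 x combine_zeros[OF Us] by simp
next
  case (Suc d)
  obtain Cs Gs where s: "set Cs \<subseteq> A" "set Gs \<subseteq> polys A x d" "length Cs = length Ks" "length Gs = length Ks"
    "combine Ks Us = combine Cs Us \<oplus> x \<otimes> combine Gs Us"
    "set Cs \<subseteq> {\<zero>} \<Longrightarrow> set Gs \<subseteq> {\<zero>} \<Longrightarrow> set Ks \<subseteq> {\<zero>}"
    using combine_polys_split[OF A x(1) Suc(2)] Us by metis
  have C: "set Cs \<subseteq> {\<zero>}" using step[OF s(1,2)] s(3-5) Suc(3,4) by simp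
  have gc: "combine Gs Us \<in> carrier R" using s(2) polys_carrier[OF A x(1)] Us by (intro combine_in_carrier) auto
  have "Cs = replicate (length Cs) \<zero>" using C by (induct Cs) auto
  then have "combine Cs Us = \<zero>" using combine_zeros[OF Us] by metis
  then have "x \<otimes> combine Gs Us = \<zero>" using s(5) Suc(4) gc x by simp
  then have "combine Gs Us = \<zero>" using gc x integral by blast
  then have "set Gs \<subseteq> {\<zero>}" using Suc(1)[OF s(2)] s(4) Suc(3) by simp
  then show ?case using s(6) C by simp
qed

lemma powers_carrier: "z \<in> carrier R \<Longrightarrow> set (powers z n) \<subseteq> carrier R"
  by (induct n) auto

lemma combine_powers_polys:
  assumes A: "subring A R" and z: "z \<in> carrier R"
  shows "set Ks \<subseteq> A \<Longrightarrow> combine Ks (powers z n) \<in> polys A z n"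
proof (induct n arbitrary: Ks)
  case 0
  then show ?case using subringE(2)[OF A] by (cases Ks) auto
next
  case (Suc n)
  show ?case
  proof (cases Ks)
    case Nil
    then show ?thesis using zero_polys[OF A z, of "Suc n"] by (simp del: polys.simps)
  next
    case (Cons a Ls)
    have "set Ls \<subseteq> carrier R" "a \<in> carrier R" using Suc(2) Cons subringE(1)[OF A] by auto
    then have "combine Ks (powers z (Suc n)) = a \<oplus> z \<otimes> combine Ls (powers z n)"
      unfolding Cons using combine_map_mult[OF _ powers_carrier[OF z] z] by simp
    then show ?thesis using polysI[of a A] Suc Cons by simp
  qed
qed

end

context field
begin

lemma combine_powers_trivial:
  assumes A: "subring A R" and z: "z \<in> carrier R" "z \<noteq> \<zero>" and tr: "(transcendental over A) z"
  shows "set Ks \<subseteq> A \<Longrightarrow> length Ks = n \<Longrightarrow> combine Ks (powers z n) = \<zero> \<Longrightarrow> set Ks \<subseteq> {\<zero>}"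
proof (induct n arbitrary: Ks)
  case (Suc n)
  then obtain a Ls where Ks: "Ks = a # Ls" by (cases Ks) auto
  have c: "set Ls \<subseteq> carrier R" "a \<in> carrier R" using Suc(2) Ks subringE(1)[OF A] by auto
  then have e: "combine Ks (powers z (Suc n)) = a \<oplus> z \<otimes> combine Ls (powers z n)"
    unfolding Ks using combine_map_mult[OF _ powers_carrier[OF z(1)] z(1)] by simp
  have "a = \<zero>"
    using transcendental_polysD[OF A z(1) tr _ combine_powers_polys[OF A z(1)], of a Ls n] Suc Ks e by auto
  moreover from this have "combine Ls (powers z n) = \<zero>"
    using e Suc(4) z integral combine_in_carrier[OF c(1) powers_carrier[OF z(1), of n]] by auto
  ultimately show ?case using Suc(1)[of Ls] Suc Ks by auto
qed simp

text \<open>Independence over the ring A[z], which after clearing denominators is independence over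
  its fraction field; for \<open>A = k\<close> this field is k(z).\<close>

definition polys_independent :: "'a set \<Rightarrow> 'a \<Rightarrow> 'a list \<Rightarrow> bool" where
  "polys_independent A z Us \<longleftrightarrow> (\<forall>d Ks. set Ks \<subseteq> polys A z d \<longrightarrow> length Ks = length Us \<longrightarrow> combine Ks Us = \<zero> \<longrightarrow> set Ks \<subseteq> {\<zero>})"

lemma finite_polys_common_degree:
  assumes A: "subring A R" and z: "z \<in> carrier R"
  shows "set Ks \<subseteq> (\<Union>d. polys A z d) \<Longrightarrow> \<exists>d. set Ks \<subseteq> polys A z d"
proof (induct Ks)
  case (Cons a Ks)
  then obtain d e where "a \<in> polys A z d" "set Ks \<subseteq> polys A z e" by auto
  then have "set (a # Ks) \<subseteq> polys A z (max d e)"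
    using polys_mono[OF A z max.cobounded1] polys_mono[OF A z max.cobounded2] by auto
  then show ?case by blast
qed auto

text \<open>Elements of the generated field are fractions over A[z]; the induction follows the field
  operations and carries a nonzero denominator along.\<close>

lemma generate_field_fraction:
  assumes A: "subring A R" and z: "z \<in> carrier R" and f: "f \<in> generate_field R (insert z A)"
  shows "\<exists>g\<in>(\<Union>d. polys A z d). g \<noteq> \<zero> \<and> g \<otimes> f \<in> (\<Union>d. polys A z d)"
proof -
  define B where "B = (\<Union>d. polys A z d)"
  have B: "subring B R" unfolding B_def using subring_polys[OF A z] .
  have AB: "A \<subseteq> B" "z \<in> B" unfolding B_def
    using base_polys[OF A z] pow_polys[OF A z, of 1] z by (auto simp del: polys.simps)
  have Bc: "\<And>x. x \<in> B \<Longrightarrow> x \<in> carrier R" using subringE(1)[OF B] by auto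
  have sub: "insert z A \<subseteq> carrier R" using z subringE(1)[OF A] by auto
  have "f \<in> carrier R \<and> (\<exists>g\<in>B. g \<noteq> \<zero> \<and> g \<otimes> f \<in> B)" using f
  proof (induct rule: generate_field.induct)
    case one
    then show ?case using subringE(3)[OF B] by force
  next
    case (incl h)
    then have "h \<in> B" using AB by auto
    then show ?case using subringE(3)[OF B] Bc by (intro conjI bexI[of _ \<one>]) auto
  next
    case (a_inv h)
    then obtain g where g: "g \<in> B" "g \<noteq> \<zero>" "g \<otimes> h \<in> B" "h \<in> carrier R" by auto
    then have "g \<otimes> \<ominus> h \<in> B" using subringE(5)[OF B g(3)] Bc by (simp add: r_minus)
    then show ?case using g by auto
  next
    case (m_inv h)
    then obtain g where g: "g \<in> B" "g \<noteq> \<zero>" "g \<otimes> h \<in> B" "h \<in> carrier R" by auto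
    note ih = inv_nonzero[OF g(4) m_inv(3)]
    have "(g \<otimes> h) \<otimes> inv h = g" using g Bc[OF g(1)] ih by (simp add: m_assoc)
    moreover have "g \<otimes> h \<noteq> \<zero>" using g Bc integral m_inv(3) by blast
    ultimately show ?case using g ih by auto
  next
    case (eng_add h1 h2)
    then obtain g1 g2 where g: "g1 \<in> B" "g1 \<noteq> \<zero>" "g1 \<otimes> h1 \<in> B" "h1 \<in> carrier R"
       "g2 \<in> B" "g2 \<noteq> \<zero>" "g2 \<otimes> h2 \<in> B" "h2 \<in> carrier R" by auto
    have c: "g1 \<in> carrier R" "g2 \<in> carrier R" using g Bc by auto
    have "(g1 \<otimes> g2) \<otimes> (h1 \<oplus> h2) = g2 \<otimes> (g1 \<otimes> h1) \<oplus> g1 \<otimes> (g2 \<otimes> h2)" using c g(4,8) by algebra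
    also have "\<dots> \<in> B" using g subringE(6,7)[OF B] by simp
    finally show ?case using g c integral subringE(6)[OF B g(1,5)] by blast
  next
    case (eng_mult h1 h2)
    then obtain g1 g2 where g: "g1 \<in> B" "g1 \<noteq> \<zero>" "g1 \<otimes> h1 \<in> B" "h1 \<in> carrier R"
       "g2 \<in> B" "g2 \<noteq> \<zero>" "g2 \<otimes> h2 \<in> B" "h2 \<in> carrier R" by auto
    have c: "g1 \<in> carrier R" "g2 \<in> carrier R" using g Bc by auto
    have "(g1 \<otimes> g2) \<otimes> (h1 \<otimes> h2) = (g1 \<otimes> h1) \<otimes> (g2 \<otimes> h2)" using c g(4,8) by algebra
    also have "\<dots> \<in> B" using g subringE(6,7)[OF B] by simp
    finally show ?case using g c integral subringE(6)[OF B g(1,5)] by blast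
  qed
  then show ?thesis unfolding B_def by blast
qed

text \<open>A relation over the generated field becomes one over A[z] after multiplication by a
  common denominator, so its dimension bounds every family.\<close>

lemma polys_independent_bound:
  assumes A: "subring A R" and z: "z \<in> carrier R"
    and fd: "finite_dimension (generate_field R (insert z A)) K" and K: "K \<subseteq> carrier R"
  shows "\<exists>N. \<forall>Us. set Us \<subseteq> K \<longrightarrow> polys_independent A z Us \<longrightarrow> length Us \<le> N"
proof -
  define E where "E = generate_field R (insert z A)"
  have E: "subfield E R" unfolding E_def
    using generate_field_is_subfield z subringE(1)[OF A] by simp
  define B where "B = (\<Union>d. polys A z d)"
  have B: "subring B R" unfolding B_def using subring_polys[OF A z] .
  obtain N where N: "dimension N E K" using fd by (auto simp: E_def finite_dimension_def)
  have ind: "independent E Us" if Us: "set Us \<subseteq> K" and pi: "polys_independent A z Us" for Us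
  proof (rule ccontr)
    assume dep: "dependent E Us"
    then have ne: "Us \<noteq> []" by auto
    have Uc: "set Us \<subseteq> carrier R" using Us K by auto
    obtain Ks where Ks: "length Ks = length Us" "combine Ks Us = \<zero>" "set Ks \<subseteq> E" "set Ks \<noteq> {\<zero>}"
      using dependent_imp_non_trivial_combine[OF E Uc dep] by metis
    have Kc: "set Ks \<subseteq> carrier R" using Ks(3) subfieldE(3)[OF E] by auto
    have "\<exists>g\<in>B. g \<noteq> \<zero> \<and> (\<forall>a\<in>set Ks. g \<otimes> a \<in> B)" using Ks(3) Kc
    proof (induct Ks)
      case Nil
      then show ?case using subringE(3)[OF B] by force
    next
      case (Cons a Ks)
      then obtain g where g: "g \<in> B" "g \<noteq> \<zero>" "\<forall>a\<in>set Ks. g \<otimes> a \<in> B" by auto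
      obtain h where h: "h \<in> B" "h \<noteq> \<zero>" "h \<otimes> a \<in> B"
        using generate_field_fraction[OF A z, of a] Cons(2) by (auto simp: B_def E_def)
      have c: "g \<in> carrier R" "h \<in> carrier R" using g h subringE(1)[OF B] by auto
      have "(g \<otimes> h) \<otimes> b \<in> B" if b: "b \<in> set (a # Ks)" for b
      proof -
        have bc: "b \<in> carrier R" using b Cons(3) by auto
        have "(g \<otimes> h) \<otimes> b = h \<otimes> (g \<otimes> b)" "(g \<otimes> h) \<otimes> b = g \<otimes> (h \<otimes> b)" using c bc by algebra+
        then show ?thesis using b g h subringE(6)[OF B] by (metis set_ConsD)
      qed
      moreover have "g \<otimes> h \<noteq> \<zero>" using integral g h c by blast
      ultimately show ?case using subringE(6)[OF B g(1) h(1)] by blast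
    qed
    then obtain g where g: "g \<in> B" "g \<noteq> \<zero>" "\<forall>a\<in>set Ks. g \<otimes> a \<in> B" by blast
    have gc: "g \<in> carrier R" using g subringE(1)[OF B] by auto
    let ?Ls = "map ((\<otimes>) g) Ks"
    have "combine ?Ls Us = \<zero>" using combine_r_distr[OF Kc Uc gc] Ks(2) gc by simp
    moreover obtain d where "set ?Ls \<subseteq> polys A z d"
      using finite_polys_common_degree[OF A z, of ?Ls] g(3) by (auto simp: B_def image_subset_iff)
    ultimately have "set ?Ls \<subseteq> {\<zero>}" using pi Ks(1) unfolding polys_independent_def by (metis length_map)
    then have "set Ks \<subseteq> {\<zero>}" using g(2) gc Kc integral by force
    moreover have "Ks \<noteq> []" using ne Ks(1) by auto
    ultimately show False using Ks(4) by (cases Ks) auto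
  qed
  show ?thesis
    using independent_length_le_dimension[OF E N ind] by blast
qed

end

section \<open>Finiteness of the extension \<open>K\<close> over k(z) for every nonconstant
  z\<close>

context finite_function_field
begin

lemma subring_k: "subring k R"
  using subfieldE(1)[OF subfield_k] .

lemma polys_K: "z \<in> K \<Longrightarrow> polys k z d \<subseteq> K"
  using polys_subset[OF subring_k _ subfieldE(1)[OF subfield_K]] by auto

lemma generate_field_subset_K: "z \<in> K \<Longrightarrow> generate_field R (insert z k) \<subseteq> K"
  by (rule generate_field_min_subfield1[OF _ subfield_K]) auto

lemma finite_dimension_if_algebraic:
  assumes E: "subfield E R" "k \<subseteq> E" "E \<subseteq> K" and alg: "\<And>y. y \<in> K \<Longrightarrow> (algebraic over E) y"
  shows "finite_dimension E K"
proof -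
  obtain S where S: "finite S" "S \<subseteq> K" "K = generate_field R (k \<union> S)"
    using ff by (auto simp: function_field_def)
  obtain xs where xs: "set xs = S" using finite_list[OF S(1)] by blast
  have c: "set xs \<subseteq> carrier R" using xs S(2) by auto
  have a: "\<And>x. x \<in> set xs \<Longrightarrow> (algebraic over E) x" using xs S(2) alg by auto
  have sf: "subfield (finite_extension E xs) R" using finite_extension_is_subfield[OF E(1) c a] .
  have "finite_extension E xs \<subseteq> K"
    using finite_extension_subring_incl[OF subfieldE(1)[OF subfield_K] E(3)] xs S(2) by auto
  moreover have "k \<union> S \<subseteq> finite_extension E xs"
    using finite_extension_incl[OF subfieldE(3)[OF E(1)] c] finite_extension_mem[OF subfieldE(1)[OF E(1)] c] E(2) xs by auto
  then have "K \<subseteq> finite_extension E xs"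
    unfolding S(3) using generate_field_min_subfield1[OF _ sf] k_subset_K S(2) by (metis K_carrier Un_least subset_iff)
  ultimately show ?thesis using finite_extension_finite_dimension(1)[OF E(1) c a] by auto
qed

text \<open>The definition of a function field supplies finiteness over k(x) for one particular x.
  An exchange of x and z transfers it to every nonconstant z: x turns out to be algebraic over
  k(z).\<close>

lemma finite_dimension_nonconstant:
  assumes z: "z \<in> K" "z \<notin> k"
  shows "finite_dimension (generate_field R (insert z k)) K"
proof -
  let ?E = "\<lambda>x. generate_field R (insert x k)"
  have sfE: "subfield (?E x) R" and xE: "x \<in> ?E x" "k \<subseteq> ?E x" if "x \<in> K" for x
    using that by (auto intro!: generate_field_is_subfield generate_field.incl)
  obtain x where x: "x \<in> K" "(transcendental over k) x" "\<And>y. y \<in> K \<Longrightarrow> (algebraic over (?E x)) y"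
    using ff by (auto simp: function_field_def)
  have "finite_dimension (?E x) K"
    using finite_dimension_if_algebraic[OF sfE xE(2) generate_field_subset_K] x by auto
  then obtain N where N: "\<And>Us. set Us \<subseteq> K \<Longrightarrow> polys_independent k x Us \<Longrightarrow> length Us \<le> N"
    using polys_independent_bound[OF subring_k _ _ subfieldE(3)[OF subfield_K]] x(1) by blast
  have zc: "z \<in> carrier R" "z \<noteq> \<zero>" and xc: "x \<in> carrier R" using z x by auto
  have x0: "x \<noteq> \<zero>" using x(2) zero_is_algebraic[OF subring_k] by (auto simp: over_def)
  have SE: "subring (?E z) R" using subfieldE(1)[OF sfE] z by auto
  have Ec: "\<And>y. y \<in> ?E z \<Longrightarrow> y \<in> carrier R" using subringE(1)[OF SE] by auto
  have alg: "(algebraic over (?E z)) x"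
  proof (rule ccontr)
    assume "\<not> (algebraic over (?E z)) x"
    then have tr: "(transcendental over (?E z)) x" by (simp add: over_def)
    \<comment> \<open>N + 1 powers of z, one more than a family independent over k[x] may have. If x
      were transcendental over k(z), they would be independent over k[x].\<close>
    let ?Us = "powers z (Suc N)"
    have Uc: "set ?Us \<subseteq> carrier R" using powers_carrier[OF zc(1)] .
    have pE: "set (powers z n) \<subseteq> ?E z" for n
      by (induct n) (use subringE(3,6)[OF SE] xE[OF z(1)] in auto)
    have polE: "polys k x d \<subseteq> polys (?E z) x d" for d
    proof (induct d)
      case (Suc d)
      then show ?case using xE(2)[OF z(1)] unfolding polys.simps by blast
    qed (use xE(2)[OF z(1)] in simp)
    have "polys_independent k x ?Us" unfolding polys_independent_def
    proof (intro allI impI)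
      fix d Ks assume "set Ks \<subseteq> polys k x d" "length Ks = length ?Us" "combine Ks ?Us = \<zero>"
      then show "set Ks \<subseteq> {\<zero>}"
      proof (rule polys_trivial_combine[OF subring_k xc x0 Uc, rotated])
        fix Cs Gs d assume a: "set Cs \<subseteq> k" "set Gs \<subseteq> polys k x d" "length Cs = length ?Us" "length Gs = length ?Us"
          "combine Cs ?Us \<oplus> x \<otimes> combine Gs ?Us = \<zero>"
        have "combine Cs ?Us \<in> ?E z"
        proof (rule combine_closed)
          show "c \<otimes> u \<in> ?E z" if "c \<in> set Cs" "u \<in> set ?Us" for c u
            using that subringE(6)[OF SE, of c u] a(1) xE(2)[OF z(1)] pE[of "Suc N"] by blast
        qed (use subringE(2,7)[OF SE] in auto)
        moreover have "combine Gs ?Us \<in> polys (?E z) x d"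
        proof (rule combine_closed)
          fix g u assume "g \<in> set Gs" "u \<in> set ?Us"
          then have gu: "g \<in> polys (?E z) x d" "u \<in> ?E z" using a(2) polE pE by blast+
          then show "g \<otimes> u \<in> polys (?E z) x d"
            using smult_polys[OF SE xc gu(2,1)] polys_carrier[OF SE xc gu(1)] Ec[OF gu(2)] by (simp add: m_comm)
        qed (use add_polys[OF SE xc] zero_polys[OF SE xc] in auto)
        ultimately have "combine Cs ?Us = \<zero>" using transcendental_polysD[OF SE xc tr _ _ a(5)] by blast
        then show "set Cs \<subseteq> {\<zero>}"
          using combine_powers_trivial[OF subring_k zc transcendental_k[OF z] a(1)] a(3) by simp
      qed
    qed
    moreover have "set ?Us \<subseteq> K" using pE generate_field_subset_K[OF z(1)] by blast
    ultimately show False using N[of ?Us] by simp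
  qed
  define E1 where "E1 = simple_extension (?E z) x"
  have E1: "subfield E1 R" unfolding E1_def using simple_extension_is_subfield[OF sfE[OF z(1)] xc] alg by simp
  have sub: "?E z \<subseteq> E1" "x \<in> E1"
    unfolding E1_def using simple_extension_incl[OF subringE(1)[OF SE] xc] simple_extension_mem[OF SE xc] by auto
  have E1K: "E1 \<subseteq> K" unfolding E1_def
    using simple_extension_subring_incl[OF subfieldE(1)[OF subfield_K] generate_field_subset_K[OF z(1)] x(1)] .
  have "?E x \<subseteq> E1" using generate_field_min_subfield1[OF _ E1, of "insert x k"] sub xE(2)[OF z(1)] x(1) by auto
  then have "\<And>y. y \<in> K \<Longrightarrow> (algebraic over E1) y" using algebraic_mono x(3) by blast
  then have "finite_dimension E1 K"
    using finite_dimension_if_algebraic[OF E1 _ E1K] sub xE(2)[OF z(1)] by auto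
  moreover have "finite_dimension (?E z) E1"
    unfolding E1_def using finite_dimension_simple_extension[OF sfE[OF z(1)] xc] alg by simp
  ultimately show ?thesis using telescopic_base_dim(1)[OF sfE[OF z(1)] E1] by blast
qed

lemma independent_bound:
  assumes z: "z \<in> K" "z \<notin> k"
  shows "\<exists>N. \<forall>Us. set Us \<subseteq> K \<longrightarrow> polys_independent k z Us \<longrightarrow> length Us \<le> N"
  using polys_independent_bound[OF subring_k _ finite_dimension_nonconstant[OF z] subfieldE(3)[OF subfield_K]] z by auto

text \<open>Transcendence keeps 1/z out of k[z], so some valuation ring above k[z] has z as a
  nonunit. Applied to 1/z it produces poles.\<close>

lemma exists_zero_place:
  assumes z: "z \<in> K" "z \<notin> k"
  shows "\<exists>P\<in>places k K. z \<in> P"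
proof -
  let ?A = "\<Union>d. polys k z d"
  have zc: "z \<in> carrier R" "z \<noteq> \<zero>" using z by auto
  note iz = inv_nonzero[OF zc]
  have A: "subring ?A R" using subring_polys[OF subring_k zc(1)] .
  have zA: "z \<in> ?A" using pow_polys[OF subring_k zc(1), of 1] zc by (auto simp del: polys.simps)
  have AK: "?A \<subseteq> K" using polys_K[OF z(1)] by auto
  have "inv z \<notin> ?A"
  proof
    assume "inv z \<in> ?A"
    then obtain d where d: "inv z \<in> polys k z d" by auto
    have "\<one> \<oplus> z \<otimes> (\<ominus> (inv z)) = \<zero>" using iz zc by (simp add: r_minus r_neg)
    then have "\<one> = \<zero>"
      using transcendental_polysD[OF subring_k zc(1) transcendental_k[OF z] k_closed(2) uminus_polys[OF subring_k zc(1) d]] by blast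
    then show False by simp
  qed
  then obtain V where V: "subring V R" "?A \<subseteq> V" "V \<subseteq> K" "inv z \<notin> V" "\<And>y. y \<in> K \<Longrightarrow> y \<noteq> \<zero> \<Longrightarrow> y \<in> V \<or> inv y \<in> V"
    using exists_valuation_ring[OF subfield_K A AK zA zc(2)] by blast
  have "k \<subseteq> V" using V(2) base_polys[OF subring_k zc(1)] by blast
  moreover have "z \<in> V" using zA V(2) by blast
  moreover have "inv z \<in> K" using z zc by auto
  ultimately have "valuation_ring k K V" using V z unfolding valuation_ring_def by blast
  then show ?thesis using nonunits_place(1)[of V] mem_nonunits[of z V] V(4) \<open>z \<in> V\<close> by blast
qed

end

section \<open>Discreteness of places\<close>

context field
begin

lemma int_pow_units_of:
  assumes "x \<in> carrier R" "x \<noteq> \<zero>"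
  shows "x [^] (n::int) = x [^]\<^bsub>units_of R\<^esub> n"
proof -
  have "x \<in> Units R" using assms field_Units by auto
  then have "x [^]\<^bsub>units_of R\<^esub> m = x [^] m" "inv\<^bsub>units_of R\<^esub> (x [^] m) = inv (x [^] m)" for m :: nat
    using units_of_pow units_of_inv Units_pow_closed by metis+
  then show ?thesis unfolding int_pow_def2 by metis
qed

lemma
  assumes x: "x \<in> carrier R" "x \<noteq> \<zero>"
  shows int_pow_closed_nonzero: "x [^] (n::int) \<in> carrier R" "x [^] n \<noteq> \<zero>"
    and int_pow_add: "x [^] (n + m) = x [^] n \<otimes> x [^] m"
    and int_pow_uminus: "x [^] (- n) = inv (x [^] n)"
    and int_pow_one_exp: "x [^] (1::int) = x"
proof -
  interpret U: group "units_of R" by (rule units_group)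
  have u: "x \<in> carrier (units_of R)" using x field_Units by (auto simp: units_of_carrier)
  have c: "x [^] n \<in> Units R" for n :: int
    using U.int_pow_closed[OF u, of n] int_pow_units_of[OF x] by (simp add: units_of_carrier)
  then show "x [^] n \<in> carrier R" "x [^] n \<noteq> \<zero>" using field_Units by auto
  show "x [^] (n + m) = x [^] n \<otimes> x [^] m"
    using U.int_pow_mult[OF u] by (simp add: int_pow_units_of[OF x] units_of_mult)
  show "x [^] (- n) = inv (x [^] n)"
    using U.int_pow_neg[OF u] units_of_inv[OF c] by (simp add: int_pow_units_of[OF x])
  show "x [^] (1::int) = x" using U.int_pow_1[OF u] by (simp add: int_pow_units_of[OF x])
qed

lemma int_pow_mult_base:
  assumes x: "x \<in> carrier R" "x \<noteq> \<zero>" and y: "y \<in> carrier R" "y \<noteq> \<zero>"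
  shows "(x \<otimes> y) [^] (n::int) = x [^] n \<otimes> y [^] n"
proof -
  interpret U: group "units_of R" by (rule units_group)
  have u: "x \<in> carrier (units_of R)" "y \<in> carrier (units_of R)"
    using x y field_Units by (auto simp: units_of_carrier)
  have xy: "x \<otimes> y \<in> carrier R" "x \<otimes> y \<noteq> \<zero>" using x y integral by auto
  show ?thesis using U.int_pow_mult_distrib[OF _ u] x y m_comm
    by (simp add: int_pow_units_of[OF x] int_pow_units_of[OF y] int_pow_units_of[OF xy] units_of_mult)
qed

end

context finite_function_field
begin

lemma K_int_pow [simp, intro]: "x \<in> K \<Longrightarrow> x \<noteq> \<zero> \<Longrightarrow> x [^] (n::int) \<in> K"
proof -
  assume x: "x \<in> K" "x \<noteq> \<zero>"
  have p: "x [^] m \<in> K" "x [^] m \<noteq> \<zero>" for m :: nat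
    using x int_pow_closed_nonzero(2)[of x "int m"] by (auto simp: int_pow_int)
  show ?thesis unfolding int_pow_def2 using p K_closed(7)[OF p] by metis
qed

text \<open>This is the degree \<open>[K : k(z)]\<close>.\<close>

definition ext_degree :: "'a \<Rightarrow> nat" where
  "ext_degree z = (GREATEST n. \<exists>Us. set Us \<subseteq> K \<and> polys_independent k z Us \<and> length Us = n)"

lemma
  assumes z: "z \<in> K" "z \<notin> k"
  shows ext_degree_attained: "\<exists>Us. set Us \<subseteq> K \<and> polys_independent k z Us \<and> length Us = ext_degree z"
    and ext_degree_max: "set Us \<subseteq> K \<Longrightarrow> polys_independent k z Us \<Longrightarrow> length Us \<le> ext_degree z"
proof -
  obtain N where N: "\<And>Us. set Us \<subseteq> K \<Longrightarrow> polys_independent k z Us \<Longrightarrow> length Us \<le> N"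
    using independent_bound[OF z] by blast
  let ?Q = "\<lambda>n. \<exists>Us. set Us \<subseteq> K \<and> polys_independent k z Us \<and> length Us = n"
  have "?Q 0" by (auto simp: polys_independent_def)
  then show "?Q (ext_degree z)" unfolding ext_degree_def
    by (rule GreatestI_nat[where b = N]) (use N in blast)
  show "set Us \<subseteq> K \<Longrightarrow> polys_independent k z Us \<Longrightarrow> length Us \<le> ext_degree z"
    unfolding ext_degree_def by (rule Greatest_le_nat[where b = N]) (use N in blast)+
qed

text \<open>The link between residues and field degrees: independence over \<open>k\<close> modulo z
  B lifts to independence over k[z], whose families have at most [K:k(z)] members.\<close>

lemma independent_mod_imp_polys_independent:
  assumes B: "subring B R" "k \<subseteq> B" "z \<in> B" "z \<noteq> \<zero>" and Us: "set Us \<subseteq> B"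
    and ind: "\<And>Cs. set Cs \<subseteq> k \<Longrightarrow> length Cs = length Us \<Longrightarrow> combine Cs Us \<in> (\<otimes>) z ` B \<Longrightarrow> set Cs \<subseteq> {\<zero>}"
  shows "polys_independent k z Us"
  unfolding polys_independent_def
proof (intro allI impI)
  have Bc: "\<And>x. x \<in> B \<Longrightarrow> x \<in> carrier R" using subringE(1)[OF B(1)] by auto
  have zc: "z \<in> carrier R" using Bc B(3) .
  have Uc: "set Us \<subseteq> carrier R" using Us Bc by auto
  fix d Ks assume "set Ks \<subseteq> polys k z d" "length Ks = length Us" "combine Ks Us = \<zero>"
  then show "set Ks \<subseteq> {\<zero>}"
  proof (rule polys_trivial_combine[OF subring_k zc B(4) Uc, rotated])
    fix Cs Gs d assume a: "set Cs \<subseteq> k" "set Gs \<subseteq> polys k z d" "length Cs = length Us" "length Gs = length Us"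
      "combine Cs Us \<oplus> z \<otimes> combine Gs Us = \<zero>"
    have "combine Gs Us \<in> B"
    proof (rule combine_closed)
      show "g \<otimes> u \<in> B" if "g \<in> set Gs" "u \<in> set Us" for g u
        using that a(2) Us polys_subset[OF subring_k zc B(1-3), of d] subringE(6)[OF B(1)] by blast
    qed (use subringE(2,7)[OF B(1)] in auto)
    then have w: "\<ominus> (combine Gs Us) \<in> B" "combine Gs Us \<in> carrier R" using subringE(5)[OF B(1)] Bc by auto
    have "combine Cs Us \<in> carrier R" using combine_in_carrier a(1) Uc by auto
    then have "combine Cs Us = z \<otimes> (\<ominus> (combine Gs Us))"
      using a(5) w zc by (metis minus_equality minus_minus r_minus m_closed a_inv_closed)
    then show "set Cs \<subseteq> {\<zero>}" using ind[OF a(1,3)] w by blast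
  qed
qed

text \<open>A maximal list that is independent modulo \<open>z B\<close> spans \<open>B\<close> modulo \<open>z B\<close>.\<close>

lemma card_incongruent_le:
  assumes z: "z \<in> K" "z \<notin> k" and B: "subring B R" "k \<subseteq> B" "z \<in> B" "B \<subseteq> K"
    and T: "T \<subseteq> B" "\<And>s t. s \<in> T \<Longrightarrow> t \<in> T \<Longrightarrow> s \<ominus> t \<in> (\<otimes>) z ` B \<Longrightarrow> s = t"
  shows "finite T \<and> card T \<le> card k ^ ext_degree z"
proof -
  have z0: "z \<noteq> \<zero>" and zc: "z \<in> carrier R" using z by auto
  have Bc: "\<And>x. x \<in> B \<Longrightarrow> x \<in> carrier R" using subringE(1)[OF B(1)] by auto
  define ind where "ind Us \<longleftrightarrow> set Us \<subseteq> B \<and> (\<forall>Cs. set Cs \<subseteq> k \<longrightarrow> length Cs = length Us \<longrightarrow> combine Cs Us \<in> (\<otimes>) z ` B \<longrightarrow> set Cs \<subseteq> {\<zero>})" for Us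
  have bound: "length Us \<le> ext_degree z" if "ind Us" for Us
    using that independent_mod_imp_polys_independent[OF B(1-3) z0, of Us] ext_degree_max[OF z, of Us] B(4)
    unfolding ind_def by blast
  let ?Q = "\<lambda>n. \<exists>Us. ind Us \<and> length Us = n"
  have Q0: "?Q 0" by (auto simp: ind_def)
  define m where "m = (GREATEST n. ?Q n)"
  have "?Q m" unfolding m_def by (rule GreatestI_nat[where P = ?Q and k = 0 and b = "ext_degree z", OF Q0]) (use bound in blast)
  then obtain Us where Us: "ind Us" "length Us = m" by blast
  have mm: "length Vs \<le> m" if "ind Vs" for Vs
    unfolding m_def by (rule Greatest_le_nat[where b = "ext_degree z"]) (use bound that in blast)+
  have UB: "set Us \<subseteq> B" and Uc: "set Us \<subseteq> carrier R" using Us Bc by (auto simp: ind_def)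
  have I: "x \<oplus> y \<in> (\<otimes>) z ` B" "\<ominus> x \<in> (\<otimes>) z ` B" "x \<in> carrier R"
    if xy: "x \<in> (\<otimes>) z ` B" "y \<in> (\<otimes>) z ` B" for x y
  proof -
    obtain a b where ab: "a \<in> B" "b \<in> B" "x = z \<otimes> a" "y = z \<otimes> b" using xy by auto
    have "x \<oplus> y = z \<otimes> (a \<oplus> b)" "\<ominus> x = z \<otimes> (\<ominus> a)" unfolding ab(3,4) using ab(1,2)[THEN Bc] zc by algebra+
    then show "x \<oplus> y \<in> (\<otimes>) z ` B" "\<ominus> x \<in> (\<otimes>) z ` B" using subringE(5,7)[OF B(1)] ab by auto
    show "x \<in> carrier R" using ab Bc zc by auto
  qed
  have ex: "\<exists>Cs. set Cs \<subseteq> k \<and> length Cs = m \<and> y \<oplus> combine Cs Us \<in> (\<otimes>) z ` B" if y: "y \<in> B" for y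
  proof -
    have yc: "y \<in> carrier R" using Bc y .
    \<comment> \<open>Maximality yields a relation involving y. Its coefficient at y is nonzero
      because \<open>Us\<close> alone is independent modulo z B, and is therefore invertible in
      \<open>k\<close>.\<close>
    have "\<not> ind (y # Us)" using mm[of "y # Us"] Us(2) by auto
    then obtain Ds where Ds: "set Ds \<subseteq> k" "length Ds = Suc m" "combine Ds (y # Us) \<in> (\<otimes>) z ` B" "\<not> set Ds \<subseteq> {\<zero>}"
      using UB y Us(2) by (auto simp: ind_def)
    then obtain c Cs where cC: "Ds = c # Cs" by (cases Ds) auto
    have cc: "c \<in> k" "set Cs \<subseteq> k" "length Cs = m" "set Cs \<subseteq> carrier R" using Ds cC by auto
    have "c \<noteq> \<zero>"
    proof
      assume "c = \<zero>"
      then have "combine Cs Us \<in> (\<otimes>) z ` B" using Ds(3) cC yc combine_in_carrier[OF cc(4) Uc] by simp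
      then have "set Cs \<subseteq> {\<zero>}" using Us cc by (auto simp: ind_def)
      then show False using Ds(4) cC \<open>c = \<zero>\<close> by auto
    qed
    then have ic: "inv c \<in> k" "inv c \<otimes> c = \<one>" "c \<in> carrier R" "inv c \<in> carrier R" using cc inv_nonzero[of c] by auto
    obtain w where w: "w \<in> B" "c \<otimes> y \<oplus> combine Cs Us = z \<otimes> w" using Ds(3) cC by auto
    have "y \<oplus> combine (map ((\<otimes>) (inv c)) Cs) Us = y \<oplus> inv c \<otimes> combine Cs Us"
      using combine_r_distr[OF cc(4) Uc ic(4)] by simp
    also have "\<dots> = (inv c \<otimes> c) \<otimes> y \<oplus> inv c \<otimes> combine Cs Us" using ic yc by simp
    also have "\<dots> = inv c \<otimes> (c \<otimes> y \<oplus> combine Cs Us)"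
      using ic(3,4) yc combine_in_carrier[OF cc(4) Uc] by algebra
    also have "\<dots> = z \<otimes> (inv c \<otimes> w)" unfolding w(2) using ic(4) zc Bc[OF w(1)] by algebra
    finally have "y \<oplus> combine (map ((\<otimes>) (inv c)) Cs) Us \<in> (\<otimes>) z ` B"
      using subringE(6)[OF B(1), of "inv c" w] ic(1) B(2) w(1) by auto
    moreover have "set (map ((\<otimes>) (inv c)) Cs) \<subseteq> k" using cc ic by auto
    ultimately show ?thesis using cc(3) by (intro exI[of _ "map ((\<otimes>) (inv c)) Cs"]) simp
  qed
  obtain \<phi> where \<phi>: "\<And>y. y \<in> B \<Longrightarrow> set (\<phi> y) \<subseteq> k \<and> length (\<phi> y) = m \<and> y \<oplus> combine (\<phi> y) Us \<in> (\<otimes>) z ` B"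
    using ex by metis
  have inj: "inj_on \<phi> T"
  proof (rule inj_onI)
    fix s t assume st: "s \<in> T" "t \<in> T" "\<phi> s = \<phi> t"
    have sB: "s \<in> B" "t \<in> B" using st T by auto
    let ?c = "combine (\<phi> t) Us"
    have c: "?c \<in> carrier R" by (rule combine_in_carrier[OF _ Uc]) (use \<phi>[OF sB(2)] in auto)
    have "s \<ominus> t = (s \<oplus> ?c) \<oplus> \<ominus> (t \<oplus> ?c)" using c sB[THEN Bc] by algebra
    then have "s \<ominus> t \<in> (\<otimes>) z ` B" using I \<phi>[OF sB(1)] \<phi>[OF sB(2)] st(3) by metis
    then show "s = t" using T(2) st by blast
  qed
  have im: "\<phi> ` T \<subseteq> {Cs. set Cs \<subseteq> k \<and> length Cs = m}" using \<phi> T(1) by auto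
  have fin: "finite {Cs. set Cs \<subseteq> k \<and> length Cs = m}" using finite_lists_length_eq[OF finite_k] .
  have "finite T" using inj im fin finite_imageD finite_subset by blast
  moreover have "card T \<le> card {Cs. set Cs \<subseteq> k \<and> length Cs = m}" using card_inj_on_le[OF inj im fin] .
  then have "card T \<le> card k ^ m" using card_lists_length_eq[OF finite_k] by simp
  moreover have "card k ^ m \<le> card k ^ ext_degree z"
    using bound[OF Us(1)] Us(2) card_k by (intro power_increasing) auto
  ultimately show ?thesis by simp
qed

end

section \<open>Uniformizers and the normalized valuation\<close>

context place
begin

lemma P_nonconstant: "z \<in> P \<Longrightarrow> z \<noteq> \<zero> \<Longrightarrow> z \<notin> k"
  using k_inter_P by blast

text \<open>V / z V is finite, so it cannot accommodate infinitely many classes. Both applications,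
  principality of \<open>P\<close> and finite divisibility by a uniformizer, are arguments by
  contradiction.\<close>

lemma finite_incongruent:
  assumes z: "z \<in> P" "z \<noteq> \<zero>" and x: "\<And>i. x i \<in> V"
    and neq: "\<And>i j::nat. i < j \<Longrightarrow> x i \<ominus> x j \<notin> (\<otimes>) z ` V"
  shows False
proof -
  have zK: "z \<in> K" "z \<notin> k" "z \<in> V" using z P_nonconstant by auto
  have neq': "x i \<ominus> x j \<notin> (\<otimes>) z ` V" if "i \<noteq> j" for i j
  proof (cases "i < j")
    case False
    then have "j < i" using that by simp
    show ?thesis
    proof
      assume "x i \<ominus> x j \<in> (\<otimes>) z ` V"
      then obtain w where w: "w \<in> V" "x i \<ominus> x j = z \<otimes> w" by auto
      have "x j \<ominus> x i = \<ominus> (x i \<ominus> x j)" using x[of i] x[of j] by (simp add: a_minus_def minus_add a_comm)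
      also have "\<dots> = z \<otimes> (\<ominus> w)" using w zK by (simp add: r_minus)
      finally show False using neq[OF \<open>j < i\<close>] w by auto
    qed
  qed (use neq in blast)
  have z0: "\<zero> \<in> (\<otimes>) z ` V" using zK by (intro image_eqI[of _ _ \<zero>]) auto
  have "inj x"
  proof (rule injI)
    fix i j assume e: "x i = x j"
    have "x i \<ominus> x j = \<zero>" unfolding e a_minus_def by (rule r_neg) (use x in auto)
    then show "i = j" using neq'[of i j] z0 by auto
  qed
  moreover have "s = t" if "s \<in> range x" "t \<in> range x" "s \<ominus> t \<in> (\<otimes>) z ` V" for s t
    using that neq' by (metis rangeE)
  then have "finite (range x)"
    using card_incongruent_le[OF zK(1,2) V_props(1,2) zK(3) V_props(4) image_subsetI[of UNIV x V, OF x]] by blast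
  ultimately show False using finite_imageD by blast
qed

lemma unit_mult: "u \<in> V - P \<Longrightarrow> w \<in> V - P \<Longrightarrow> u \<otimes> w \<in> V - P"
  and unit_inv: "u \<in> V - P \<Longrightarrow> inv u \<in> V - P"
proof -
  show inv: "inv u \<in> V - P" if "u \<in> V - P" for u
  proof -
    have "u \<noteq> \<zero>" "inv u \<in> V" using that unit_iff by auto
    then show ?thesis using inv_nonzero[of u] that unit_iff[of "inv u"] by auto
  qed
  show "u \<otimes> w \<in> V - P" if u: "u \<in> V - P" and w: "w \<in> V - P" for u w
  proof -
    have nz: "u \<noteq> \<zero>" "w \<noteq> \<zero>" "u \<in> carrier R" "w \<in> carrier R" using u w unit_iff by auto
    then have "inv (u \<otimes> w) = inv u \<otimes> inv w" by (simp add: inv_mult)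
    moreover have "inv u \<otimes> inv w \<in> V" using inv u w by auto
    ultimately show ?thesis using unit_iff[of "u \<otimes> w"] u w nz integral by auto
  qed
qed

lemma one_plus_P: "p \<in> P \<Longrightarrow> \<one> \<oplus> p \<in> V - P"
proof
  assume p: "p \<in> P"
  then show "\<one> \<oplus> p \<in> V" by auto
  show "\<one> \<oplus> p \<notin> P"
  proof
    assume "\<one> \<oplus> p \<in> P"
    then have "(\<one> \<oplus> p) \<ominus> p \<in> P" using p by blast
    moreover have "(\<one> \<oplus> p) \<ominus> p = \<one>" using p by (simp add: a_minus_def a_assoc r_neg)
    ultimately show False by simp
  qed
qed

text \<open>A unit factor may be cancelled in divisibility by z.\<close>

lemma unit_not_mult: "u \<in> V - P \<Longrightarrow> x \<in> K \<Longrightarrow> y \<in> V \<Longrightarrow> x \<otimes> u = z \<otimes> y \<Longrightarrow> z \<in> K \<Longrightarrow> x \<in> (\<otimes>) z ` V"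
proof -
  assume a: "u \<in> V - P" "x \<in> K" "y \<in> V" "x \<otimes> u = z \<otimes> y" "z \<in> K"
  have u: "u \<noteq> \<zero>" "inv u \<in> V" "u \<in> carrier R" using a unit_iff by auto
  then have "x = (x \<otimes> u) \<otimes> inv u" using inv_nonzero[of u] a(2) by (simp add: m_assoc)
  also have "\<dots> = z \<otimes> (y \<otimes> inv u)" unfolding a(4) using a u by (intro m_assoc) auto
  finally show ?thesis using a u by auto
qed

definition uniformizer :: "'a \<Rightarrow> bool" where
  "uniformizer t \<longleftrightarrow> t \<in> P \<and> t \<noteq> \<zero> \<and> P = (\<otimes>) t ` V"

text \<open>If no element generated \<open>P\<close>, every nonzero x in \<open>P\<close> would
  factor as y p with y and p again in \<open>P\<close>. Iteration gives an infinite chain of proper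
  divisors of z, pairwise incongruent modulo z.\<close>

lemma exists_uniformizer: "\<exists>t. uniformizer t"
proof (rule ccontr)
  assume no: "\<nexists>t. uniformizer t"
  have step: "\<exists>y\<in>P. y \<noteq> \<zero> \<and> (\<exists>p\<in>P. x = y \<otimes> p)" if x: "x \<in> P" "x \<noteq> \<zero>" for x
  proof -
    have "P \<noteq> (\<otimes>) x ` V" using no x by (auto simp: uniformizer_def)
    moreover have "(\<otimes>) x ` V \<subseteq> P" using x by auto
    ultimately obtain y where y: "y \<in> P" "y \<notin> (\<otimes>) x ` V" by blast
    note ix = inv_nonzero[of x]
    have yx: "y \<otimes> inv x \<in> K" using x y by auto
    have "x \<otimes> (y \<otimes> inv x) = y \<otimes> (x \<otimes> inv x)" using x y yx by (intro m_lcomm) auto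
    then have "y = x \<otimes> (y \<otimes> inv x)" using ix x y by simp
    then have nV: "y \<otimes> inv x \<notin> V" using y(2) by blast
    have y0: "y \<noteq> \<zero>" using nV ix x by auto
    have "inv (y \<otimes> inv x) \<in> P" using not_V_inv_P[OF yx nV] .
    moreover have "inv (y \<otimes> inv x) = inv y \<otimes> x" using inv_mult[of y "inv x"] ix x y y0 by auto
    moreover have "x = y \<otimes> (inv y \<otimes> x)" using inv_nonzero[of y] x y y0 by (simp add: m_assoc[symmetric])
    ultimately show ?thesis using y y0 by metis
  qed
  obtain z where z: "z \<in> P" "z \<noteq> \<zero>" using exists_nonzero_P by blast
  have "\<exists>f. \<forall>n. (f n \<in> P \<and> f n \<noteq> \<zero> \<and> (n = 0 \<longrightarrow> f n = z)) \<and> (\<exists>p\<in>P. f n = f (Suc n) \<otimes> p)"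
    by (rule dependent_nat_choice) (use z step in auto)
  then obtain f where f: "\<And>n. f n \<in> P \<and> f n \<noteq> \<zero>" "f 0 = z" "\<And>n. \<exists>p\<in>P. f n = f (Suc n) \<otimes> p" by metis
  have dv: "i < j \<Longrightarrow> \<exists>p\<in>P. f i = f j \<otimes> p" for i j
  proof (induct rule: strict_inc_induct)
    case (base i)
    then show ?case using f(3) by blast
  next
    case (step i)
    then obtain p p' where p: "p \<in> P" "p' \<in> P" "f i = f (Suc i) \<otimes> p'" "f (Suc i) = f j \<otimes> p" using f(3) by blast
    then have "f i = f j \<otimes> (p \<otimes> p')" using f(1)[of j] by (auto simp: m_assoc)
    then show ?case using p by auto
  qed
  \<comment> \<open>The shift by one leaves out z = f 0, so each term of the sequence divides z
    properly. A congruence between two terms would make z divide the later one, as their difference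
    is that term times a unit.\<close>
  show False
  proof (rule finite_incongruent[OF z, of "\<lambda>i. f (Suc i)"])
    fix i j :: nat assume ij: "i < j"
    obtain p where p: "p \<in> P" "f (Suc i) = f (Suc j) \<otimes> p" using dv[of "Suc i" "Suc j"] ij by auto
    show "f (Suc i) \<ominus> f (Suc j) \<notin> (\<otimes>) z ` V"
    proof
      assume "f (Suc i) \<ominus> f (Suc j) \<in> (\<otimes>) z ` V"
      then obtain w where w: "w \<in> V" "f (Suc i) \<ominus> f (Suc j) = z \<otimes> w" by auto
      have fc: "f (Suc j) \<in> carrier R" "p \<in> carrier R" using f(1) p by auto
      have "f (Suc j) \<otimes> (\<one> \<oplus> \<ominus> p) = \<ominus> (f (Suc j) \<otimes> p \<ominus> f (Suc j))" using fc by algebra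
      also have "\<dots> = z \<otimes> (\<ominus> w)" using w p z by (simp add: r_minus)
      finally have "f (Suc j) \<in> (\<otimes>) z ` V"
        by (intro unit_not_mult[OF one_plus_P[of "\<ominus> p"]]) (use p f(1) w z in auto)
      then obtain w where w: "w \<in> V" "f (Suc j) = z \<otimes> w" by auto
      obtain p' where p': "p' \<in> P" "z = f (Suc j) \<otimes> p'" using dv[of 0 "Suc j"] f(2) by auto
      have "z \<otimes> (w \<otimes> p') = (z \<otimes> w) \<otimes> p'" by (rule m_assoc[symmetric]) (use w(1) p'(1) z in auto)
      then have "z \<otimes> \<one> = z \<otimes> (w \<otimes> p')" unfolding w(2)[symmetric] p'(2)[symmetric] using z by auto
      then have "\<one> = w \<otimes> p'" using z w(1) p'(1) m_lcancel[of z \<one> "w \<otimes> p'"] by auto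
      then show False using P_smult[OF w(1) p'(1)] by (metis one_not_P)
    qed
  qed (use f in auto)
qed

lemma uniformizer_pow_P: "uniformizer t \<Longrightarrow> t [^] Suc n \<in> P"
  by (induct n) (auto simp: uniformizer_def)

lemma V_pow [simp, intro]: "x \<in> V \<Longrightarrow> x [^] (n::nat) \<in> V"
  by (induct n) auto

text \<open>For y in \<open>P\<close> the exponent is the last power of t that divides y; elements
  outside \<open>V\<close> are treated through their inverses.\<close>

lemma exists_rep:
  assumes t: "uniformizer t" and x: "x \<in> K" "x \<noteq> \<zero>"
  shows "\<exists>u\<in>V - P. \<exists>n::int. x = u \<otimes> t [^] n"
proof -
  have tc: "t \<in> carrier R" "t \<noteq> \<zero>" "t \<in> V" using t by (auto simp: uniformizer_def)
  have pV: "t [^] (n::nat) \<in> V" "t [^] n \<noteq> \<zero>" for n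
    using tc int_pow_closed_nonzero(2)[OF tc(1,2), of "int n"] by (auto simp: int_pow_int)
  have main: "\<exists>u\<in>V - P. \<exists>n::nat. y = u \<otimes> t [^] n" if y: "y \<in> P" "y \<noteq> \<zero>" for y
  proof -
    \<comment> \<open>If every power of t divided y, the powers of t would be pairwise incongruent
      modulo y, against finiteness of V / y V.\<close>
    have "\<exists>n. y \<notin> (\<otimes>) (t [^] (n::nat)) ` V"
    proof (rule ccontr)
      assume "\<nexists>n. y \<notin> (\<otimes>) (t [^] (n::nat)) ` V"
      then have all: "\<And>n::nat. y \<in> (\<otimes>) (t [^] n) ` V" by blast
      show False
      proof (rule finite_incongruent[OF y, of "\<lambda>i. t [^] i"])
        fix i j :: nat assume ij: "i < j"
        then obtain d where j: "j = i + Suc d" using less_iff_Suc_add by auto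
        show "t [^] i \<ominus> t [^] j \<notin> (\<otimes>) y ` V"
        proof
          assume "t [^] i \<ominus> t [^] j \<in> (\<otimes>) y ` V"
          then obtain w where w: "w \<in> V" "t [^] i \<ominus> t [^] j = y \<otimes> w" by auto
          have "t [^] i \<otimes> (\<one> \<oplus> \<ominus> (t [^] Suc d)) = t [^] i \<ominus> t [^] j"
            unfolding j using nat_pow_mult[OF tc(1), of i "Suc d"] tc
            by (simp add: r_distr r_minus a_minus_def del: nat_pow_Suc)
          then have "t [^] i \<in> (\<otimes>) y ` V"
            by (intro unit_not_mult[OF one_plus_P[of "\<ominus> (t [^] Suc d)"]])
               (use w tc y uniformizer_pow_P[OF t, of d] in \<open>auto simp del: nat_pow_Suc\<close>)
          then obtain w where w: "w \<in> V" "t [^] i = y \<otimes> w" by auto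
          obtain w' where w': "w' \<in> V" "y = t [^] Suc i \<otimes> w'" using all[of "Suc i"] by auto
          have "t [^] i \<otimes> (t \<otimes> (w' \<otimes> w)) = (t [^] Suc i \<otimes> w') \<otimes> w"
            using w(1) w'(1) tc by (auto simp: m_assoc)
          then have "t [^] i \<otimes> \<one> = t [^] i \<otimes> (t \<otimes> (w' \<otimes> w))"
            unfolding w'(2)[symmetric] w(2)[symmetric] using tc by auto
          then have "\<one> = t \<otimes> (w' \<otimes> w)" using m_lcancel[of "t [^] i" \<one> "t \<otimes> (w' \<otimes> w)"] pV[of i] tc w(1) w'(1) by auto
          moreover have "t \<in> P" using t by (simp add: uniformizer_def)
          ultimately show False using P_smult'[of "w' \<otimes> w" t] w(1) w'(1) by (metis V_closed(4) one_not_P)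
        qed
      qed (use tc in auto)
    qed
    then obtain n where n: "y \<notin> (\<otimes>) (t [^] (n::nat)) ` V" and least: "\<And>m. m < n \<Longrightarrow> y \<in> (\<otimes>) (t [^] m) ` V"
      using exists_least_iff[of "\<lambda>n. y \<notin> (\<otimes>) (t [^] (n::nat)) ` V"] by blast
    have "n \<noteq> 0"
    proof
      assume "n = 0"
      then show False using n y by (auto intro!: image_eqI[of _ _ y])
    qed
    then obtain m where m: "n = Suc m" by (cases n) auto
    obtain u where u: "u \<in> V" "y = t [^] m \<otimes> u" using least[of m] m by auto
    have "u \<notin> P"
    proof
      assume "u \<in> P"
      then obtain w where w: "w \<in> V" "u = t \<otimes> w" using t by (auto simp: uniformizer_def)
      then have "y = t [^] n \<otimes> w" unfolding u(2) m using tc by (auto simp: m_assoc)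
      then show False using n w by blast
    qed
    moreover have "y = u \<otimes> t [^] m" using u tc by (auto simp: m_comm)
    ultimately show ?thesis using u by blast
  qed
  consider "x \<in> P" | "x \<in> V - P" | "x \<notin> V" by blast
  then show ?thesis
  proof cases
    case 1
    then show ?thesis using main[OF 1 x(2)] by (metis int_pow_int)
  next
    case 2
    then show ?thesis using x by (intro bexI[of _ x] exI[of _ 0]) auto
  next
    case 3
    have ix: "inv x \<in> P" "inv x \<noteq> \<zero>" using not_V_inv_P[OF x(1) 3] inv_nonzero[of x] x by auto
    obtain u n where u: "u \<in> V - P" "inv x = u \<otimes> t [^] (n::nat)" using main[OF ix] by blast
    have u0: "u \<noteq> \<zero>" "u \<in> carrier R" using u unit_iff by auto
    have "x = inv (u \<otimes> t [^] n)" using u inv_nonzero[of x] x by auto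
    also have "\<dots> = inv u \<otimes> inv (t [^] n)" using inv_mult u0 pV tc by auto
    also have "\<dots> = inv u \<otimes> t [^] (- int n)" using int_pow_uminus[OF tc(1,2), of "int n"] by (simp add: int_pow_int)
    finally show ?thesis using unit_inv[OF u(1)] by blast
  qed
qed

lemma unit_int_pow: "u \<in> V - P \<Longrightarrow> u [^] (n::int) \<in> V - P"
proof -
  assume u: "u \<in> V - P"
  have "u [^] (n::nat) \<in> V - P" for n
    by (induct n) (use u unit_mult in auto)
  then show ?thesis unfolding int_pow_def2 using unit_inv by metis
qed

text \<open>Two different uniformizers are allowed because the description operator in
  \<open>place_val\<close> ranges over all generators of \<open>P\<close>.\<close>

lemma rep_unique:
  assumes t: "uniformizer t" "uniformizer t'" and u: "u \<in> V - P" "u' \<in> V - P"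
    and eq: "u \<otimes> t [^] (n::int) = u' \<otimes> t' [^] (m::int)"
  shows "n = m"
proof -
  have tc: "t \<in> carrier R" "t \<noteq> \<zero>" "t' \<in> carrier R" "t' \<noteq> \<zero>" using t by (auto simp: uniformizer_def)
  obtain w where w: "w \<in> V" "t' = t \<otimes> w" using t by (auto simp: uniformizer_def)
  obtain w' where w': "w' \<in> V" "t = t' \<otimes> w'" using t by (auto simp: uniformizer_def)
  have "t \<otimes> (w \<otimes> w') = (t \<otimes> w) \<otimes> w'" by (rule m_assoc[symmetric]) (use w(1) w'(1) tc in auto)
  then have "t \<otimes> \<one> = t \<otimes> (w \<otimes> w')" unfolding w(2)[symmetric] w'(2)[symmetric] using tc by auto
  then have ww: "\<one> = w \<otimes> w'" using m_lcancel[of t \<one> "w \<otimes> w'"] tc w(1) w'(1) by auto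
  have wP: "w \<in> V - P" using w ww P_smult'[OF w'(1), of w] by (metis DiffI one_not_P)
  have w0: "w \<in> carrier R" "w \<noteq> \<zero>" using wP unit_iff by auto
  define s where "s = (u' \<otimes> w [^] m) \<otimes> inv u"
  have s: "s \<in> V - P" unfolding s_def using u unit_mult unit_inv unit_int_pow[OF wP] by metis
  have u0: "u \<in> carrier R" "u \<noteq> \<zero>" "u' \<in> carrier R" using u unit_iff by auto
  note iu = inv_nonzero[OF u0(1,2)]
  note tn = int_pow_closed_nonzero[OF tc(1,2)] and wn = int_pow_closed_nonzero[OF w0]
  have "(u \<otimes> t [^] n) \<otimes> inv u = (u \<otimes> inv u) \<otimes> t [^] n"
    using u0(1) iu[THEN conjunct1] tn(1)[of n] by algebra
  then have "t [^] n = (u \<otimes> t [^] n) \<otimes> inv u" using iu tn by simp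
  also have "\<dots> = (u' \<otimes> (t [^] m \<otimes> w [^] m)) \<otimes> inv u"
    unfolding eq w(2) using int_pow_mult_base[OF tc(1,2) w0] by simp
  also have "\<dots> = s \<otimes> t [^] m" unfolding s_def using tn(1)[of m] wn(1)[of m] u0(1,3) iu[THEN conjunct1] by algebra
  finally have e: "t [^] n = s \<otimes> t [^] m" .
  have "t [^] n = t [^] (n - m) \<otimes> t [^] m" using int_pow_add[OF tc(1,2), of "n - m" m] by simp
  then have ts: "t [^] (n - m) = s" using e m_rcancel[of "t [^] m" "t [^] (n - m)" s] tn s by auto
  show "n = m"
  proof (rule ccontr)
    assume "n \<noteq> m"
    then consider d where "n - m = int (Suc d)" | d where "m - n = int (Suc d)"
      by (metis linorder_less_linear zless_iff_Suc_zadd add_diff_cancel_left')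
    then show False
    proof cases
      case 1
      then have "t [^] Suc d = s" using ts int_pow_int by metis
      then show False using uniformizer_pow_P[OF t(1)] s by (metis DiffD2)
    next
      case 2
      then have "t [^] Suc d = inv s" using ts int_pow_uminus[OF tc(1,2), of "n - m"] int_pow_int by (metis minus_diff_eq)
      then show False using uniformizer_pow_P[OF t(1)] unit_inv[OF s] by (metis DiffD2)
    qed
  qed
qed

abbreviation "v \<equiv> place_val K P"

lemma Units_V: "Units (R\<lparr>carrier := V\<rparr>) = V - P"
proof -
  have "x \<in> Units (R\<lparr>carrier := V\<rparr>) \<longleftrightarrow> x \<in> V - P" for x
  proof
    assume "x \<in> Units (R\<lparr>carrier := V\<rparr>)"
    then obtain y where xy: "x \<in> V" "y \<in> V" "x \<otimes> y = \<one>" by (auto simp: Units_def)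
    then have "x \<notin> P" using P_smult'[of y x] one_not_P by metis
    then show "x \<in> V - P" using xy by blast
  next
    assume x: "x \<in> V - P"
    then show "x \<in> Units (R\<lparr>carrier := V\<rparr>)"
      using unit_inv[OF x] inv_nonzero[of x] unit_iff[of x] by (auto simp: Units_def intro!: bexI[of _ "inv x"])
  qed
  then show ?thesis by blast
qed

lemma PIdl_V: "t \<in> V \<Longrightarrow> PIdl\<^bsub>R\<lparr>carrier := V\<rparr>\<^esub> t = (\<otimes>) t ` V"
  unfolding cgenideal_def using m_comm by (auto simp: image_iff)

lemma uniformizer_iff: "uniformizer t \<longleftrightarrow> t \<in> P \<and> P = PIdl\<^bsub>R\<lparr>carrier := V\<rparr>\<^esub> t"
proof (cases "t \<in> P")
  case True
  then have e: "PIdl\<^bsub>R\<lparr>carrier := V\<rparr>\<^esub> t = (\<otimes>) t ` V" using PIdl_V by auto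
  have "P \<noteq> (\<otimes>) \<zero> ` V"
  proof -
    have "(\<otimes>) \<zero> ` V \<subseteq> {\<zero>}" by auto
    then show ?thesis using exists_nonzero_P by blast
  qed
  then show ?thesis unfolding e using True by (auto simp: uniformizer_def)
qed (auto simp: uniformizer_def)

lemma v_rep:
  assumes t: "uniformizer t" and u: "u \<in> V - P"
  shows "v (u \<otimes> t [^] (n::int)) = n"
  unfolding place_val_def Units_V
proof (rule the_equality)
  show "\<exists>s\<in>P. \<exists>w\<in>V - P. P = PIdl\<^bsub>R\<lparr>carrier := V\<rparr>\<^esub> s \<and> u \<otimes> t [^] n = w \<otimes> s [^] n"
    using t u unfolding uniformizer_iff by blast
next
  fix m :: int assume "\<exists>s\<in>P. \<exists>w\<in>V - P. P = PIdl\<^bsub>R\<lparr>carrier := V\<rparr>\<^esub> s \<and> u \<otimes> t [^] n = w \<otimes> s [^] m"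
  then obtain s w where "s \<in> P" "w \<in> V - P" "P = PIdl\<^bsub>R\<lparr>carrier := V\<rparr>\<^esub> s" "u \<otimes> t [^] n = w \<otimes> s [^] m" by blast
  then show "m = n" using rep_unique[of t s u w n m] t u uniformizer_iff by blast
qed

lemma v_mult:
  assumes "x \<in> K" "x \<noteq> \<zero>" "y \<in> K" "y \<noteq> \<zero>"
  shows "v (x \<otimes> y) = v x + v y"
proof -
  obtain t where t: "uniformizer t" using exists_uniformizer by blast
  have tc: "t \<in> carrier R" "t \<noteq> \<zero>" using t by (auto simp: uniformizer_def)
  obtain u n where u: "u \<in> V - P" "x = u \<otimes> t [^] (n::int)" using exists_rep[OF t assms(1,2)] by blast
  obtain w m where w: "w \<in> V - P" "y = w \<otimes> t [^] (m::int)" using exists_rep[OF t assms(3,4)] by blast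
  have c: "u \<in> carrier R" "w \<in> carrier R" using u w by auto
  have "x \<otimes> y = (u \<otimes> w) \<otimes> (t [^] n \<otimes> t [^] m)"
    unfolding u(2) w(2) using c int_pow_closed_nonzero(1)[OF tc] by (simp add: m_assoc m_lcomm)
  also have "\<dots> = (u \<otimes> w) \<otimes> t [^] (n + m)" using int_pow_add[OF tc] by simp
  finally show ?thesis using v_rep[OF t] u w unit_mult by metis
qed

lemma v_one [simp]: "v \<one> = 0"
  using v_mult[of \<one> \<one>] by simp

lemma v_inv: "x \<in> K \<Longrightarrow> x \<noteq> \<zero> \<Longrightarrow> v (inv x) = - v x"
  using v_mult[of x "inv x"] inv_nonzero[of x] by auto

lemma v_pow: "x \<in> K \<Longrightarrow> x \<noteq> \<zero> \<Longrightarrow> v (x [^] (n::nat)) = int n * v x \<and> x [^] n \<noteq> \<zero>"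
proof (induct n)
  case (Suc n)
  then show ?case using v_mult[of "x [^] n" x] integral[of "x [^] n" x] by (auto simp: algebra_simps)
qed simp

lemma v_pos_iff: "x \<in> K \<Longrightarrow> x \<noteq> \<zero> \<Longrightarrow> x \<in> P \<longleftrightarrow> v x > 0"
  and v_nonneg_iff: "x \<in> K \<Longrightarrow> x \<noteq> \<zero> \<Longrightarrow> x \<in> V \<longleftrightarrow> v x \<ge> 0"
proof -
  obtain t where t: "uniformizer t" using exists_uniformizer by blast
  have tc: "t \<in> carrier R" "t \<noteq> \<zero>" using t by (auto simp: uniformizer_def)
  have pos: "x \<in> P" if x: "x \<in> K" "x \<noteq> \<zero>" "v x > 0" for x
  proof -
    obtain u n where u: "u \<in> V - P" "x = u \<otimes> t [^] (n::int)" using exists_rep[OF t x(1,2)] by blast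
    then have "n > 0" using x(3) v_rep[OF t] by simp
    then obtain d where "n = int (Suc d)" using zero_less_imp_eq_int gr0_conv_Suc by metis
    then have "x = u \<otimes> t [^] Suc d" using u int_pow_int by metis
    then show ?thesis using uniformizer_pow_P[OF t, of d] u by (metis DiffD1 P_smult)
  qed
  have zero: "x \<in> V - P" if x: "x \<in> K" "x \<noteq> \<zero>" "v x = 0" for x
  proof -
    obtain u n where u: "u \<in> V - P" "x = u \<otimes> t [^] (n::int)" using exists_rep[OF t x(1,2)] by blast
    then have "n = 0" using x(3) v_rep[OF t] by simp
    then show ?thesis using u by auto
  qed
  have neg: "x \<notin> V" if x: "x \<in> K" "x \<noteq> \<zero>" "v x < 0" for x
  proof -
    have "inv x \<in> P" using pos[of "inv x"] x v_inv[of x] inv_nonzero[of x] by auto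
    then show ?thesis using inv_nonzero[of x] x mem_P_iff[of "inv x"] by auto
  qed
  show "x \<in> P \<longleftrightarrow> v x > 0" if "x \<in> K" "x \<noteq> \<zero>" for x
    using pos[OF that] zero[OF that] neg[OF that] P_V by (cases "v x" "0::int" rule: linorder_cases) auto
  show "x \<in> V \<longleftrightarrow> v x \<ge> 0" if "x \<in> K" "x \<noteq> \<zero>" for x
    using pos[OF that] zero[OF that] neg[OF that] P_V by (cases "v x" "0::int" rule: linorder_cases) auto
qed

lemma v_uniformizer: "uniformizer t \<Longrightarrow> v t = 1"
  using v_rep[of t \<one> 1] by (auto simp: uniformizer_def int_pow_one_exp)

lemma exists_v: "\<exists>x\<in>K. x \<noteq> \<zero> \<and> v x = n"
proof -
  obtain t where t: "uniformizer t" using exists_uniformizer by blast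
  then have tc: "t \<in> K" "t \<noteq> \<zero>" by (auto simp: uniformizer_def)
  then show ?thesis using v_rep[OF t, of \<one> n] int_pow_closed_nonzero[of t n] by (intro bexI[of _ "t [^] n"]) auto
qed

lemma v_const: "c \<in> k \<Longrightarrow> c \<noteq> \<zero> \<Longrightarrow> v c = 0"
  using v_pos_iff[of c] v_nonneg_iff[of c] k_inter_P[of c] by auto

lemma v_minus: "x \<in> K \<Longrightarrow> x \<noteq> \<zero> \<Longrightarrow> v (\<ominus> x) = v x"
  using v_mult[of "\<ominus> \<one>" x] v_const[of "\<ominus> \<one>"] by (simp add: l_minus)

lemma v_add:
  assumes "x \<in> K" "x \<noteq> \<zero>" "y \<in> K" "y \<noteq> \<zero>" "x \<oplus> y \<noteq> \<zero>"
  shows "v (x \<oplus> y) \<ge> min (v x) (v y)"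
proof -
  have *: "v (x \<oplus> y) \<ge> v x" if a: "x \<in> K" "x \<noteq> \<zero>" "y \<in> K" "y \<noteq> \<zero>" "x \<oplus> y \<noteq> \<zero>" "v x \<le> v y" for x y
  proof -
    note ix = inv_nonzero[of x]
    have q: "y \<otimes> inv x \<in> K" "y \<otimes> inv x \<noteq> \<zero>" using a ix integral[of y "inv x"] by auto
    have "v (y \<otimes> inv x) \<ge> 0" using a v_mult[of y "inv x"] v_inv[of x] ix by auto
    then have V: "\<one> \<oplus> y \<otimes> inv x \<in> V" using v_nonneg_iff[OF q] by auto
    have xc: "x \<in> carrier R" "y \<in> carrier R" using a by auto
    have "x \<otimes> (\<one> \<oplus> y \<otimes> inv x) = x \<oplus> y \<otimes> (x \<otimes> inv x)"
      using xc ix[OF xc(1) a(2), THEN conjunct1] by algebra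
    also have "\<dots> = x \<oplus> y" using ix a by simp
    finally have e: "x \<otimes> (\<one> \<oplus> y \<otimes> inv x) = x \<oplus> y" .
    then have "\<one> \<oplus> y \<otimes> inv x \<noteq> \<zero>" using a by force
    then show ?thesis using v_mult[of x "\<one> \<oplus> y \<otimes> inv x"] v_nonneg_iff[of "\<one> \<oplus> y \<otimes> inv x"] V a e by auto
  qed
  show ?thesis using *[of x y] *[of y x] assms by (cases "v x \<le> v y") (auto simp: a_comm)
qed

lemma v_add_strict:
  assumes x: "x \<in> K" "x \<noteq> \<zero>" and y: "y \<in> K" "y \<noteq> \<zero>" and less: "v x < v y"
  shows "x \<oplus> y \<noteq> \<zero>" "v (x \<oplus> y) = v x"
proof -
  show nz: "x \<oplus> y \<noteq> \<zero>"
  proof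
    assume "x \<oplus> y = \<zero>"
    then have "x = \<ominus> y" using x y by (simp add: minus_equality)
    then show False using v_minus[OF y] less by simp
  qed
  have "v (x \<oplus> y) \<ge> v x" using v_add[OF x y nz] less by simp
  moreover have "x = (x \<oplus> y) \<oplus> \<ominus> y" using x y by (simp add: a_assoc r_neg)
  then have "v x \<ge> min (v (x \<oplus> y)) (v y)"
    using v_add[of "x \<oplus> y" "\<ominus> y"] v_minus[OF y] x y nz by auto
  ultimately show "v (x \<oplus> y) = v x" using less by simp
qed

end

section \<open>Weak approximation\<close>

context finite_function_field
begin

lemma placeI: "P \<in> places k K \<Longrightarrow> place R k K P"
  by unfold_locales

definition val_ge :: "'a set \<Rightarrow> int \<Rightarrow> 'a set" where
  "val_ge P n = {x \<in> K. x = \<zero> \<or> n \<le> place_val K P x}"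

lemma val_ge_K [intro]: "x \<in> val_ge P n \<Longrightarrow> x \<in> K"
  by (simp add: val_ge_def)

lemma val_ge_mono: "x \<in> val_ge P n \<Longrightarrow> m \<le> n \<Longrightarrow> x \<in> val_ge P m"
  by (auto simp: val_ge_def)

lemma zero_val_ge [simp, intro]: "\<zero> \<in> val_ge P n"
  by (simp add: val_ge_def)

end

context place
begin

lemma val_ge_0: "val_ge P 0 = V"
  using v_nonneg_iff by (auto simp: val_ge_def)

lemma val_ge_1: "val_ge P 1 = P"
proof -
  have "x \<in> P \<longleftrightarrow> x \<in> K \<and> (x = \<zero> \<or> 1 \<le> v x)" for x
    using v_pos_iff[of x] by (cases "x \<in> K \<and> x \<noteq> \<zero>") auto
  then show ?thesis by (auto simp: val_ge_def)
qed

lemma val_ge_add: "x \<in> val_ge P n \<Longrightarrow> y \<in> val_ge P n \<Longrightarrow> x \<oplus> y \<in> val_ge P n"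
  using v_add[of x y] by (cases "x = \<zero> \<or> y = \<zero> \<or> x \<oplus> y = \<zero>") (auto simp: val_ge_def)

lemma val_ge_uminus: "x \<in> val_ge P n \<Longrightarrow> \<ominus> x \<in> val_ge P n"
  using v_minus[of x] by (cases "x = \<zero>") (auto simp: val_ge_def)

lemma val_ge_diff: "x \<in> val_ge P n \<Longrightarrow> y \<in> val_ge P n \<Longrightarrow> x \<ominus> y \<in> val_ge P n"
  by (simp add: a_minus_def val_ge_add val_ge_uminus)

lemma val_ge_mult: "x \<in> val_ge P n \<Longrightarrow> y \<in> val_ge P m \<Longrightarrow> x \<otimes> y \<in> val_ge P (n + m)"
  using v_mult[of x y] by (cases "x = \<zero> \<or> y = \<zero>") (auto simp: val_ge_def)

end

context finite_function_field
begin

text \<open>A discrete valuation ring is a maximal proper subring: together with an element x of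
  negative value it generates all of \<open>K\<close>.\<close>

lemma place_ring_subset_imp_eq:
  assumes P: "P \<in> places k K" and Q: "Q \<in> places k K" and sub: "place_ring K P \<subseteq> place_ring K Q"
  shows "P = Q"
proof -
  interpret P: place R k K P using placeI[OF P] .
  interpret Q: place R k K Q using placeI[OF Q] .
  have "place_ring K Q \<subseteq> place_ring K P"
  proof (rule ccontr)
    assume "\<not> ?thesis"
    then obtain x where x: "x \<in> Q.V" "x \<notin> P.V" by blast
    then have xK: "x \<in> K" "x \<noteq> \<zero>" by auto
    have vx: "P.v x < 0" using P.v_nonneg_iff[OF xK] x by simp
    have "y \<in> Q.V" if y: "y \<in> K" for y
    proof (cases "y = \<zero>")
      case False
      \<comment> \<open>As the value of x at \<open>P\<close> is at most -1, dividing y by this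
        power of x makes it integral at \<open>P\<close>.\<close>
      define n where "n = nat \<bar>P.v y\<bar>"
      note p = P.v_pow[OF xK, of n] and ip = inv_nonzero[of "x [^] n"]
      have i: "inv (x [^] n) \<in> K" "inv (x [^] n) \<noteq> \<zero>" using p xK ip by auto
      have vi: "P.v (inv (x [^] n)) = - (int n * P.v x)" using P.v_inv[of "x [^] n"] p xK by auto
      have "int n * 1 \<le> int n * - P.v x" using vx by (intro mult_left_mono) auto
      then have "P.v (y \<otimes> inv (x [^] n)) \<ge> 0"
        using P.v_mult[OF y False i] vi n_def by simp
      moreover have "y \<otimes> inv (x [^] n) \<noteq> \<zero>" using integral[of y "inv (x [^] n)"] y i False by auto
      ultimately have "y \<otimes> inv (x [^] n) \<in> Q.V"
        using P.v_nonneg_iff[of "y \<otimes> inv (x [^] n)"] sub y i by auto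
      then have "(y \<otimes> inv (x [^] n)) \<otimes> x [^] n \<in> Q.V" using x by auto
      also have "(y \<otimes> inv (x [^] n)) \<otimes> x [^] n = y \<otimes> (inv (x [^] n) \<otimes> x [^] n)"
        by (rule m_assoc) (use y i xK in auto)
      also have "\<dots> = y" using ip p xK y by auto
      finally show ?thesis .
    qed auto
    then show False using Q.V_props(4,5) by blast
  qed
  then show ?thesis using sub P.P_eq Q.P_eq by (metis subset_antisym)
qed

text \<open>By incomparability of the two rings choose x integral only at \<open>P\<close> and y
  integral only at \<open>Q\<close>; their quotient x / y works.\<close>

lemma exists_separating_element:
  assumes P: "P \<in> places k K" and Q: "Q \<in> places k K" and neq: "P \<noteq> Q"
  shows "\<exists>u\<in>K. u \<noteq> \<zero> \<and> place_val K P u > 0 \<and> place_val K Q u < 0"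
proof -
  interpret P: place R k K P using placeI[OF P] .
  interpret Q: place R k K Q using placeI[OF Q] .
  obtain x where x: "x \<in> P.V" "x \<notin> Q.V" using place_ring_subset_imp_eq[OF P Q] neq by blast
  obtain y where y: "y \<in> Q.V" "y \<notin> P.V" using place_ring_subset_imp_eq[OF Q P] neq by blast
  have K: "x \<in> K" "x \<noteq> \<zero>" "y \<in> K" "y \<noteq> \<zero>" using x y by auto
  have i: "inv y \<in> K" "inv y \<noteq> \<zero>" using K inv_nonzero[of y] by auto
  have "P.v x \<ge> 0" "P.v y < 0" "Q.v x < 0" "Q.v y \<ge> 0"
    using x y K P.v_nonneg_iff Q.v_nonneg_iff by (meson not_le)+
  then have "P.v (x \<otimes> inv y) > 0" "Q.v (x \<otimes> inv y) < 0"
    using P.v_mult[OF K(1,2) i] Q.v_mult[OF K(1,2) i] P.v_inv[OF K(3,4)] Q.v_inv[OF K(3,4)] by auto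
  moreover have "x \<otimes> inv y \<noteq> \<zero>" using integral[of x "inv y"] K i by auto
  ultimately show ?thesis using K i by (intro bexI[of _ "x \<otimes> inv y"]) auto
qed

text \<open>Induction on \<open>S\<close>: if y fails at the new place, a high power of a function
  separating it from \<open>P\<close> is added to y.\<close>

lemma exists_isolating_element:
  assumes "finite S" "S \<subseteq> places k K" "P \<in> places k K" "P \<notin> S"
  shows "\<exists>u\<in>K. u \<noteq> \<zero> \<and> place_val K P u > 0 \<and> (\<forall>Q\<in>S. place_val K Q u < 0)"
  using assms
proof (induct S)
  case empty
  then show ?case using place.exists_v[OF placeI, of P 1] by auto
next
  case (insert Q S)
  obtain y where y: "y \<in> K" "y \<noteq> \<zero>" "place_val K P y > 0" "\<And>Q. Q \<in> S \<Longrightarrow> place_val K Q y < 0"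
    using insert by auto
  interpret P: place R k K P using placeI insert by simp
  interpret Q: place R k K Q using placeI insert by simp
  show ?case
  proof (cases "Q.v y < 0")
    case True
    then show ?thesis using y by auto
  next
    case False
    obtain z where z: "z \<in> K" "z \<noteq> \<zero>" "P.v z > 0" "Q.v z < 0"
      using exists_separating_element[of P Q] insert by auto
    define r where "r = Suc (nat (\<Sum>Q\<in>S. \<bar>place_val K Q y\<bar>))"
    \<comment> \<open>The exponent exceeds all values of y on \<open>S\<close>, so y and z^r never
      have equal value there and the pole cannot cancel.\<close>
    have r: "\<bar>place_val K T y\<bar> < int r" if "T \<in> S" for T
      using member_le_sum[of T S "\<lambda>Q. \<bar>place_val K Q y\<bar>"] insert(1) that by (auto simp: r_def)
    have rp: "r > 0" by (simp add: r_def)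
    have zr: "z [^] r \<in> K" "z [^] r \<noteq> \<zero>" using z P.v_pow[of z r] by auto
    have vQ: "Q.v (z [^] r) < Q.v y" using Q.v_pow[OF z(1,2), of r] z rp False
      by (smt (verit) mult_pos_neg of_nat_0_less_iff)
    have u: "y \<oplus> z [^] r \<noteq> \<zero>" "Q.v (y \<oplus> z [^] r) < 0"
      using Q.v_add_strict[OF zr y(1,2) vQ] y zr vQ z Q.v_pow[OF z(1,2), of r] rp
      by (auto simp: a_comm mult_pos_neg)
    have vP: "P.v (y \<oplus> z [^] r) > 0"
      using P.v_add[OF y(1,2) zr u(1)] P.v_pow[OF z(1,2), of r] z y(3) rp
      by (smt (verit) mult_pos_pos of_nat_0_less_iff)
    have "place_val K T (y \<oplus> z [^] r) < 0" if T: "T \<in> S" for T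
    proof -
      interpret T: place R k K T using placeI insert T by auto
      have e: "T.v (z [^] r) = int r * T.v z" using T.v_pow[OF z(1,2)] by simp
      consider "T.v z < 0" | "T.v z = 0" | "T.v z > 0" by linarith
      then show ?thesis
      proof cases
        case 1
        then have "int r * 1 \<le> int r * - T.v z" by (intro mult_left_mono) auto
        then have "T.v (z [^] r) < T.v y" using r[OF T] e by simp
        then show ?thesis using T.v_add_strict[OF zr y(1,2)] y(4)[OF T] y zr by (simp add: a_comm)
      next
        case 2
        then show ?thesis using T.v_add_strict[OF y(1,2) zr] y(4)[OF T] e by simp
      next
        case 3
        then have "T.v (z [^] r) \<ge> 0" using e by simp
        then show ?thesis using T.v_add_strict[OF y(1,2) zr] y(4)[OF T] by simp
      qed
    qed
    then show ?thesis using u vP y zr by (intro bexI[of _ "y \<oplus> z [^] r"]) auto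
  qed
qed

text \<open>The witness is 1 / (1 + u^n): u vanishes at \<open>P\<close>, where the quotient is
  close to 1, and has poles on \<open>S\<close>, where it is close to 0.\<close>

lemma exists_idempotent_like:
  assumes S: "finite S" "S \<subseteq> places k K" "P \<in> places k K" "P \<notin> S" and n: "n > 0"
  shows "\<exists>w\<in>K. w \<ominus> \<one> \<in> val_ge P (int n) \<and> (\<forall>Q\<in>S. w \<in> val_ge Q (int n))"
proof -
  interpret P: place R k K P using placeI S by simp
  obtain u where u: "u \<in> K" "u \<noteq> \<zero>" "P.v u > 0" "\<And>Q. Q \<in> S \<Longrightarrow> place_val K Q u < 0"
    using exists_isolating_element[OF S] by auto
  have un: "u [^] n \<in> K" "u [^] n \<noteq> \<zero>" using u P.v_pow[of u n] by auto
  have "int n * 1 \<le> int n * P.v u" using u by (intro mult_left_mono) auto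
  then have vP: "P.v (u [^] n) \<ge> int n" using P.v_pow[OF u(1,2), of n] by simp
  define s where "s = \<one> \<oplus> u [^] n"
  have s: "s \<noteq> \<zero>" "P.v s = 0" "s \<in> K"
    using P.v_add_strict[of \<one> "u [^] n"] un vP n by (auto simp: s_def)
  note si = inv_nonzero[of s]
  have i: "inv s \<in> K" "inv s \<noteq> \<zero>" using s si by auto
  have "inv s \<ominus> inv s \<otimes> s = \<ominus> (u [^] n \<otimes> inv s)"
  proof -
    have "inv s \<in> carrier R" "u [^] n \<in> carrier R" using i un by auto
    then have "inv s \<ominus> inv s \<otimes> (\<one> \<oplus> u [^] n) = \<ominus> (u [^] n \<otimes> inv s)" by algebra
    then show ?thesis using s_def by simp
  qed
  then have "inv s \<ominus> \<one> = \<ominus> (u [^] n \<otimes> inv s)" using si s by simp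
  moreover have "u [^] n \<otimes> inv s \<in> val_ge P (int n + 0)"
    using P.val_ge_mult[of "u [^] n" "int n" "inv s" 0] un vP i P.v_inv[of s] s by (auto simp: val_ge_def)
  ultimately have a: "inv s \<ominus> \<one> \<in> val_ge P (int n)" using P.val_ge_uminus by simp
  have "inv s \<in> val_ge Q (int n)" if Q: "Q \<in> S" for Q
  proof -
    interpret Q: place R k K Q using placeI S Q by auto
    have "int n * 1 \<le> int n * - Q.v u" using u(4)[OF Q] by (intro mult_left_mono) auto
    then have vn: "Q.v (u [^] n) \<le> - int n" using Q.v_pow[OF u(1,2), of n] by simp
    then have "Q.v s = Q.v (u [^] n)"
      using Q.v_add_strict[OF un, of \<one>] n un by (simp add: s_def a_comm)
    then show ?thesis using Q.v_inv[of s] s i vn by (simp add: val_ge_def)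
  qed
  then show ?thesis using a i by blast
qed

text \<open>An approximation on \<open>S\<close> is corrected at a new place by y w, where y is the
  error there and w is close to 1 at that place and close to 0 on \<open>S\<close>.\<close>

theorem weak_approximation:
  assumes "finite S" "S \<subseteq> places k K" "\<And>P. P \<in> S \<Longrightarrow> a P \<in> K"
  shows "\<exists>x\<in>K. \<forall>P\<in>S. x \<ominus> a P \<in> val_ge P n"
  using assms
proof (induct S)
  case (insert P S)
  obtain x where x: "x \<in> K" "\<And>Q. Q \<in> S \<Longrightarrow> x \<ominus> a Q \<in> val_ge Q n" using insert by auto
  define y where "y = a P \<ominus> x"
  have aP: "a P \<in> K" and y: "y \<in> K" using insert x by (auto simp: y_def)
  \<comment> \<open>The precision demanded of w includes the size of the values of y, since y may
    have poles at the places concerned.\<close>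
  define r where "r = Suc (nat (\<Sum>Q\<in>insert P S. \<bar>n\<bar> + \<bar>place_val K Q y\<bar>))"
  have r: "\<bar>n\<bar> + \<bar>place_val K Q y\<bar> \<le> int r" if "Q \<in> insert P S" for Q
    using member_le_sum[of Q "insert P S" "\<lambda>Q. \<bar>n\<bar> + \<bar>place_val K Q y\<bar>"] insert(1) that by (auto simp: r_def)
  obtain w where w: "w \<in> K" "w \<ominus> \<one> \<in> val_ge P (int r)" "\<And>Q. Q \<in> S \<Longrightarrow> w \<in> val_ge Q (int r)"
    using exists_idempotent_like[of S P r] insert by (auto simp: r_def)
  have yw: "y \<otimes> s \<in> val_ge Q n" if Q: "Q \<in> insert P S" and s: "s \<in> val_ge Q (int r)" for Q s
  proof -
    interpret Q: place R k K Q using placeI insert Q by auto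
    have "y \<in> val_ge Q (Q.v y)" using y by (simp add: val_ge_def)
    then show ?thesis using Q.val_ge_mult[OF _ s] val_ge_mono r[OF Q] by (smt (verit))
  qed
  let ?x = "x \<oplus> y \<otimes> w"
  have c: "x \<in> carrier R" "y \<in> carrier R" "w \<in> carrier R" "a P \<in> carrier R" using x y w aP by auto
  have "?x \<ominus> a Q \<in> val_ge Q n" if Q: "Q \<in> insert P S" for Q
  proof -
    interpret Q: place R k K Q using placeI insert Q by auto
    show ?thesis
    proof (cases "Q = P")
      case True
      have "?x \<ominus> a P = y \<otimes> (w \<ominus> \<one>)" unfolding y_def using c(1,3,4) by algebra
      then show ?thesis using yw[OF Q] w(2) True by simp
    next
      case False
      then have QS: "Q \<in> S" using Q by simp
      have aQ: "a Q \<in> carrier R" using insert(5)[OF Q] by auto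
      have "?x \<ominus> a Q = (x \<ominus> a Q) \<oplus> y \<otimes> w" using c aQ by algebra
      then show ?thesis using Q.val_ge_add[OF x(2)[OF QS] yw[OF Q w(3)[OF QS]]] by simp
    qed
  qed
  then show ?case using x y w by (intro bexI[of _ ?x]) auto
qed auto

end

section \<open>Residue fields\<close>

context ring
begin

lemma card_dimension:
  assumes K: "subfield K R" "finite K" and "dimension n K E"
  shows "finite E \<and> card E = card K ^ n"
  using assms(3)
proof (induct n arbitrary: E)
  case 0
  then have "E = {\<zero>}" using dimension_zero[OF K(1)] by blast
  then show ?case by simp
next
  case (Suc n)
  from Suc(2) obtain w F where F: "w \<in> carrier R" "w \<notin> F" "dimension n K F" "E = line_extension K w F"
    by (cases rule: dimension.cases) auto
  note IH = Suc(1)[OF F(3)] and sp = space_subgroup_props[OF K(1) F(3)]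
  have Kc: "\<And>c. c \<in> K \<Longrightarrow> c \<in> carrier R" using subfieldE(3)[OF K(1)] by auto
  have Fc: "\<And>e. e \<in> F \<Longrightarrow> e \<in> carrier R" using sp(1) by auto
  have E: "E = (\<lambda>(c, e). c \<otimes> w \<oplus> e) ` (K \<times> F)"
  proof (intro Set.set_eqI iffI)
    fix x assume "x \<in> E"
    then obtain c e where "c \<in> K" "e \<in> F" "x = c \<otimes> w \<oplus> e" unfolding F(4) line_extension_mem_iff by blast
    then show "x \<in> (\<lambda>(c, e). c \<otimes> w \<oplus> e) ` (K \<times> F)" by (intro image_eqI[of _ _ "(c, e)"]) auto
  next
    fix x assume "x \<in> (\<lambda>(c, e). c \<otimes> w \<oplus> e) ` (K \<times> F)"
    then obtain c e where "c \<in> K" "e \<in> F" "x = c \<otimes> w \<oplus> e" by auto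
    then show "x \<in> E" unfolding F(4) line_extension_mem_iff by blast
  qed
  have inj: "inj_on (\<lambda>(c, e). c \<otimes> w \<oplus> e) (K \<times> F)"
  proof (rule inj_onI, clarify)
    fix c e d f assume a: "c \<in> K" "e \<in> F" "d \<in> K" "f \<in> F" "c \<otimes> w \<oplus> e = d \<otimes> w \<oplus> f"
    note cc = a(1,3)[THEN Kc] a(2,4)[THEN Fc]
    have "(c \<ominus> d) \<otimes> w = (c \<otimes> w \<oplus> e) \<oplus> \<ominus> (d \<otimes> w) \<oplus> \<ominus> e"
      using cc F(1) by (simp add: l_distr l_minus a_minus_def a_ac r_neg1 r_neg2 r_neg)
    also have "\<dots> = f \<oplus> \<ominus> e" unfolding a(5) using cc F(1) by (simp add: a_ac r_neg1 r_neg2 r_neg)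
    finally have m: "(c \<ominus> d) \<otimes> w \<in> F" using sp(3)[OF a(4) sp(4)[OF a(2)]] by simp
    have "c \<ominus> d \<in> K" using subringE(5,7)[OF subfieldE(1)[OF K(1)]] a by (simp add: a_minus_def)
    then have "c \<ominus> d = \<zero>" using sp(6)[of "c \<ominus> d" w] m F(1,2) by auto
    then have "c = d" using cc by simp
    then show "c = d \<and> e = f" using a(5) cc F(1) by simp
  qed
  show ?case unfolding E using inj IH K(2) by (simp add: card_image card_cartesian_product)
qed

text \<open>Over a finite field a dimension can be read off from a cardinality; residue degrees and
  \<open>ell\<close> are always computed in this way.\<close>

lemma card_dim:
  assumes K: "subfield K R" "finite K" and E: "subalgebra K E R" "finite E"
  shows "card E = card K ^ dim K E"
proof -
  obtain Us where Us: "set Us = E" using finite_list[OF E(2)] by blast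
  have c: "set Us \<subseteq> carrier R" using subalgebra_in_carrier[OF E(1)] Us by simp
  have "Span K Us = E"
    using subalgebra_Span_incl[OF K(1) E(1), of Us] Span_base_incl[OF K(1) c] Us by auto
  then have "finite_dimension K E" using Span_finite_dimension[OF K(1) c] by simp
  then have "dimension (dim K E) K E" using finite_dimensionE[OF K(1)] by (simp add: over_def)
  then show ?thesis using card_dimension[OF K] by blast
qed

end

context place
begin

abbreviation "pdeg \<equiv> place_degree k K P"

text \<open>Translates the quotient ring in \<open>place_degree\<close> into a set of
  representatives, after which residue fields are handled by congruences. Finiteness holds because z
  V lies in \<open>P\<close> for any z in \<open>P\<close>.\<close>

lemma card_residues:
  obtains T where "T \<subseteq> V" "finite T" "card T = card k ^ pdeg"
    "\<And>s t. s \<in> T \<Longrightarrow> t \<in> T \<Longrightarrow> s \<ominus> t \<in> P \<Longrightarrow> s = t" "\<And>x. x \<in> V \<Longrightarrow> \<exists>t\<in>T. x \<ominus> t \<in> P"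
proof -
  let ?V = "R\<lparr>carrier := V\<rparr>"
  let ?F = "?V Quot P"
  have Vsub: "subring V R" using V_props(1) .
  have "subcring V R" using subcringI'[OF Vsub] .
  then have cr: "cring ?V" using subcring_iff[OF subringE(1)[OF Vsub]] by simp
  interpret V: cring ?V using cr .
  have "maximalideal P ?V" using nonunits_maximalideal(1)[OF place_valuation_ring(1)[OF P] subfield_K] P_eq by simp
  then interpret M: maximalideal P ?V .
  have fld: "field ?F" using M.quotient_is_field[OF cr] .
  interpret F: field ?F using fld .
  interpret h: ring_hom_ring ?V ?F "\<lambda>x. P +>\<^bsub>?V\<^esub> x" using M.rcos_ring_hom_ring .
  have cos: "P +>\<^bsub>?V\<^esub> x = P +>\<^bsub>?V\<^esub> y \<longleftrightarrow> x \<ominus> y \<in> P" if xy: "x \<in> V" "y \<in> V" for x y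
  proof
    assume "P +>\<^bsub>?V\<^esub> x = P +>\<^bsub>?V\<^esub> y"
    then have "x \<in> P +>\<^bsub>?V\<^esub> y" using M.a_rcos_self[of x] xy by simp
    then obtain p where p: "p \<in> P" "x = p \<oplus> y" by (auto simp: a_r_coset_def')
    have "p \<oplus> y \<ominus> y = p" using p(1) xy by (simp add: a_minus_def a_assoc r_neg)
    then show "x \<ominus> y \<in> P" using p by simp
  next
    assume p: "x \<ominus> y \<in> P"
    have "x = (x \<ominus> y) \<oplus> y" using xy by (simp add: a_minus_def a_assoc l_neg)
    then have "x \<in> P +>\<^bsub>?V\<^esub> y" using p by (auto simp: a_r_coset_def')
    then show "P +>\<^bsub>?V\<^esub> x = P +>\<^bsub>?V\<^esub> y" using M.a_repr_independence'[of x y] xy by simp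
  qed
  have carF: "carrier ?F = (\<lambda>x. P +>\<^bsub>?V\<^esub> x) ` V"
    unfolding FactRing_def A_RCOSETS_defs by (auto simp: a_r_coset_def)
  define \<rho> where "\<rho> = (\<lambda>C. SOME x. x \<in> V \<and> P +>\<^bsub>?V\<^esub> x = C)"
  have \<rho>: "\<rho> C \<in> V \<and> P +>\<^bsub>?V\<^esub> (\<rho> C) = C" if "C \<in> carrier ?F" for C
    unfolding \<rho>_def by (rule someI_ex) (use that carF in auto)
  define T where "T = \<rho> ` carrier ?F"
  have TV: "T \<subseteq> V" using \<rho> by (auto simp: T_def)
  have inc: "s = t" if "s \<in> T" "t \<in> T" "s \<ominus> t \<in> P" for s t
  proof -
    obtain C D where CD: "C \<in> carrier ?F" "D \<in> carrier ?F" "s = \<rho> C" "t = \<rho> D" using \<open>s \<in> T\<close> \<open>t \<in> T\<close> by (auto simp: T_def)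
    then have "C = D" using cos[of s t] \<rho> that TV by metis
    then show ?thesis using CD by simp
  qed
  have cov: "\<exists>t\<in>T. x \<ominus> t \<in> P" if x: "x \<in> V" for x
  proof -
    have C: "P +>\<^bsub>?V\<^esub> x \<in> carrier ?F" using carF x by blast
    show ?thesis using cos[of x "\<rho> (P +>\<^bsub>?V\<^esub> x)"] \<rho>[OF C] x C by (auto simp: T_def)
  qed
  have inj: "inj_on \<rho> (carrier ?F)" by (rule inj_onI) (metis \<rho>)
  obtain z where z: "z \<in> P" "z \<noteq> \<zero>" using exists_nonzero_P by blast
  have "(\<otimes>) z ` V \<subseteq> P" using z by auto
  then have "finite T"
    using card_incongruent_le[OF _ P_nonconstant[OF z] V_props(1,2) _ V_props(4) TV] inc z by blast
  then have finF: "finite (carrier ?F)" using finite_imageD inj unfolding T_def by blast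
  let ?k = "(\<lambda>a. P +>\<^bsub>?V\<^esub> a) ` k"
  have "subfield k ?V"
  proof (rule ring.subfield_iff(1)[OF V.ring_axioms])
    show "field (?V\<lparr>carrier := k\<rparr>)" using subfield_iff(2)[OF subfield_k] by simp
  qed auto
  then have sk: "subfield ?k ?F" using h.img_is_subfield(2) F.one_not_zero by auto
  have "card ?k = card k"
  proof (rule card_image, rule inj_onI)
    fix a b assume ab: "a \<in> k" "b \<in> k" "P +>\<^bsub>?V\<^esub> a = P +>\<^bsub>?V\<^esub> b"
    then have "a \<ominus> b = \<zero>" using cos[of a b] k_inter_P[of "a \<ominus> b"] by auto
    then show "a = b" using ab by simp
  qed
  moreover have "card (carrier ?F) = card ?k ^ F.dim ?k (carrier ?F)"
    using F.card_dim[OF sk _ F.carrier_is_subalgebra[OF subfieldE(3)[OF sk]] finF] finite_k by simp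
  moreover have "pdeg = F.dim ?k (carrier ?F)" by (simp add: place_degree_def Let_def)
  moreover have "card T = card (carrier ?F)" unfolding T_def using card_image[OF inj] .
  ultimately have "card T = card k ^ pdeg" by simp
  then show thesis using that[OF TV \<open>finite T\<close> _ inc cov] by blast
qed

lemma P_cong_trans: "x \<ominus> t \<in> P \<Longrightarrow> y \<ominus> t \<in> P \<Longrightarrow> x \<in> V \<Longrightarrow> y \<in> V \<Longrightarrow> t \<in> V \<Longrightarrow> x \<ominus> y \<in> P"
proof -
  assume a: "x \<ominus> t \<in> P" "y \<ominus> t \<in> P" "x \<in> V" "y \<in> V" "t \<in> V"
  have c: "x \<in> carrier R" "y \<in> carrier R" "t \<in> carrier R" using a by auto
  have "x \<ominus> y = (x \<ominus> t) \<ominus> (y \<ominus> t)" using c by algebra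
  then show ?thesis using P_closed(4)[OF a(1,2)] by simp
qed

lemma incongruent_card_le:
  assumes "S \<subseteq> V" "\<And>s t. s \<in> S \<Longrightarrow> t \<in> S \<Longrightarrow> s \<ominus> t \<in> P \<Longrightarrow> s = t"
  shows "finite S \<and> card S \<le> card k ^ pdeg"
proof -
  obtain T where T: "T \<subseteq> V" "finite T" "card T = card k ^ pdeg"
    "\<And>s t. s \<in> T \<Longrightarrow> t \<in> T \<Longrightarrow> s \<ominus> t \<in> P \<Longrightarrow> s = t" "\<And>x. x \<in> V \<Longrightarrow> \<exists>t\<in>T. x \<ominus> t \<in> P"
    by (rule card_residues) (rule that; blast)
  obtain f where f: "\<And>x. x \<in> V \<Longrightarrow> f x \<in> T \<and> x \<ominus> f x \<in> P" using T(5) by metis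
  have inj: "inj_on f S"
  proof (rule inj_onI)
    fix s t assume st: "s \<in> S" "t \<in> S" "f s = f t"
    have "s \<in> V" "t \<in> V" using st assms(1) by auto
    then have "s \<ominus> t \<in> P" using P_cong_trans[of s "f s" t] f[of s] f[of t] st(3) T(1) by (metis subsetD)
    then show "s = t" using assms(2) st by blast
  qed
  have im: "f ` S \<subseteq> T" using f assms(1) by auto
  have "finite S" using finite_imageD[OF finite_subset[OF im T(2)] inj] .
  moreover have "card S \<le> card k ^ pdeg" using card_inj_on_le[OF inj im T(2)] T(3) by simp
  ultimately show ?thesis by blast
qed

lemma k_incongruent: "a \<in> k \<Longrightarrow> b \<in> k \<Longrightarrow> a \<ominus> b \<in> P \<Longrightarrow> a = b"
  using k_inter_P[of "a \<ominus> b"] by auto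

lemma deg_pos: "pdeg \<ge> 1"
proof -
  have "card k \<le> card k ^ pdeg" using incongruent_card_le[of k] k_incongruent by auto
  then show ?thesis using card_k by (cases pdeg) auto
qed

text \<open>The working form of rationality: every function regular at \<open>P\<close> takes a
  value in \<open>k\<close>. Otherwise a class outside \<open>k\<close> would be one too
  many.\<close>

lemma deg_one_iff: "pdeg = 1 \<longleftrightarrow> (\<forall>x\<in>V. \<exists>c\<in>k. x \<ominus> c \<in> P)"
proof
  assume d: "pdeg = 1"
  show "\<forall>x\<in>V. \<exists>c\<in>k. x \<ominus> c \<in> P"
  proof (rule ccontr)
    assume "\<not> ?thesis"
    then obtain x where x: "x \<in> V" "\<And>c. c \<in> k \<Longrightarrow> x \<ominus> c \<notin> P" by blast
    have x2: "c \<ominus> x \<notin> P" if c: "c \<in> k" for c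
    proof
      assume "c \<ominus> x \<in> P"
      then have "\<ominus> (c \<ominus> x) \<in> P" by auto
      moreover have "\<ominus> (c \<ominus> x) = x \<ominus> c" using c x by (simp add: a_minus_def minus_add a_comm)
      ultimately show False using x c by simp
    qed
    have xk: "x \<notin> k" using x(2)[of x] x(1) by (auto simp: a_minus_def r_neg)
    have "card (insert x k) \<le> card k ^ pdeg"
      using incongruent_card_le[of "insert x k"] x x2 k_incongruent by auto
    then show False using d xk finite_k by simp
  qed
next
  assume all: "\<forall>x\<in>V. \<exists>c\<in>k. x \<ominus> c \<in> P"
  obtain T where T: "T \<subseteq> V" "finite T" "card T = card k ^ pdeg"
    "\<And>s t. s \<in> T \<Longrightarrow> t \<in> T \<Longrightarrow> s \<ominus> t \<in> P \<Longrightarrow> s = t" "\<And>x. x \<in> V \<Longrightarrow> \<exists>t\<in>T. x \<ominus> t \<in> P"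
    by (rule card_residues) (rule that; blast)
  obtain f where f: "\<And>x. x \<in> V \<Longrightarrow> f x \<in> k \<and> x \<ominus> f x \<in> P" using all by metis
  have inj: "inj_on f T"
  proof (rule inj_onI)
    fix s t assume st: "s \<in> T" "t \<in> T" "f s = f t"
    have "s \<in> V" "t \<in> V" using st T(1) by auto
    then have "s \<ominus> t \<in> P" using P_cong_trans[of s "f s" t] f[of s] f[of t] st(3) by (metis k_V)
    then show "s = t" using T(4) st by blast
  qed
  have "card T \<le> card k" using card_inj_on_le[OF inj _ finite_k] f T(1) by blast
  then have "card k ^ pdeg \<le> card k ^ 1" using T(3) by simp
  then have "pdeg \<le> 1" using card_k power_increasing_iff[of "card k" pdeg 1] by linarith
  then show "pdeg = 1" using deg_pos by simp
qed

end

section \<open>Zeros of a function\<close>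

context place
begin

text \<open>Truncated expansions r + t s with digits r from a residue system show that V / P^e has
  at least q^(e deg P) classes.\<close>

lemma exists_incongruent_system:
  "\<exists>T. T \<subseteq> V \<and> finite T \<and> card T = (card k ^ pdeg) ^ e \<and> (\<forall>s\<in>T. \<forall>t\<in>T. s \<ominus> t \<in> val_ge P (int e) \<longrightarrow> s = t)"
proof (induct e)
  case 0
  then show ?case by (intro exI[of _ "{\<zero>}"]) auto
next
  case (Suc e)
  obtain T where T: "T \<subseteq> V" "finite T" "card T = (card k ^ pdeg) ^ e"
    "\<And>s t. s \<in> T \<Longrightarrow> t \<in> T \<Longrightarrow> s \<ominus> t \<in> val_ge P (int e) \<Longrightarrow> s = t" using Suc by metis
  obtain Q where Q: "Q \<subseteq> V" "finite Q" "card Q = card k ^ pdeg"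
    "\<And>s t. s \<in> Q \<Longrightarrow> t \<in> Q \<Longrightarrow> s \<ominus> t \<in> P \<Longrightarrow> s = t" "\<And>x. x \<in> V \<Longrightarrow> \<exists>t\<in>Q. x \<ominus> t \<in> P"
    by (rule card_residues) (rule that; blast)
  obtain t where t: "uniformizer t" using exists_uniformizer by blast
  then have tP: "t \<in> P" "t \<noteq> \<zero>" "t \<in> K" "t \<in> carrier R" by (auto simp: uniformizer_def)
  let ?f = "\<lambda>(r, s). r \<oplus> t \<otimes> s"
  have inc: "r = r' \<and> s = s'" if a: "r \<in> Q" "s \<in> T" "r' \<in> Q" "s' \<in> T"
    and d: "(r \<oplus> t \<otimes> s) \<ominus> (r' \<oplus> t \<otimes> s') \<in> val_ge P (int (Suc e))" for r s r' s'
  proof -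
    have V: "r \<in> V" "s \<in> V" "r' \<in> V" "s' \<in> V" using a T Q by auto
    then have c: "r \<in> carrier R" "s \<in> carrier R" "r' \<in> carrier R" "s' \<in> carrier R" by auto
    have "(r \<oplus> t \<otimes> s) \<ominus> (r' \<oplus> t \<otimes> s') \<in> P" using val_ge_mono[OF d, of 1] val_ge_1 by auto
    moreover have "t \<otimes> (s' \<ominus> s) \<in> P" using tP V by auto
    ultimately have "((r \<oplus> t \<otimes> s) \<ominus> (r' \<oplus> t \<otimes> s')) \<oplus> t \<otimes> (s' \<ominus> s) \<in> P" by auto
    also have "((r \<oplus> t \<otimes> s) \<ominus> (r' \<oplus> t \<otimes> s')) \<oplus> t \<otimes> (s' \<ominus> s) = r \<ominus> r'" using c tP(4) by algebra
    finally have rr: "r = r'" using Q(4) a by blast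
    have "(r \<oplus> t \<otimes> s) \<ominus> (r' \<oplus> t \<otimes> s') = t \<otimes> (s \<ominus> s')" unfolding rr using c tP(4) by algebra
    then have d': "t \<otimes> (s \<ominus> s') \<in> val_ge P (int (Suc e))" using d by simp
    have "s \<ominus> s' \<in> val_ge P (int e)"
    proof (cases "s \<ominus> s' = \<zero>")
      case False
      then have "t \<otimes> (s \<ominus> s') \<noteq> \<zero>" using integral[of t "s \<ominus> s'"] tP c by auto
      then show ?thesis using d' v_mult[of t "s \<ominus> s'"] v_uniformizer[OF t] tP V False by (auto simp: val_ge_def)
    qed auto
    then show ?thesis using T(4) a rr by blast
  qed
  have inj: "inj_on ?f (Q \<times> T)"
  proof (rule inj_onI, clarify)
    fix r s r' s' assume a: "r \<in> Q" "s \<in> T" "r' \<in> Q" "s' \<in> T" "r \<oplus> t \<otimes> s = r' \<oplus> t \<otimes> s'"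
    have "r' \<oplus> t \<otimes> s' \<in> carrier R" using a T(1) Q(1) tP by blast
    then have "(r \<oplus> t \<otimes> s) \<ominus> (r' \<oplus> t \<otimes> s') = \<zero>" unfolding a(5) by simp
    then show "r = r' \<and> s = s'" using inc[OF a(1-4)] by simp
  qed
  have "card (?f ` (Q \<times> T)) = (card k ^ pdeg) ^ Suc e"
    using card_image[OF inj] T(3) Q(3) by (simp add: card_cartesian_product)
  moreover have "?f ` (Q \<times> T) \<subseteq> V" using T(1) Q(1) tP(1) by auto
  moreover have "finite (?f ` (Q \<times> T))" using T Q by auto
  moreover have "\<forall>x\<in>?f ` (Q \<times> T). \<forall>y\<in>?f ` (Q \<times> T). x \<ominus> y \<in> val_ge P (int (Suc e)) \<longrightarrow> x = y"
    using inc by fastforce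
  ultimately show ?case by blast
qed

end

context finite_function_field
begin

abbreviation "pd \<equiv> place_degree k K"

text \<open>Chinese remaindering by weak approximation produces q^(sum of e_P deg P) elements that
  are incongruent modulo z in the ring of functions regular on \<open>S\<close>; there are at most
  q^[K:k(z)] such classes.\<close>

lemma sum_zeros_le:
  assumes z: "z \<in> K" "z \<notin> k" and S: "finite S" "S \<subseteq> {P \<in> places k K. z \<in> P}"
  shows "(\<Sum>P\<in>S. nat (place_val K P z) * pd P) \<le> ext_degree z"
proof (cases "S = {}")
  case False
  have SP: "\<And>P. P \<in> S \<Longrightarrow> place R k K P" using placeI S by auto
  have z0: "z \<noteq> \<zero>" using z by auto
  define e where "e P = nat (place_val K P z)" for P
  have e: "int (e P) = place_val K P z" if "P \<in> S" for P
    using place.v_pos_iff[OF SP[OF that] z(1) z0] S that by (auto simp: e_def)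
  have "\<exists>T. \<forall>P\<in>S. T P \<subseteq> place_ring K P \<and> finite (T P) \<and> card (T P) = (card k ^ pd P) ^ e P \<and>
      (\<forall>s\<in>T P. \<forall>t\<in>T P. s \<ominus> t \<in> val_ge P (int (e P)) \<longrightarrow> s = t)"
    by (rule bchoice) (rule ballI, rule place.exists_incongruent_system[OF SP])
  then obtain T where T0: "\<forall>P\<in>S. T P \<subseteq> place_ring K P \<and> finite (T P) \<and> card (T P) = (card k ^ pd P) ^ e P \<and>
      (\<forall>s\<in>T P. \<forall>t\<in>T P. s \<ominus> t \<in> val_ge P (int (e P)) \<longrightarrow> s = t)" ..
  note T = bspec[OF T0]
  \<comment> \<open>A single precision that is at least every exponent e(P), as weak approximation
    uses the same exponent at all places.\<close>
  define M where "M = (\<Sum>P\<in>S. int (e P))"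
  have M: "int (e P) \<le> M" "0 \<le> M" if "P \<in> S" for P
    using member_le_sum[OF that, of "\<lambda>P. int (e P)"] S(1) by (auto simp: M_def intro: sum_nonneg)
  define B where "B = K \<inter> (\<Inter>P\<in>S. place_ring K P)"
  have VB: "x \<in> B \<longleftrightarrow> x \<in> K \<and> (\<forall>P\<in>S. x \<in> place_ring K P)" for x by (auto simp: B_def)
  note Vr = place.V_closed[OF SP]
  have B: "subring B R"
    by (rule subringI) (auto simp: VB intro: Vr)
  have kB: "k \<subseteq> B" using place.k_V[OF SP] by (auto simp: VB)
  have zB: "z \<in> B" using z S place.P_V[OF SP] by (auto simp: VB)
  have ex: "\<exists>x\<in>K. \<forall>P\<in>S. x \<ominus> f P \<in> val_ge P M" if f: "f \<in> PiE S T" for f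
    by (rule weak_approximation[OF S(1)]) (use S f T place.V_K[OF SP] in \<open>auto simp: PiE_iff\<close>, blast)
  then obtain h where h: "\<And>f. f \<in> PiE S T \<Longrightarrow> h f \<in> K \<and> (\<forall>P\<in>S. h f \<ominus> f P \<in> val_ge P M)" by metis
  have fV: "f P \<in> place_ring K P" if "f \<in> PiE S T" "P \<in> S" for f P
    using PiE_mem[OF that] T[OF that(2)] by blast
  have hB: "h f \<in> B" if f: "f \<in> PiE S T" for f
    unfolding VB
  proof (intro conjI ballI)
    show "h f \<in> K" using h[OF f] by blast
    fix P assume P: "P \<in> S"
    interpret P: place R k K P using SP[OF P] .
    have hK: "h f \<in> K" using h[OF f] by blast
    have "h f \<ominus> f P \<in> P.V" using h[OF f] P val_ge_mono[OF _ M(2)[OF P]] P.val_ge_0 by blast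
    then have "(h f \<ominus> f P) \<oplus> f P \<in> P.V" using fV[OF f P] by auto
    then show "h f \<in> P.V" using hK fV[OF f P] by (simp add: a_minus_def a_assoc l_neg)
  qed
  have sep: "f = g" if f: "f \<in> PiE S T" and g: "g \<in> PiE S T" and d: "h f \<ominus> h g \<in> (\<otimes>) z ` B" for f g
  proof (rule PiE_ext[OF f g])
    fix P assume P: "P \<in> S"
    interpret P: place R k K P using SP[OF P] .
    obtain b where b: "b \<in> B" "h f \<ominus> h g = z \<otimes> b" using d by auto
    have bV: "b \<in> val_ge P 0" using b P P.val_ge_0 by (auto simp: VB)
    have "z \<in> val_ge P (int (e P))" using e[OF P] z by (simp add: val_ge_def)
    then have 1: "h f \<ominus> h g \<in> val_ge P (int (e P))" using P.val_ge_mult[OF _ bV] b(2) by fastforce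
    have 2: "h f \<ominus> f P \<in> val_ge P (int (e P))" "h g \<ominus> g P \<in> val_ge P (int (e P))"
      using h[OF f] h[OF g] P val_ge_mono[OF _ M(1)[OF P]] by auto
    have c: "h f \<in> carrier R" "h g \<in> carrier R" "f P \<in> carrier R" "g P \<in> carrier R"
      using h[OF f] h[OF g] fV[OF f P] fV[OF g P] by auto
    have "f P \<ominus> g P = (h f \<ominus> h g) \<ominus> (h f \<ominus> f P) \<oplus> (h g \<ominus> g P)" using c by algebra
    then have "f P \<ominus> g P \<in> val_ge P (int (e P))"
      using P.val_ge_add[OF P.val_ge_diff[OF 1 2(1)] 2(2)] by simp
    then show "f P = g P" using T[OF P] PiE_mem[OF f P] PiE_mem[OF g P] by blast
  qed
  have inj: "inj_on h (PiE S T)"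
  proof (rule inj_onI)
    fix f g assume fg: "f \<in> PiE S T" "g \<in> PiE S T" "h f = h g"
    have "h g \<in> K" using h[OF fg(2)] by blast
    then have "h f \<ominus> h g = z \<otimes> \<zero>" unfolding fg(3) using z by simp
    moreover have "\<zero> \<in> B" using subringE(2)[OF B] .
    ultimately show "f = g" using sep[OF fg(1,2)] by blast
  qed
  have "s = t" if st: "s \<in> h ` PiE S T" "t \<in> h ` PiE S T" "s \<ominus> t \<in> (\<otimes>) z ` B" for s t
  proof -
    obtain f g where "f \<in> PiE S T" "g \<in> PiE S T" "s = h f" "t = h g" using st(1,2) by blast
    then show ?thesis using sep[of f g] st(3) by blast
  qed
  moreover have "h ` PiE S T \<subseteq> B" "B \<subseteq> K" using hB VB by blast+
  ultimately have "card (h ` PiE S T) \<le> card k ^ ext_degree z"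
    using card_incongruent_le[OF z B kB zB] by blast
  then have "card (PiE S T) \<le> card k ^ ext_degree z" using card_image[OF inj] by simp
  moreover have "card (PiE S T) = (\<Prod>P\<in>S. card k ^ (pd P * e P))"
    using card_PiE[OF S(1), of T] T by (simp add: power_mult)
  moreover have "\<dots> = card k ^ (\<Sum>P\<in>S. pd P * e P)" using power_sum[of "card k"] by metis
  ultimately have "(\<Sum>P\<in>S. pd P * e P) \<le> ext_degree z"
    using card_k power_increasing_iff[of "card k"] by simp
  then show ?thesis by (simp add: e_def mult.commute)
qed simp

lemma card_zeros_le:
  assumes z: "z \<in> K" "z \<notin> k"
  shows "finite {P \<in> places k K. z \<in> P} \<and> card {P \<in> places k K. z \<in> P} \<le> ext_degree z"
proof -
  have z0: "z \<noteq> \<zero>" using z by auto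
  have *: "card S \<le> ext_degree z" if S: "finite S" "S \<subseteq> {P \<in> places k K. z \<in> P}" for S
  proof -
    have "card S = (\<Sum>P\<in>S. 1)" by simp
    also have "\<dots> \<le> (\<Sum>P\<in>S. nat (place_val K P z) * pd P)"
    proof (rule sum_mono)
      fix P assume "P \<in> S"
      then have P: "P \<in> places k K" "z \<in> P" using S by auto
      interpret P: place R k K P using placeI[OF P(1)] .
      have "nat (P.v z) \<ge> 1" using P.v_pos_iff[OF z(1) z0] P by simp
      then show "1 \<le> nat (P.v z) * pd P" using P.deg_pos by simp
    qed
    finally show ?thesis using sum_zeros_le[OF z S] by simp
  qed
  have "finite {P \<in> places k K. z \<in> P}"
    using infinite_arbitrarily_large[of "{P \<in> places k K. z \<in> P}" "Suc (ext_degree z)"] *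
    by (metis Suc_n_not_le_n)
  then show ?thesis using * by blast
qed

lemma inv_not_k: "z \<in> K \<Longrightarrow> z \<notin> k \<Longrightarrow> inv z \<in> K \<and> inv z \<notin> k \<and> z \<noteq> \<zero> \<and> inv z \<noteq> \<zero> \<and> inv (inv z) = z"
proof -
  assume z: "z \<in> K" "z \<notin> k"
  then have "z \<noteq> \<zero>" by auto
  then show ?thesis using inv_nonzero[of z] z k_closed(7)[of "inv z"] by auto
qed

lemma finite_support:
  assumes "z \<in> K" "z \<noteq> \<zero>"
  shows "finite {P \<in> places k K. place_val K P z \<noteq> 0}"
proof (cases "z \<in> k")
  case True
  then have "{P \<in> places k K. place_val K P z \<noteq> 0} = {}" using place.v_const[OF placeI] assms by auto
  then show ?thesis by (metis finite.emptyI)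
next
  case False
  note i = inv_not_k[OF assms(1) False]
  have "{P \<in> places k K. place_val K P z \<noteq> 0} \<subseteq> {P \<in> places k K. z \<in> P} \<union> {P \<in> places k K. inv z \<in> P}"
  proof
    fix P assume "P \<in> {P \<in> places k K. place_val K P z \<noteq> 0}"
    then have P: "P \<in> places k K" "place_val K P z \<noteq> 0" by auto
    interpret P: place R k K P using placeI[OF P(1)] .
    show "P \<in> {P \<in> places k K. z \<in> P} \<union> {P \<in> places k K. inv z \<in> P}"
      using P P.v_pos_iff[of z] P.v_pos_iff[of "inv z"] P.v_inv[OF assms] assms i by auto
  qed
  then show ?thesis using card_zeros_le[OF assms(1) False] card_zeros_le[of "inv z"] i finite_subset by blast
qed

lemma exists_nonconstant: "\<exists>z\<in>K. z \<notin> k"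
proof -
  obtain x where "x \<in> K" "(transcendental over k) x" using ff by (auto simp: function_field_def)
  then show ?thesis using algebraic_self[OF subring_k, of x] by (auto simp: over_def)
qed

text \<open>With finitely many places, approximation would give a function vanishing at all of them,
  hence a nonconstant function without poles. The result provides a nonrational place for the first
  step of the tower.\<close>

lemma infinite_places: "infinite (places k K)"
proof
  assume fin: "finite (places k K)"
  have "\<forall>P\<in>places k K. \<exists>a. a \<in> K \<and> a \<noteq> \<zero> \<and> place_val K P a = 1"
    using place.exists_v[OF placeI] by fast
  from bchoice[OF this] obtain a where a0: "\<forall>P\<in>places k K. a P \<in> K \<and> a P \<noteq> \<zero> \<and> place_val K P (a P) = 1" ..
  note a = bspec[OF a0]
  \<comment> \<open>Precision 2 against targets of value 1 makes x vanish everywhere and at the same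
    time keeps it from being zero.\<close>
  have "\<exists>x\<in>K. \<forall>P\<in>places k K. x \<ominus> a P \<in> val_ge P 2"
    by (rule weak_approximation[OF fin subset_refl conjunct1[OF a]])
  then obtain x where x1: "x \<in> K" and x2: "\<forall>P\<in>places k K. x \<ominus> a P \<in> val_ge P 2" by (rule bexE)
  note x = x1 bspec[OF x2]
  have xP: "x \<in> P \<and> x \<noteq> \<zero>" if P: "P \<in> places k K" for P
  proof -
    interpret P: place R k K P using placeI[OF P] .
    have "a P \<in> val_ge P 1" using a[OF P] by (simp add: val_ge_def)
    moreover have "x \<ominus> a P \<in> val_ge P 1" using val_ge_mono[OF x(2)[OF P]] by simp
    ultimately have "(x \<ominus> a P) \<oplus> a P \<in> val_ge P 1" using P.val_ge_add by blast
    then have "x \<in> P" using x(1) a[OF P] P.val_ge_1 by (simp add: a_minus_def a_assoc l_neg)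
    moreover have "x \<noteq> \<zero>"
    proof
      assume "x = \<zero>"
      then have "\<ominus> (a P) \<in> val_ge P 2" using x(2)[OF P] a[OF P] by (simp add: a_minus_def)
      then show False using P.val_ge_uminus[of "\<ominus> (a P)" 2] a[OF P] by (simp add: val_ge_def)
    qed
    ultimately show ?thesis by blast
  qed
  obtain z where z: "z \<in> K" "z \<notin> k" using exists_nonconstant by blast
  obtain P where P: "P \<in> places k K" using exists_zero_place[OF z] by blast
  have xk: "x \<notin> k" using place.k_inter_P[OF placeI[OF P]] xP[OF P] by blast
  obtain Q where Q: "Q \<in> places k K" "inv x \<in> Q" using exists_zero_place[of "inv x"] inv_not_k[OF x(1) xk] by blast
  interpret Q: place R k K Q using placeI[OF Q(1)] .
  have "x \<otimes> inv x \<in> Q" using Q(2) xP[OF Q(1)] by blast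
  then show False using inv_nonzero[of x] x(1) xP[OF Q(1)] by simp
qed

section \<open>Riemann-Roch spaces\<close>

abbreviation "RR \<equiv> riemann_roch_space k K"
abbreviation "ddeg \<equiv> divisor_degree k K"
abbreviation "ell D \<equiv> int (dim k (RR D))"

lemma mem_RR: "x \<in> RR D \<longleftrightarrow> x \<in> K \<and> (\<forall>P\<in>places k K. x \<in> val_ge P (- D P))"
  by (auto simp: riemann_roch_space_def val_ge_def)

lemma RR_mono: "(\<And>P. P \<in> places k K \<Longrightarrow> D P \<le> D' P) \<Longrightarrow> RR D \<subseteq> RR D'"
  unfolding subset_iff mem_RR by (metis val_ge_mono neg_le_iff_le)

lemma RR_closed:
  "x \<in> RR D \<Longrightarrow> y \<in> RR D \<Longrightarrow> x \<oplus> y \<in> RR D" "x \<in> RR D \<Longrightarrow> \<ominus> x \<in> RR D"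
  "x \<in> RR D \<Longrightarrow> y \<in> RR D \<Longrightarrow> x \<ominus> y \<in> RR D" "\<zero> \<in> RR D" "c \<in> k \<Longrightarrow> x \<in> RR D \<Longrightarrow> c \<otimes> x \<in> RR D"
  "x \<in> RR D \<Longrightarrow> x \<in> K"
proof -
  have kP: "c \<in> val_ge P 0" if "c \<in> k" "P \<in> places k K" for c P
    using place.val_ge_0[OF placeI[OF that(2)]] place.k_V[OF placeI[OF that(2)] that(1)] by simp
  show "c \<in> k \<Longrightarrow> x \<in> RR D \<Longrightarrow> c \<otimes> x \<in> RR D"
    using place.val_ge_mult[OF placeI] kP unfolding mem_RR by fastforce
qed (auto simp: mem_RR place.val_ge_add[OF placeI] place.val_ge_uminus[OF placeI] place.val_ge_diff[OF placeI])

lemma RR_subalgebra: "subalgebra k (RR D) R"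
proof (rule subalgebra.intro)
  show "subgroup (RR D) (add_monoid R)"
  proof (rule add.subgroupI)
    show "RR D \<noteq> {}" using RR_closed(4) by blast
  qed (use RR_closed in auto)
  show "subalgebra_axioms k (RR D) R" using RR_closed by (auto simp: subalgebra_axioms_def)
qed

text \<open>A function outside \<open>k\<close> has a pole, namely at a zero of its inverse.\<close>

lemma RR_0: "RR (\<lambda>P. 0) = k"
proof
  show "k \<subseteq> RR (\<lambda>P. 0)" using place.val_ge_0[OF placeI] place.k_V[OF placeI] by (auto simp: mem_RR)
  show "RR (\<lambda>P. 0) \<subseteq> k"
  proof
    fix z assume z: "z \<in> RR (\<lambda>P. 0)"
    show "z \<in> k"
    proof (rule ccontr)
      assume zk: "z \<notin> k"
      have zK: "z \<in> K" using z mem_RR by blast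
      note i = inv_not_k[OF zK zk]
      obtain P where P: "P \<in> places k K" "inv z \<in> P" using exists_zero_place[of "inv z"] i by blast
      interpret P: place R k K P using placeI[OF P(1)] .
      have "P.v (inv z) > 0" using P.v_pos_iff P i by blast
      moreover have "P.v z \<ge> 0" using z P(1) i zK by (simp add: mem_RR val_ge_def)
      ultimately show False using P.v_inv[of z] i zK by simp
    qed
  qed
qed

lemma card_RR: "finite (RR D) \<Longrightarrow> card (RR D) = card k ^ dim k (RR D)"
  using card_dim[OF subfield_k finite_k RR_subalgebra] .

lemma ell_0: "ell (\<lambda>P. 0) = 1"
proof -
  have "card k ^ 1 = card k ^ dim k k" using card_RR[of "\<lambda>P. 0"] finite_k by (simp add: RR_0)
  then show ?thesis using card_k power_inject_exp[of "card k" 1 "dim k k"] by (simp add: RR_0)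
qed

text \<open>Counting substitute for rank-nullity: \<open>H\<close> plays the kernel and
  \<open>Y\<close> contains the image. No additivity of \<open>f\<close> is involved, so
  \<open>f\<close> may be given by chosen representatives.\<close>

lemma card_fibres:
  assumes G: "G \<subseteq> carrier R" and f: "\<And>a. a \<in> G \<Longrightarrow> f a \<in> Y" "\<And>a b. a \<in> G \<Longrightarrow> b \<in> G \<Longrightarrow> f a = f b \<Longrightarrow> a \<ominus> b \<in> H"
    and fin: "finite Y" "finite H"
  shows "finite G \<and> card G \<le> card Y * card H"
proof -
  define r where "r = (\<lambda>c. SOME b. b \<in> G \<and> f b = c)"
  have r: "r (f a) \<in> G \<and> f (r (f a)) = f a" if "a \<in> G" for a
    unfolding r_def by (rule someI_ex) (use that in blast)
  let ?h = "\<lambda>a. (f a, a \<ominus> r (f a))"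
  have im: "?h ` G \<subseteq> Y \<times> H" using f r by auto
  have inj: "inj_on ?h G"
  proof (rule inj_onI)
    fix a b assume ab: "a \<in> G" "b \<in> G" "?h a = ?h b"
    then have e: "a \<ominus> r (f a) = b \<ominus> r (f a)" by auto
    have c: "a \<in> carrier R" "b \<in> carrier R" "r (f a) \<in> carrier R" using ab r[of a] G by auto
    have "a = (a \<ominus> r (f a)) \<oplus> r (f a)" using c by (simp add: a_minus_def a_assoc l_neg)
    also have "\<dots> = b" unfolding e using c by (simp add: a_minus_def a_assoc l_neg)
    finally show "a = b" .
  qed
  have "finite (Y \<times> H)" using fin by simp
  then show ?thesis
    using finite_imageD[OF finite_subset[OF im] inj] card_inj_on_le[OF inj im] by (simp add: card_cartesian_product)
qed

lemma ddeg_sum: "finite S \<Longrightarrow> {P. D P \<noteq> 0} \<subseteq> S \<Longrightarrow> ddeg D = (\<Sum>P\<in>S. D P * int (pd P))"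
  unfolding divisor_degree_def by (rule sum.mono_neutral_left) auto

lemma divisor_add: "divisor k K D \<Longrightarrow> divisor k K E \<Longrightarrow> divisor k K (\<lambda>P. D P + E P) \<and> ddeg (\<lambda>P. D P + E P) = ddeg D + ddeg E"
proof -
  assume DE: "divisor k K D" "divisor k K E"
  let ?S = "{P. D P \<noteq> 0} \<union> {P. E P \<noteq> 0}"
  have S: "finite ?S" "?S \<subseteq> places k K" using DE by (auto simp: divisor_def)
  have sub: "{P. D P + E P \<noteq> 0} \<subseteq> ?S" by auto
  have "divisor k K (\<lambda>P. D P + E P)" unfolding divisor_def using S sub finite_subset by blast
  moreover have "ddeg (\<lambda>P. D P + E P) = ddeg D + ddeg E"
    using ddeg_sum[OF S(1) sub] ddeg_sum[OF S(1), of D] ddeg_sum[OF S(1), of E]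
    by (simp add: distrib_right sum.distrib)
  ultimately show ?thesis by blast
qed

lemma divisor_scale: "divisor k K D \<Longrightarrow> divisor k K (\<lambda>P. c * D P) \<and> ddeg (\<lambda>P. c * D P) = c * ddeg D"
proof -
  assume D: "divisor k K D"
  then have S: "finite {P. D P \<noteq> 0}" "{P. D P \<noteq> 0} \<subseteq> places k K" by (auto simp: divisor_def)
  have sub: "{P. c * D P \<noteq> 0} \<subseteq> {P. D P \<noteq> 0}" by auto
  have "divisor k K (\<lambda>P. c * D P)" unfolding divisor_def using S sub finite_subset by blast
  moreover have "ddeg (\<lambda>P. c * D P) = c * ddeg D"
    using ddeg_sum[OF S(1) sub] ddeg_sum[OF S(1), of D] by (simp add: sum_distrib_left mult.assoc)
  ultimately show ?thesis by blast
qed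

lemma divisor_point: "P \<in> places k K \<Longrightarrow> divisor k K (\<lambda>Q. if Q = P then n else 0) \<and> ddeg (\<lambda>Q. if Q = P then n else 0) = n * int (pd P)"
proof -
  assume P: "P \<in> places k K"
  have sub: "{Q. (if Q = P then n else 0) \<noteq> 0} \<subseteq> {P}" by auto
  then have "divisor k K (\<lambda>Q. if Q = P then n else 0)"
    unfolding divisor_def using P finite_subset by blast
  then show ?thesis using ddeg_sum[OF _ sub] by simp
qed

lemma divisor_positive_part: "divisor k K D \<Longrightarrow> divisor k K (\<lambda>P. max 0 (D P))"
  unfolding divisor_def by (auto elim: rev_finite_subset)

text \<open>For t of value D(P) + 1 the residue class of a t is the leading coefficient of a at
  \<open>P\<close>. It determines a up to L(D), so L(D + P) / L(D) has at most as many elements as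
  the residue field.\<close>

lemma RR_add_point:
  assumes P: "P \<in> places k K" and fin: "finite (RR D)"
  shows "finite (RR (D(P := D P + 1))) \<and> ell (D(P := D P + 1)) \<le> ell D + int (pd P)"
proof -
  interpret P: place R k K P using placeI[OF P] .
  let ?D = "D(P := D P + 1)"
  obtain t where t: "t \<in> K" "t \<noteq> \<zero>" "P.v t = D P + 1" using P.exists_v by blast
  obtain T where T: "T \<subseteq> P.V" "finite T" "card T = card k ^ P.pdeg"
    "\<And>s t. s \<in> T \<Longrightarrow> t \<in> T \<Longrightarrow> s \<ominus> t \<in> P \<Longrightarrow> s = t" "\<And>x. x \<in> P.V \<Longrightarrow> \<exists>t\<in>T. x \<ominus> t \<in> P"
    by (rule P.card_residues) (rule that; blast)
  obtain f where f: "\<And>x. x \<in> P.V \<Longrightarrow> f x \<in> T \<and> x \<ominus> f x \<in> P" using T(5) by metis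
  have aV: "a \<otimes> t \<in> P.V" if "a \<in> RR ?D" for a
  proof -
    have "a \<in> val_ge P (- (D P + 1))" using that P unfolding mem_RR by fastforce
    moreover have "t \<in> val_ge P (D P + 1)" using t by (simp add: val_ge_def)
    ultimately show ?thesis using P.val_ge_mult[of a "- (D P + 1)" t "D P + 1"] P.val_ge_0 by simp
  qed
  have step: "a \<ominus> b \<in> RR D" if ab: "a \<in> RR ?D" "b \<in> RR ?D" "f (a \<otimes> t) = f (b \<otimes> t)" for a b
  proof -
    have abR: "a \<ominus> b \<in> RR ?D" using RR_closed(3) ab by blast
    have c: "a \<in> carrier R" "b \<in> carrier R" "t \<in> carrier R" using ab RR_closed(6) t by auto
    have "a \<otimes> t \<ominus> b \<otimes> t \<in> P"
      using P.P_cong_trans[of "a \<otimes> t" "f (a \<otimes> t)" "b \<otimes> t"] f[OF aV[OF ab(1)]] f[OF aV[OF ab(2)]] aV ab T(1) by auto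
    moreover have "a \<otimes> t \<ominus> b \<otimes> t = (a \<ominus> b) \<otimes> t" using c by algebra
    ultimately have p: "(a \<ominus> b) \<otimes> t \<in> P" by simp
    have dK: "a \<ominus> b \<in> K" using abR RR_closed(6) by blast
    have "a \<ominus> b \<in> val_ge P (- D P)"
    proof (cases "a \<ominus> b = \<zero>")
      case False
      then have "P.v ((a \<ominus> b) \<otimes> t) > 0" using p P.v_pos_iff[of "(a \<ominus> b) \<otimes> t"] integral[of "a \<ominus> b" t] dK t by auto
      then show ?thesis using P.v_mult[OF dK False t(1,2)] t(3) dK by (simp add: val_ge_def)
    qed auto
    then show ?thesis using abR unfolding mem_RR by (metis fun_upd_other)
  qed
  have cf: "finite (RR ?D) \<and> card (RR ?D) \<le> card T * card (RR D)"
    by (rule card_fibres[where f = "\<lambda>a. f (a \<otimes> t)"]) (use RR_closed(6) f aV step T(2) fin in auto)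
  then have "card k ^ dim k (RR ?D) \<le> card k ^ (P.pdeg + dim k (RR D))"
    using card_RR[of ?D] card_RR[OF fin] T(3) by (simp add: power_add)
  then have "dim k (RR ?D) \<le> P.pdeg + dim k (RR D)" using card_k power_increasing_iff[of "card k"] by simp
  then show ?thesis using cf by simp
qed

text \<open>One place is added at a time, by induction on the total gap between the divisors. In
  other words deg D - ell D does not decrease when D grows.\<close>

lemma RR_le:
  assumes D: "divisor k K D" "divisor k K D'" and le: "\<And>P. D P \<le> D' P" and fin: "finite (RR D)"
  shows "finite (RR D') \<and> ell D' \<le> ell D + ddeg D' - ddeg D"
  using D(1) le fin
proof (induct "\<Sum>P | D P \<noteq> D' P. nat (D' P - D P)" arbitrary: D rule: less_induct)
  case less
  have "{P. D P \<noteq> D' P} \<subseteq> {P. D P \<noteq> 0} \<union> {P. D' P \<noteq> 0}" by auto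
  then have fS: "finite {P. D P \<noteq> D' P}"
    using less(2) D(2) unfolding divisor_def by (meson finite_UnI finite_subset)
  show ?case
  proof (cases "D = D'")
    case True
    then show ?thesis using less(4) by simp
  next
    case False
    then obtain P where P: "D P \<noteq> D' P" by blast
    then have lt: "D P < D' P" using less(3)[of P] by simp
    have Pp: "P \<in> places k K" using P less(2) D(2) unfolding divisor_def by (metis (mono_tags) mem_Collect_eq subsetD)
    let ?E = "D(P := D P + 1)"
    have E: "divisor k K ?E \<and> ddeg ?E = ddeg D + int (pd P)"
    proof -
      have "?E = (\<lambda>Q. D Q + (if Q = P then 1 else 0))" by auto
      then show ?thesis using divisor_add[OF less(2), of "\<lambda>Q. if Q = P then 1 else 0"] divisor_point[OF Pp, of 1] by simp
    qed
    have leE: "?E Q \<le> D' Q" for Q using less(3)[of Q] lt by simp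
    have "(\<Sum>Q | ?E Q \<noteq> D' Q. nat (D' Q - ?E Q)) = (\<Sum>Q | D Q \<noteq> D' Q. nat (D' Q - ?E Q))"
      by (rule sum.mono_neutral_left[OF fS]) (use lt in auto)
    also have "\<dots> < (\<Sum>Q | D Q \<noteq> D' Q. nat (D' Q - D Q))"
      by (rule sum_strict_mono_ex1[OF fS]) (use lt in auto)
    finally have m: "(\<Sum>Q | ?E Q \<noteq> D' Q. nat (D' Q - ?E Q)) < (\<Sum>Q | D Q \<noteq> D' Q. nat (D' Q - D Q))" .
    note ap = RR_add_point[OF Pp less(4)]
    have "finite (RR D') \<and> ell D' \<le> ell ?E + ddeg D' - ddeg ?E"
      using less(1)[OF m _ leE] E ap by blast
    then show ?thesis using E ap by linarith
  qed
qed

lemma divisor_0: "divisor k K (\<lambda>P. 0)" "ddeg (\<lambda>P. 0) = 0"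
  by (auto simp: divisor_def divisor_degree_def)

lemma RR_effective:
  assumes "divisor k K D" "\<And>P. 0 \<le> D P"
  shows "finite (RR D) \<and> ell D \<le> ddeg D + 1"
  using RR_le[OF divisor_0(1) assms] ell_0 divisor_0(2) finite_k by (simp add: RR_0)

lemma finite_RR: "divisor k K D \<Longrightarrow> finite (RR D)"
  using RR_effective[OF divisor_positive_part[of D]] RR_mono[of D "\<lambda>P. max 0 (D P)"] finite_subset by auto

section \<open>The degree of a principal divisor\<close>

text \<open>The polar part of the divisor of \<open>w\<close>. The value 0 off the places is what
  \<open>divisor\<close> requires of a support.\<close>

definition pole_divisor :: "'a \<Rightarrow> 'a set \<Rightarrow> int" where
  "pole_divisor w P = (if P \<in> places k K then max 0 (- place_val K P w) else 0)"

lemma divisor_pole: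
  assumes "w \<in> K" "w \<noteq> \<zero>"
  shows "divisor k K (pole_divisor w)"
proof -
  have "{P. pole_divisor w P \<noteq> 0} \<subseteq> {P \<in> places k K. place_val K P w \<noteq> 0}" by (auto simp: pole_divisor_def)
  then show ?thesis using finite_support[OF assms] finite_subset unfolding divisor_def by blast
qed

lemma ddeg_pole_le:
  assumes "w \<in> K" "w \<notin> k"
  shows "ddeg (pole_divisor w) \<le> int (ext_degree (inv w))"
proof -
  note i = inv_not_k[OF assms]
  let ?S = "{P \<in> places k K. inv w \<in> P}"
  have v: "place_val K P (inv w) = - place_val K P w \<and> (inv w \<in> P \<longleftrightarrow> - place_val K P w > 0)" if "P \<in> places k K" for P
    using place.v_inv[OF placeI[OF that], of w] place.v_pos_iff[OF placeI[OF that], of "inv w"] assms i by auto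
  have fin: "finite ?S" using card_zeros_le[of "inv w"] i by blast
  have "ddeg (pole_divisor w) = (\<Sum>P\<in>?S. pole_divisor w P * int (pd P))"
    by (rule ddeg_sum[OF fin]) (use v in \<open>auto simp: pole_divisor_def split: if_splits\<close>)
  also have "\<dots> = (\<Sum>P\<in>?S. int (nat (place_val K P (inv w)) * pd P))"
    by (rule sum.cong) (use v in \<open>auto simp: pole_divisor_def\<close>)
  also have "\<dots> \<le> int (ext_degree (inv w))"
    using sum_zeros_le[of "inv w", OF _ _ fin subset_refl] i unfolding of_nat_sum[symmetric] of_nat_le_iff by blast
  finally show ?thesis .
qed

lemma card_polys:
  assumes w: "w \<in> K" "w \<notin> k"
  shows "finite (polys k w d) \<and> card (polys k w d) = card k ^ Suc d"
proof (induct d)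
  case 0
  then show ?case using finite_k by simp
next
  case (Suc d)
  have wc: "w \<in> carrier R" "w \<noteq> \<zero>" using w by auto
  let ?f = "\<lambda>(a, g). a \<oplus> w \<otimes> g"
  have e: "polys k w (Suc d) = ?f ` (k \<times> polys k w d)" by (auto simp: image_iff)
  have inj: "inj_on ?f (k \<times> polys k w d)"
  proof (rule inj_onI, clarify)
    fix a g b h assume a: "a \<in> k" "g \<in> polys k w d" "b \<in> k" "h \<in> polys k w d" "a \<oplus> w \<otimes> g = b \<oplus> w \<otimes> h"
    have c: "a \<in> carrier R" "b \<in> carrier R" "g \<in> carrier R" "h \<in> carrier R"
      using a polys_carrier[OF subring_k wc(1)] by auto
    have "(a \<ominus> b) \<oplus> w \<otimes> (g \<oplus> \<ominus> h) = (a \<oplus> w \<otimes> g) \<ominus> (b \<oplus> w \<otimes> h)" using c wc(1) by algebra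
    also have "\<dots> = \<zero>" unfolding a(5) using c wc(1) by simp
    finally have z: "(a \<ominus> b) \<oplus> w \<otimes> (g \<oplus> \<ominus> h) = \<zero>" .
    have "g \<oplus> \<ominus> h \<in> polys k w d" using add_polys[OF subring_k wc(1)] uminus_polys[OF subring_k wc(1)] a by blast
    then have "a \<ominus> b = \<zero>"
      using transcendental_polysD[OF subring_k wc(1) transcendental_k[OF w] _ _ z] a by blast
    then have ab: "a = b" using c by simp
    then have "w \<otimes> g = w \<otimes> h" using a(5) c wc by simp
    then show "a = b \<and> g = h" using ab m_lcancel[of w g h] wc c by simp
  qed
  show ?case unfolding e using card_image[OF inj] Suc finite_k by (simp add: card_cartesian_product)
qed

lemma polys_val_ge:
  assumes P: "P \<in> places k K" and w: "w \<in> K" and B: "B \<ge> 0" "w \<in> val_ge P (- B)"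
  shows "g \<in> polys k w d \<Longrightarrow> g \<in> val_ge P (- (int d * B))"
proof (induct d arbitrary: g)
  case 0
  then show ?case using place.val_ge_0[OF placeI[OF P]] place.k_V[OF placeI[OF P]] by simp
next
  case (Suc d)
  interpret P: place R k K P using placeI[OF P] .
  obtain a h where ah: "a \<in> k" "h \<in> polys k w d" "g = a \<oplus> w \<otimes> h" using Suc(2) by auto
  have "w \<otimes> h \<in> val_ge P (- (int (Suc d) * B))"
    using P.val_ge_mult[OF B(2) Suc(1)[OF ah(2)]] by (simp add: algebra_simps)
  moreover have "a \<in> val_ge P (- (int (Suc d) * B))"
    using val_ge_mono[of a P 0] P.val_ge_0 P.k_V[OF ah(1)] B(1) by simp
  ultimately show ?case unfolding ah(3) using P.val_ge_add by blast
qed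

lemma exists_bounding_divisor:
  "set Us \<subseteq> K \<Longrightarrow> \<exists>C. divisor k K C \<and> (\<forall>P. 0 \<le> C P) \<and> set Us \<subseteq> RR C"
proof (induct Us)
  case Nil
  then show ?case using divisor_0 by auto
next
  case (Cons u Us)
  then obtain C where C: "divisor k K C" "\<And>P. 0 \<le> C P" "set Us \<subseteq> RR C" by auto
  have u: "u \<in> K" using Cons by simp
  show ?case
  proof (cases "u = \<zero>")
    case True
    then show ?thesis using C RR_closed(4) by auto
  next
    case False
    let ?C = "\<lambda>P. C P + pole_divisor u P"
    have p: "0 \<le> pole_divisor u P" for P by (simp add: pole_divisor_def)
    have "u \<in> RR ?C" unfolding mem_RR val_ge_def using u C(2) by (auto simp: pole_divisor_def) (smt (verit))
    moreover have "RR C \<subseteq> RR ?C" using p by (intro RR_mono) simp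
    moreover have "divisor k K ?C" using divisor_add[OF C(1) divisor_pole[OF u False]] by blast
    moreover have "0 \<le> ?C P" for P using C(2)[of P] p[of P] by linarith
    ultimately show ?thesis using C(3) by (intro exI[of _ ?C]) auto
  qed
qed

text \<open>Combinations of a basis of \<open>K\<close> over k(w), with coefficients of degree at
  most r in w, have poles bounded by r times the poles of w plus a divisor C that depends on the
  basis only. Independence makes them distinct.\<close>

lemma RR_lower_bound:
  assumes w: "w \<in> K" "w \<notin> k"
  shows "\<exists>C. divisor k K C \<and> (\<forall>P. 0 \<le> C P) \<and>
    (\<forall>r. int (ext_degree w) * (int r + 1) \<le> ell (\<lambda>P. int r * pole_divisor w P + C P))"
proof -
  have wc: "w \<in> carrier R" "w \<noteq> \<zero>" using w by auto
  obtain Us where Us: "set Us \<subseteq> K" "polys_independent k w Us" "length Us = ext_degree w"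
    using ext_degree_attained[OF w] by blast
  have Uc: "set Us \<subseteq> carrier R" using Us(1) by auto
  obtain C where C: "divisor k K C" "\<And>P. 0 \<le> C P" "set Us \<subseteq> RR C" using exists_bounding_divisor[OF Us(1)] by blast
  have "int (ext_degree w) * (int r + 1) \<le> ell (\<lambda>P. int r * pole_divisor w P + C P)" for r
  proof -
    let ?D = "\<lambda>P. int r * pole_divisor w P + C P"
    let ?A = "{Ks. set Ks \<subseteq> polys k w r \<and> length Ks = ext_degree w}"
    have D: "divisor k K ?D" using divisor_add[of "\<lambda>P. int r * pole_divisor w P" C] divisor_scale[OF divisor_pole[OF w(1) wc(2)]] C(1) by blast
    have im: "combine Ks Us \<in> RR ?D" if Ks: "Ks \<in> ?A" for Ks
    proof (rule combine_closed)
      fix g u assume gu: "g \<in> set Ks" "u \<in> set Us"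
      have g: "g \<in> polys k w r" using gu Ks by auto
      then have gK: "g \<in> K" using polys_K[OF w(1)] by blast
      have uR: "u \<in> RR C" using gu C(3) by blast
      show "g \<otimes> u \<in> RR ?D" unfolding mem_RR
      proof (intro conjI ballI)
        show "g \<otimes> u \<in> K" using gK RR_closed(6)[OF uR] by simp
        fix P assume P: "P \<in> places k K"
        have "g \<in> val_ge P (- (int r * pole_divisor w P))"
          by (rule polys_val_ge[OF P w(1) _ _ g]) (use P w in \<open>auto simp: pole_divisor_def val_ge_def\<close>)
        moreover have "u \<in> val_ge P (- C P)" using uR P by (simp add: mem_RR)
        ultimately show "g \<otimes> u \<in> val_ge P (- (int r * pole_divisor w P + C P))"
          using place.val_ge_mult[OF placeI[OF P]] by fastforce
      qed
    qed (use RR_closed in auto)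
    have inj: "inj_on (\<lambda>Ks. combine Ks Us) ?A"
    proof (rule inj_onI)
      fix Ks Ls assume KL: "Ks \<in> ?A" "Ls \<in> ?A" "combine Ks Us = combine Ls Us"
      have kc: "set Ks \<subseteq> carrier R" "set Ls \<subseteq> carrier R" using KL polys_carrier[OF subring_k wc(1)] by auto
      let ?Ns = "map ((\<otimes>) (\<ominus> \<one>)) Ls"
      \<comment> \<open>Independence is stated for a vanishing combination, so two coefficient lists
        are compared through their difference.\<close>
      let ?Ms = "map2 (\<oplus>) Ks ?Ns"
      have nc: "set ?Ns \<subseteq> carrier R" using kc by auto
      have "combine ?Ms Us = combine Ks Us \<oplus> combine ?Ns Us"
        using combine_add[of Ks Us ?Ns] kc nc KL Us(3) Uc by simp
      also have "combine ?Ns Us = \<ominus> \<one> \<otimes> combine Ls Us" using combine_r_distr[OF kc(2) Uc, of "\<ominus> \<one>"] by simp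
      also have "combine Ks Us \<oplus> \<ominus> \<one> \<otimes> combine Ls Us = \<zero>"
        unfolding KL(3) using combine_in_carrier[OF kc(2) Uc] by (simp add: l_minus r_neg)
      finally have z: "combine ?Ms Us = \<zero>" .
      have "set ?Ms \<subseteq> polys k w r"
      proof
        fix m assume "m \<in> set ?Ms"
        then have "\<exists>i<length ?Ms. ?Ms ! i = m" by (simp only: in_set_conv_nth)
        then obtain i where i: "i < length ?Ms" "m = ?Ms ! i" by blast
        then have il: "i < length Ks" "i < length Ls" by auto
        then have m: "m = Ks ! i \<oplus> \<ominus> \<one> \<otimes> Ls ! i" using i by simp
        have a: "Ks ! i \<in> polys k w r" and b: "Ls ! i \<in> polys k w r" using KL nth_mem[OF il(1)] nth_mem[OF il(2)] by blast+
        show "m \<in> polys k w r" unfolding m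
          by (intro add_polys[OF subring_k wc(1) a] smult_polys[OF subring_k wc(1) _ b]) simp
      qed
      moreover have "length ?Ms = length Us" using KL Us(3) by simp
      ultimately have sz: "set ?Ms \<subseteq> {\<zero>}" using Us(2)[unfolded polys_independent_def, rule_format] z by blast
      show "Ks = Ls"
      proof (rule nth_equalityI)
        show "length Ks = length Ls" using KL by simp
        fix i assume i: "i < length Ks"
        then have "?Ms ! i \<in> set ?Ms" using KL by (intro nth_mem) simp
        then have "Ks ! i \<oplus> \<ominus> \<one> \<otimes> Ls ! i = \<zero>" using sz i KL by auto
        moreover have "Ks ! i \<in> carrier R" "Ls ! i \<in> carrier R" using kc i KL nth_mem by (metis (mono_tags) mem_Collect_eq subsetD)+
        ultimately have "Ks ! i \<ominus> Ls ! i = \<zero>" by (simp add: l_minus a_minus_def)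
        then show "Ks ! i = Ls ! i" using \<open>Ks ! i \<in> carrier R\<close> \<open>Ls ! i \<in> carrier R\<close> by simp
      qed
    qed
    have "card ?A = (card k ^ Suc r) ^ ext_degree w"
      using card_lists_length_eq[of "polys k w r" "ext_degree w"] card_polys[OF w, of r] by simp
    moreover have "card ?A \<le> card (RR ?D)"
      by (rule card_inj_on_le[OF inj _ finite_RR[OF D]]) (use im in blast)
    ultimately have "card k ^ (Suc r * ext_degree w) \<le> card k ^ dim k (RR ?D)"
      using card_RR[OF finite_RR[OF D]] by (simp only: power_mult)
    then have "Suc r * ext_degree w \<le> dim k (RR ?D)" using card_k power_increasing_iff[of "card k"] by simp
    then have "int (Suc r * ext_degree w) \<le> ell ?D" by (simp only: of_nat_le_iff)
    then show ?thesis by (simp add: algebra_simps)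
  qed
  then show ?thesis using C by blast
qed

text \<open>Growth in r is compared: \<open>ell\<close> is at least n (r + 1) by the lower bound and
  at most r deg + deg C + 1 for an effective divisor, so the slope deg cannot be below n.\<close>

lemma ext_degree_le_pole:
  assumes w: "w \<in> K" "w \<notin> k"
  shows "int (ext_degree w) \<le> ddeg (pole_divisor w)"
proof (rule ccontr)
  assume neg: "\<not> ?thesis"
  have wc: "w \<noteq> \<zero>" using w by auto
  obtain C where C: "divisor k K C" "\<And>P. 0 \<le> C P"
    "\<And>r. int (ext_degree w) * (int r + 1) \<le> ell (\<lambda>P. int r * pole_divisor w P + C P)"
    using RR_lower_bound[OF w] by blast
  \<comment> \<open>With slope at most n - 1 the two bounds would give r + n <= deg C + 1, which
    fails for this r because n is at least 1.\<close>
  define r where "r = nat (ddeg C + 1)"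
  let ?D = "\<lambda>P. int r * pole_divisor w P + C P"
  have s: "divisor k K (\<lambda>P. int r * pole_divisor w P)" "ddeg (\<lambda>P. int r * pole_divisor w P) = int r * ddeg (pole_divisor w)"
    using divisor_scale[OF divisor_pole[OF w(1) wc]] by auto
  have D: "divisor k K ?D" "ddeg ?D = int r * ddeg (pole_divisor w) + ddeg C"
    using divisor_add[OF s(1) C(1)] s(2) by auto
  have "ell ?D \<le> ddeg ?D + 1" using RR_effective[OF D(1)] C(2) by (simp add: pole_divisor_def)
  then have 1: "int (ext_degree w) * (int r + 1) \<le> int r * ddeg (pole_divisor w) + ddeg C + 1"
    using C(3)[of r] D(2) by linarith
  have 2: "int r * ddeg (pole_divisor w) \<le> int r * (int (ext_degree w) - 1)"
    using neg by (intro mult_left_mono) auto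
  have "int r \<ge> ddeg C + 1" by (simp add: r_def)
  moreover have "int (ext_degree w) * (int r + 1) = int r * (int (ext_degree w) - 1) + int r + int (ext_degree w)"
    by (simp add: algebra_simps)
  moreover have "0 \<le> ddeg C" unfolding divisor_degree_def using C(2) by (intro sum_nonneg) simp
  moreover have "int (ext_degree w) \<ge> 1"
  proof -
    have "0 \<le> ddeg (pole_divisor w)" unfolding divisor_degree_def by (intro sum_nonneg) (simp add: pole_divisor_def)
    then show ?thesis using neg by linarith
  qed
  ultimately show False using 1 2 by linarith
qed

text \<open>The inequalities [K:k(w)] <= poles of w <= [K:k(1/w)] <= poles of 1/w <= [K:k(w)] form a
  cycle, so equality holds throughout. That principal divisors have degree 0 follows.\<close>

lemma ddeg_pole:
  assumes w: "w \<in> K" "w \<notin> k"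
  shows "ddeg (pole_divisor w) = int (ext_degree w)" and "ddeg (pole_divisor (inv w)) = int (ext_degree w)"
proof -
  note i = inv_not_k[OF w]
  have "int (ext_degree w) \<le> ddeg (pole_divisor w)" "ddeg (pole_divisor w) \<le> int (ext_degree (inv w))"
    "int (ext_degree (inv w)) \<le> ddeg (pole_divisor (inv w))" "ddeg (pole_divisor (inv w)) \<le> int (ext_degree w)"
    using ext_degree_le_pole[OF w] ddeg_pole_le[OF w] ext_degree_le_pole[of "inv w"] ddeg_pole_le[of "inv w"] i by auto
  then show "ddeg (pole_divisor w) = int (ext_degree w)" "ddeg (pole_divisor (inv w)) = int (ext_degree w)" by linarith+
qed

definition principal_divisor :: "'a \<Rightarrow> 'a set \<Rightarrow> int" where
  "principal_divisor f P = (if P \<in> places k K then place_val K P f else 0)"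

lemma principal_divisor:
  assumes f: "f \<in> K" "f \<noteq> \<zero>"
  shows "divisor k K (principal_divisor f) \<and> ddeg (principal_divisor f) = 0"
proof (cases "f \<in> k")
  case True
  then have "principal_divisor f = (\<lambda>P. 0)" using place.v_const[OF placeI] f by (auto simp: principal_divisor_def)
  then show ?thesis using divisor_0 by simp
next
  case False
  note i = inv_not_k[OF f(1) False]
  have e: "principal_divisor f = (\<lambda>P. pole_divisor (inv f) P + (-1) * pole_divisor f P)"
    using place.v_inv[OF placeI f] by (intro ext) (auto simp: principal_divisor_def pole_divisor_def)
  have d: "divisor k K (pole_divisor (inv f))" "divisor k K (\<lambda>P. (-1) * pole_divisor f P)"
    "ddeg (\<lambda>P. (-1) * pole_divisor f P) = - ddeg (pole_divisor f)"
    using divisor_pole[of "inv f"] divisor_scale[OF divisor_pole[OF f], of "-1"] i by auto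
  show ?thesis unfolding e using divisor_add[OF d(1,2)] d(3) ddeg_pole[OF f(1) False] by simp
qed

text \<open>Multiplication by 1/f maps L(D) bijectively onto the space of the shifted
  divisor.\<close>

lemma ell_principal:
  assumes D: "divisor k K D" and f: "f \<in> K" "f \<noteq> \<zero>"
  shows "ell (\<lambda>P. D P + principal_divisor f P) = ell D"
proof -
  let ?E = "\<lambda>P. D P + principal_divisor f P"
  have E: "divisor k K ?E" using divisor_add[OF D] principal_divisor[OF f] by blast
  note jf = inv_nonzero[of f]
  have if': "inv f \<in> K" "inv f \<noteq> \<zero>" "f \<otimes> inv f = \<one>" using jf f by auto
  have "x \<in> RR D \<longleftrightarrow> inv f \<otimes> x \<in> RR ?E" if x: "x \<in> K" for x
  proof (cases "x = \<zero>")
    case True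
    then show ?thesis using RR_closed(4) if' by simp
  next
    case False
    have "inv f \<otimes> x \<noteq> \<zero>" using integral[of "inv f" x] False x if' by auto
    then show ?thesis unfolding mem_RR val_ge_def
      using False x if' place.v_mult[OF placeI if'(1,2) x False] place.v_inv[OF placeI f]
      by (auto simp: principal_divisor_def)
  qed
  moreover have "x \<in> (\<otimes>) (inv f) ` RR D" if x: "x \<in> RR ?E" and *: "\<And>x. x \<in> K \<Longrightarrow> x \<in> RR D \<longleftrightarrow> inv f \<otimes> x \<in> RR ?E" for x
  proof -
    have xK: "x \<in> K" using RR_closed(6)[OF x] .
    have "inv f \<otimes> (f \<otimes> x) = (f \<otimes> inv f) \<otimes> x"
    proof -
      have "inv f \<in> carrier R" "f \<in> carrier R" "x \<in> carrier R" using xK f if' by auto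
      then show ?thesis by algebra
    qed
    then have e: "inv f \<otimes> (f \<otimes> x) = x" using xK if' by simp
    moreover have "f \<otimes> x \<in> RR D" using *[of "f \<otimes> x"] e x xK f by simp
    ultimately show ?thesis by (metis image_eqI)
  qed
  ultimately have "RR ?E = (\<otimes>) (inv f) ` RR D" using RR_closed(6) by blast
  moreover have "inj_on ((\<otimes>) (inv f)) (RR D)"
  proof (rule inj_onI)
    fix a b assume ab: "a \<in> RR D" "b \<in> RR D" "inv f \<otimes> a = inv f \<otimes> b"
    then show "a = b" using m_lcancel[of "inv f" a b] RR_closed(6) if' by auto
  qed
  ultimately have "card (RR ?E) = card (RR D)" using card_image by metis
  then have "card k ^ dim k (RR ?E) = card k ^ dim k (RR D)" using card_RR finite_RR[OF D] finite_RR[OF E] by metis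
  then show ?thesis using card_k power_inject_exp[of "card k"] by simp
qed

section \<open>Riemann's theorem and the number of rational places\<close>

text \<open>The bound is known for multiples of the pole divisor of a fixed w. An arbitrary divisor
  is enlarged to an effective one, which is then moved below such a multiple by a principal divisor;
  deg - \<open>ell\<close> only grows along the way.\<close>

theorem riemann: "\<exists>\<gamma>. \<forall>D. divisor k K D \<longrightarrow> ddeg D - ell D \<le> \<gamma>"
proof -
  obtain w where w: "w \<in> K" "w \<notin> k" using exists_nonconstant by blast
  have w0: "w \<noteq> \<zero>" using w by auto
  define n where "n = int (ext_degree w)"
  define B where "B = pole_divisor w"
  have B: "divisor k K B" "ddeg B = n" "\<And>P. 0 \<le> B P"
    using divisor_pole[OF w(1) w0] ddeg_pole[OF w] by (auto simp: B_def n_def pole_divisor_def)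
  have n1: "n \<ge> 1"
  proof -
    obtain P where P: "P \<in> places k K" "w \<in> P" using exists_zero_place[OF w] by blast
    then have "{P \<in> places k K. w \<in> P} \<noteq> {}" by blast
    then have "card {P \<in> places k K. w \<in> P} \<noteq> 0" using card_zeros_le[OF w] by (metis (mono_tags, lifting) card_0_eq)
    then show ?thesis using card_zeros_le[OF w] unfolding n_def by linarith
  qed
  obtain C where C: "divisor k K C" "\<And>P. 0 \<le> C P" "\<And>r. n * (int r + 1) \<le> ell (\<lambda>P. int r * B P + C P)"
    using RR_lower_bound[OF w] unfolding n_def B_def by blast
  define \<gamma> where "\<gamma> = ddeg C - n"
  have rB: "divisor k K (\<lambda>P. int r * B P)" "ddeg (\<lambda>P. int r * B P) = int r * n" for r
    using divisor_scale[OF B(1), of "int r"] B(2) by auto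
  have low: "int r * n - ell (\<lambda>P. int r * B P) \<le> \<gamma>" for r
  proof -
    have a: "divisor k K (\<lambda>P. int r * B P + C P)" "ddeg (\<lambda>P. int r * B P + C P) = int r * n + ddeg C"
      using divisor_add[OF rB(1) C(1), of r] rB(2)[of r] by auto
    have "ell (\<lambda>P. int r * B P + C P) \<le> ell (\<lambda>P. int r * B P) + ddeg (\<lambda>P. int r * B P + C P) - ddeg (\<lambda>P. int r * B P)"
      using RR_le[OF rB(1) a(1)] C(2) finite_RR[OF rB(1)] by auto
    then show ?thesis using C(3)[of r] a(2) rB(2)[of r] unfolding \<gamma>_def by (simp add: algebra_simps)
  qed
  have "ddeg A - ell A \<le> \<gamma>" if A: "divisor k K A" for A
  proof -
    define A1 where "A1 = (\<lambda>P. max 0 (A P))"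
    have A1: "divisor k K A1" "\<And>P. 0 \<le> A1 P" using divisor_positive_part[OF A] by (auto simp: A1_def)
    have m: "divisor k K (\<lambda>P. (-1) * A1 P)" "ddeg (\<lambda>P. (-1) * A1 P) = - ddeg A1" using divisor_scale[OF A1(1), of "-1"] by auto
    \<comment> \<open>Chosen so that the bound for r B leaves L(r B - A1) with dimension at least
      1.\<close>
    define r where "r = nat (\<gamma> + ddeg A1 + 1)"
    let ?E = "\<lambda>P. int r * B P + (-1) * A1 P"
    have E: "divisor k K ?E" "ddeg ?E = int r * n - ddeg A1" using divisor_add[OF rB(1) m(1), of r] rB(2)[of r] m(2) by auto
    have "ell (\<lambda>P. int r * B P) \<le> ell ?E + ddeg (\<lambda>P. int r * B P) - ddeg ?E"
      using RR_le[OF E(1) rB(1)] A1(2) finite_RR[OF E(1)] by auto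
    then have "int r * n - \<gamma> - ddeg A1 \<le> ell ?E" using low[of r] E(2) rB(2)[of r] by linarith
    moreover have "int r \<le> int r * n" using n1 mult_left_mono[of 1 n "int r"] by simp
    moreover have "int r \<ge> \<gamma> + ddeg A1 + 1" by (simp add: r_def)
    ultimately have "ell ?E \<ge> 1" by linarith
    then have "card (RR ?E) \<ge> card k ^ 1"
      using card_RR[OF finite_RR[OF E(1)]] card_k power_increasing[of 1 "dim k (RR ?E)" "card k"] by simp
    then have "card (RR ?E) > card {\<zero>}" using card_k by simp
    then have "\<not> RR ?E \<subseteq> {\<zero>}" using card_mono[of "{\<zero>}" "RR ?E"] by auto
    then obtain f where f: "f \<in> RR ?E" "f \<noteq> \<zero>" by blast
    have fK: "f \<in> K" using RR_closed(6)[OF f(1)] .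
    note jf = inv_nonzero[of f]
    have i: "inv f \<in> K" "inv f \<noteq> \<zero>" using fK f jf by auto
    \<comment> \<open>This is A1 minus the divisor of f, equivalent to A1; that f lies in L(r B -
      A1) says exactly that it is at most r B.\<close>
    let ?D = "\<lambda>P. A1 P + principal_divisor (inv f) P"
    note pf = principal_divisor[OF i]
    have D: "divisor k K ?D" "ddeg ?D = ddeg A1" using divisor_add[OF A1(1)] pf by auto
    have lD: "ell ?D = ell A1" using ell_principal[OF A1(1) i] .
    have le: "?D P \<le> int r * B P" for P
    proof (cases "P \<in> places k K")
      case True
      then have "f \<in> val_ge P (- (int r * B P + - 1 * A1 P))" using f(1) unfolding mem_RR by blast
      then have "- (int r * B P + - 1 * A1 P) \<le> place_val K P f" using f(2) by (simp add: val_ge_def)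
      then show ?thesis using True place.v_inv[OF placeI[OF True] fK f(2)] by (simp add: principal_divisor_def)
    next
      case False
      then have "A1 P = 0" using A1(1) by (auto simp: divisor_def)
      then show ?thesis using False B(3)[of P] by (simp add: principal_divisor_def)
    qed
    have 1: "ell (\<lambda>P. int r * B P) \<le> ell ?D + ddeg (\<lambda>P. int r * B P) - ddeg ?D"
      using RR_le[OF D(1) rB(1) le finite_RR[OF D(1)]] by blast
    have 2: "ell A1 \<le> ell A + ddeg A1 - ddeg A"
      using RR_le[OF A A1(1) _ finite_RR[OF A]] by (simp add: A1_def)
    show ?thesis using 1 2 lD D(2) low[of r] rB(2)[of r] by linarith
  qed
  then show ?thesis by blast
qed

text \<open>\<open>GREATEST\<close> on integers is meaningful only if the maximum is attained.
  Riemann's bound ensures this: a divisor minimizing the distance to the bound attains it.\<close>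

lemma genus_ge:
  assumes D: "divisor k K D"
  shows "ddeg D - ell D + 1 \<le> genus k K"
proof -
  obtain \<gamma> where \<gamma>: "\<And>D. divisor k K D \<Longrightarrow> ddeg D - ell D \<le> \<gamma>" using riemann by blast
  obtain D0 where D0: "divisor k K D0" "\<And>E. divisor k K E \<Longrightarrow> nat (\<gamma> - (ddeg D0 - ell D0)) \<le> nat (\<gamma> - (ddeg E - ell E))"
    using ex_has_least_nat[of "divisor k K" D "\<lambda>E. nat (\<gamma> - (ddeg E - ell E))"] D by blast
  have max: "ddeg E - ell E + 1 \<le> ddeg D0 - ell D0 + 1" if "divisor k K E" for E
    using D0(2)[OF that] \<gamma>[OF that] \<gamma>[OF D0(1)] by linarith
  have "genus k K = ddeg D0 - ell D0 + 1"
    unfolding genus_def by (rule Greatest_equality) (use D0(1) max in auto)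
  then show ?thesis using max[OF D] by simp
qed

lemma rational_place_bound:
  assumes "P \<in> places k K" "pd P = 1"
  shows "finite {P \<in> places k K. pd P = 1} \<and> int (num_rational_places k K) \<le> 1 + int (card k) * (genus k K + 1)"
proof -
  interpret P: place R k K P using placeI[OF assms(1)] .
  define g where "g = genus k K"
  have g0: "g \<ge> 0" using genus_ge[OF divisor_0(1)] ell_0 divisor_0(2) by (simp add: g_def)
  let ?D = "\<lambda>Q. if Q = P then g + 1 else 0"
  have D: "divisor k K ?D" "ddeg ?D = g + 1" using divisor_point[OF assms(1), of "g + 1"] assms(2) by auto
  \<comment> \<open>The degree is g + 1, so g + 1 - ell + 1 <= g. A dimension of 2 forces a function
    outside \<open>k\<close>.\<close>
  have "ell ?D \<ge> 2" using genus_ge[OF D(1)] D(2) by (simp add: g_def)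
  then have "card (RR ?D) \<ge> card k ^ 2"
    using card_RR[OF finite_RR[OF D(1)]] card_k power_increasing[of 2 "dim k (RR ?D)" "card k"] by simp
  moreover have "card k ^ 2 > card k" using card_k by (simp add: power2_eq_square)
  ultimately have "\<not> RR ?D \<subseteq> k" using card_mono[OF finite_k, of "RR ?D"] by linarith
  then obtain f where f: "f \<in> RR ?D" "f \<notin> k" by blast
  have fK: "f \<in> K" using RR_closed(6)[OF f(1)] .
  let ?Z = "\<lambda>c. {Q \<in> places k K. f \<ominus> c \<in> Q}"
  have Z: "finite (?Z c) \<and> int (card (?Z c)) \<le> g + 1" if c: "c \<in> k" for c
  proof -
    have fcK: "f \<ominus> c \<in> K" using fK c by auto
    have fck: "f \<ominus> c \<notin> k"
    proof
      assume "f \<ominus> c \<in> k"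
      then have "(f \<ominus> c) \<oplus> c \<in> k" using c by blast
      then show False using fK c f(2) by (simp add: a_minus_def a_assoc l_neg)
    qed
    have f0: "f \<ominus> c \<noteq> \<zero>" using fck by auto
    have "RR (\<lambda>P. 0) \<subseteq> RR ?D" by (rule RR_mono) (use g0 in auto)
    then have cD: "c \<in> RR ?D" using RR_0 c by blast
    have fcR: "f \<ominus> c \<in> RR ?D" using RR_closed(3)[OF f(1) cD] .
    have le: "pole_divisor (f \<ominus> c) Q \<le> ?D Q" for Q
    proof (cases "Q \<in> places k K")
      case True
      then have "- ?D Q \<le> place_val K Q (f \<ominus> c)" using fcR f0 unfolding mem_RR val_ge_def by blast
      then show ?thesis using True g0 by (auto simp: pole_divisor_def)
    qed (use g0 in \<open>auto simp: pole_divisor_def\<close>)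
    have "ddeg (pole_divisor (f \<ominus> c)) \<le> ddeg ?D"
    proof -
      let ?S = "{Q. pole_divisor (f \<ominus> c) Q \<noteq> 0} \<union> {P}"
      have S: "finite ?S" using divisor_pole[OF fcK f0] by (simp add: divisor_def)
      have "ddeg (pole_divisor (f \<ominus> c)) = (\<Sum>Q\<in>?S. pole_divisor (f \<ominus> c) Q * int (pd Q))" by (rule ddeg_sum[OF S]) auto
      also have "\<dots> \<le> (\<Sum>Q\<in>?S. ?D Q * int (pd Q))" using le by (intro sum_mono mult_right_mono) auto
      also have "\<dots> = ddeg ?D" by (rule ddeg_sum[OF S, symmetric]) auto
      finally show ?thesis .
    qed
    then have "int (ext_degree (f \<ominus> c)) \<le> g + 1" using ddeg_pole(1)[OF fcK fck] D(2) by simp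
    then show ?thesis using card_zeros_le[OF fcK fck] by linarith
  qed
  let ?N = "{Q \<in> places k K. pd Q = 1}"
  \<comment> \<open>At a rational place other than P the function f is regular and has a value c in
    \<open>k\<close>, so the place is a zero of f - c.\<close>
  have sub: "?N \<subseteq> insert P (\<Union>c\<in>k. ?Z c)"
  proof
    fix Q assume "Q \<in> ?N"
    then have Q: "Q \<in> places k K" "pd Q = 1" by auto
    interpret Q: place R k K Q using placeI[OF Q(1)] .
    show "Q \<in> insert P (\<Union>c\<in>k. ?Z c)"
    proof (cases "Q = P")
      case False
      have "f \<in> val_ge Q (- ?D Q)" using f(1) Q(1) unfolding mem_RR by blast
      then have "f \<in> val_ge Q 0" using False by simp
      then have "f \<in> Q.V" using Q.val_ge_0 by simp
      then show ?thesis using Q.deg_one_iff Q by auto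
    qed simp
  qed
  have fin: "finite (\<Union>c\<in>k. ?Z c)" using Z finite_k by auto
  have "card (\<Union>c\<in>k. ?Z c) \<le> (\<Sum>c\<in>k. card (?Z c))" by (rule card_UN_le[OF finite_k])
  then have "int (card (\<Union>c\<in>k. ?Z c)) \<le> int (\<Sum>c\<in>k. card (?Z c))" by (simp only: of_nat_le_iff)
  also have "\<dots> = (\<Sum>c\<in>k. int (card (?Z c)))" by (rule of_nat_sum)
  also have "\<dots> \<le> (\<Sum>c\<in>k. g + 1)" using Z by (intro sum_mono) auto
  finally have "int (card (\<Union>c\<in>k. ?Z c)) \<le> int (card k) * (g + 1)" by simp
  moreover have "card ?N \<le> card (insert P (\<Union>c\<in>k. ?Z c))" by (rule card_mono) (use sub fin in auto)
  moreover have "card (insert P (\<Union>c\<in>k. ?Z c)) \<le> 1 + card (\<Union>c\<in>k. ?Z c)" using fin by (simp add: card_insert_if)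
  ultimately show ?thesis using finite_subset[OF sub] fin unfolding num_rational_places_def g_def by simp
qed

end

section \<open>Quadratic extensions\<close>

text \<open>The condition \<alpha> \<noteq> a \<ominus> \<alpha> is separability: the second root of
  T^2 - a T + b is a - \<alpha>. This form is uniform in the characteristic.\<close>

locale quadratic_extension = finite_function_field +
  fixes \<alpha> a b
  assumes alpha: "\<alpha> \<in> carrier R" "\<alpha> \<notin> K" "\<alpha> \<noteq> a \<ominus> \<alpha>" and ab: "a \<in> K" "b \<in> K"
    and alpha_sq: "\<alpha> \<otimes> \<alpha> = a \<otimes> \<alpha> \<ominus> b"
begin

definition "\<beta> = a \<ominus> \<alpha>"

definition "K' = {u \<oplus> v \<otimes> \<alpha> | u v. u \<in> K \<and> v \<in> K}"

lemma K'E: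
  assumes "z \<in> K'"
  obtains u v where "u \<in> K" "v \<in> K" "z = u \<oplus> v \<otimes> \<alpha>"
  using assms by (auto simp: K'_def)

lemma K'I: "u \<in> K \<Longrightarrow> v \<in> K \<Longrightarrow> u \<oplus> v \<otimes> \<alpha> \<in> K'"
  by (auto simp: K'_def)

lemma abc: "a \<in> carrier R" "b \<in> carrier R" "\<beta> \<in> carrier R"
  using ab alpha by (auto simp: \<beta>_def)

lemma alpha_beta: "\<alpha> \<oplus> \<beta> = a" "\<alpha> \<otimes> \<beta> = b"
proof -
  show "\<alpha> \<oplus> \<beta> = a" unfolding \<beta>_def using abc(1) alpha(1) by algebra
  have "\<alpha> \<otimes> \<beta> = a \<otimes> \<alpha> \<ominus> \<alpha> \<otimes> \<alpha>" unfolding \<beta>_def using abc(1) alpha(1) by algebra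
  also have "\<dots> = b" unfolding alpha_sq using abc(1,2) alpha(1) by algebra
  finally show "\<alpha> \<otimes> \<beta> = b" .
qed

lemma beta_sq: "\<beta> \<otimes> \<beta> = a \<otimes> \<beta> \<ominus> b"
proof -
  have "\<beta> \<otimes> \<beta> = (\<alpha> \<oplus> \<beta>) \<otimes> \<beta> \<ominus> \<alpha> \<otimes> \<beta>" using abc(3) alpha(1) by algebra
  then show ?thesis by (simp add: alpha_beta)
qed

lemma beta_not_K: "\<beta> \<notin> K"
proof
  assume "\<beta> \<in> K"
  then have "a \<ominus> \<beta> \<in> K" using ab by simp
  moreover have "a \<ominus> \<beta> = \<alpha>" unfolding \<beta>_def using abc alpha(1) by algebra
  ultimately show False using alpha by simp
qed

text \<open>Formulated for any \<gamma> outside \<open>K\<close>, because it is applied to both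
  roots \<alpha> and \<beta>.\<close>

lemma rep_unique:
  assumes g: "\<gamma> \<in> carrier R" "\<gamma> \<notin> K" and u: "u \<in> K" "v \<in> K" "u' \<in> K" "v' \<in> K"
    and eq: "u \<oplus> v \<otimes> \<gamma> = u' \<oplus> v' \<otimes> \<gamma>"
  shows "u = u' \<and> v = v'"
proof -
  have c: "u \<in> carrier R" "v \<in> carrier R" "u' \<in> carrier R" "v' \<in> carrier R" using u by auto
  have "(v \<ominus> v') \<otimes> \<gamma> = (u \<oplus> v \<otimes> \<gamma>) \<ominus> u \<ominus> v' \<otimes> \<gamma>" using c g(1) by algebra
  also have "\<dots> = u' \<ominus> u" unfolding eq using c g(1) by algebra
  finally have m: "(v \<ominus> v') \<otimes> \<gamma> = u' \<ominus> u" .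
  have "v = v'"
  proof (rule ccontr)
    assume "v \<noteq> v'"
    then have d: "v \<ominus> v' \<noteq> \<zero>" "v \<ominus> v' \<in> K" "v \<ominus> v' \<in> carrier R" using c u by auto
    note i = inv_nonzero[OF d(3,1)]
    have "\<gamma> = (inv (v \<ominus> v') \<otimes> (v \<ominus> v')) \<otimes> \<gamma>" using i g by simp
    also have "\<dots> = inv (v \<ominus> v') \<otimes> ((v \<ominus> v') \<otimes> \<gamma>)" by (rule m_assoc) (use i d g in auto)
    also have "\<dots> = inv (v \<ominus> v') \<otimes> (u' \<ominus> u)" unfolding m ..
    also have "\<dots> \<in> K" using d u by auto
    finally show False using g by simp
  qed
  moreover from this have "u = u'" using eq c g(1) by simp
  ultimately show ?thesis by blast
qed

lemma mult_rep:
  assumes g: "\<gamma> \<in> carrier R" "\<gamma> \<otimes> \<gamma> = a \<otimes> \<gamma> \<ominus> b" and u: "u \<in> K" "v \<in> K" "u' \<in> K" "v' \<in> K"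
  shows "(u \<oplus> v \<otimes> \<gamma>) \<otimes> (u' \<oplus> v' \<otimes> \<gamma>) = (u \<otimes> u' \<ominus> v \<otimes> v' \<otimes> b) \<oplus> (u \<otimes> v' \<oplus> v \<otimes> u' \<oplus> v \<otimes> v' \<otimes> a) \<otimes> \<gamma>"
proof -
  have c: "u \<in> carrier R" "v \<in> carrier R" "u' \<in> carrier R" "v' \<in> carrier R" using u by auto
  have "(u \<oplus> v \<otimes> \<gamma>) \<otimes> (u' \<oplus> v' \<otimes> \<gamma>) = u \<otimes> u' \<oplus> (u \<otimes> v' \<oplus> v \<otimes> u') \<otimes> \<gamma> \<oplus> v \<otimes> v' \<otimes> (\<gamma> \<otimes> \<gamma>)"
    using c g(1) by algebra
  also have "\<dots> = (u \<otimes> u' \<ominus> v \<otimes> v' \<otimes> b) \<oplus> (u \<otimes> v' \<oplus> v \<otimes> u' \<oplus> v \<otimes> v' \<otimes> a) \<otimes> \<gamma>"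
    unfolding g(2) using c g(1) abc(1,2) by algebra
  finally show ?thesis .
qed

lemma add_rep:
  assumes "\<gamma> \<in> carrier R" "u \<in> K" "v \<in> K" "u' \<in> K" "v' \<in> K"
  shows "(u \<oplus> v \<otimes> \<gamma>) \<oplus> (u' \<oplus> v' \<otimes> \<gamma>) = (u \<oplus> u') \<oplus> (v \<oplus> v') \<otimes> \<gamma>"
proof -
  have c: "u \<in> carrier R" "v \<in> carrier R" "u' \<in> carrier R" "v' \<in> carrier R" using assms by auto
  then show ?thesis using assms(1) by algebra
qed

lemma norm_rep:
  assumes "u \<in> K" "v \<in> K"
  shows "(u \<oplus> v \<otimes> \<alpha>) \<otimes> (u \<oplus> v \<otimes> \<beta>) = u \<otimes> u \<oplus> u \<otimes> v \<otimes> a \<oplus> v \<otimes> v \<otimes> b"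
proof -
  have c: "u \<in> carrier R" "v \<in> carrier R" using assms by auto
  have "(u \<oplus> v \<otimes> \<alpha>) \<otimes> (u \<oplus> v \<otimes> \<beta>) = u \<otimes> u \<oplus> u \<otimes> v \<otimes> (\<alpha> \<oplus> \<beta>) \<oplus> v \<otimes> v \<otimes> (\<alpha> \<otimes> \<beta>)"
    using c abc(3) alpha(1) by algebra
  then show ?thesis by (simp add: alpha_beta)
qed

lemma K'_carrier: "z \<in> K' \<Longrightarrow> z \<in> carrier R"
  using alpha(1) by (auto elim!: K'E)

lemma K_subset_K': "u \<in> K \<Longrightarrow> u \<in> K'"
  using K'I[of u \<zero>] alpha(1) by simp

lemma alpha_K': "\<alpha> \<in> K'"
  using K'I[of \<zero> \<one>] alpha(1) by simp

lemma beta_K': "\<beta> \<in> K'"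
proof -
  have "\<beta> = a \<oplus> (\<ominus> \<one>) \<otimes> \<alpha>" unfolding \<beta>_def using abc alpha(1) by algebra
  then show ?thesis using K'I[of a "\<ominus> \<one>"] ab by simp
qed

lemma rep_zero: "\<gamma> \<in> carrier R \<Longrightarrow> \<gamma> \<notin> K \<Longrightarrow> u \<in> K \<Longrightarrow> v \<in> K \<Longrightarrow> u \<oplus> v \<otimes> \<gamma> = \<zero> \<Longrightarrow> u = \<zero> \<and> v = \<zero>"
  using rep_unique[of \<gamma> u v \<zero> \<zero>] by simp

lemma subfield_K': "subfield K' R"
proof (rule subfieldI'[OF subringI])
  show "K' \<subseteq> carrier R" using K'_carrier by blast
  show "\<one> \<in> K'" using K_subset_K' by simp
  fix x y assume "x \<in> K'" "y \<in> K'"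
  then obtain u v u' v' where c: "u \<in> K" "v \<in> K" "u' \<in> K" "v' \<in> K" "x = u \<oplus> v \<otimes> \<alpha>" "y = u' \<oplus> v' \<otimes> \<alpha>"
    by (metis K'E)
  show "x \<otimes> y \<in> K'" unfolding c(5,6) mult_rep[OF alpha(1) alpha_sq c(1-4)] using c ab by (intro K'I) auto
  show "x \<oplus> y \<in> K'" unfolding c(5,6) add_rep[OF alpha(1) c(1-4)] using c by (intro K'I) auto
next
  fix x assume "x \<in> K'"
  then obtain u v where c: "u \<in> K" "v \<in> K" "x = u \<oplus> v \<otimes> \<alpha>" by (metis K'E)
  have "\<ominus> x = (\<ominus> u) \<oplus> (\<ominus> v) \<otimes> \<alpha>"
  proof -
    have "u \<in> carrier R" "v \<in> carrier R" using c by auto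
    then show ?thesis unfolding c(3) using alpha(1) by algebra
  qed
  then show "\<ominus> x \<in> K'" using c by (auto intro: K'I)
next
  fix x assume x: "x \<in> K' - {\<zero>}"
  then obtain u v where c: "u \<in> K" "v \<in> K" "x = u \<oplus> v \<otimes> \<alpha>" by (metis DiffD1 K'E)
  \<comment> \<open>The norm of x. It lies in \<open>K\<close> and is nonzero, so the inverse of x
    is the conjugate divided by the norm.\<close>
  let ?N = "u \<otimes> u \<oplus> u \<otimes> v \<otimes> a \<oplus> v \<otimes> v \<otimes> b"
  let ?y = "u \<oplus> v \<otimes> \<beta>"
  have yc: "?y \<in> carrier R" "x \<in> carrier R" using c abc alpha(1) by auto
  have NK: "?N \<in> K" using c ab by auto
  have xy: "x \<otimes> ?y = ?N" unfolding c(3) using norm_rep[OF c(1,2)] .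
  have "?y \<noteq> \<zero>" using rep_zero[OF abc(3) beta_not_K c(1,2)] x c alpha(1) by auto
  then have N0: "?N \<noteq> \<zero>" using xy integral[of x ?y] yc x by auto
  note i = inv_nonzero[of ?N]
  have iN: "inv ?N \<in> K" "inv ?N \<in> carrier R" "?N \<otimes> inv ?N = \<one>" using NK N0 i by auto
  have "x \<otimes> (?y \<otimes> inv ?N) = (x \<otimes> ?y) \<otimes> inv ?N" by (rule m_assoc[symmetric]) (use yc iN in auto)
  then have "inv x = ?y \<otimes> inv ?N" using xy iN yc by (intro comm_inv_char) auto
  also have "?y = (u \<oplus> v \<otimes> a) \<oplus> (\<ominus> v) \<otimes> \<alpha>"
  proof -
    have "u \<in> carrier R" "v \<in> carrier R" using c by auto
    then show ?thesis unfolding \<beta>_def using alpha(1) abc(1) by algebra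
  qed
  also have "\<dots> \<otimes> inv ?N = ((u \<oplus> v \<otimes> a) \<otimes> inv ?N) \<oplus> ((\<ominus> v) \<otimes> inv ?N) \<otimes> \<alpha>"
  proof -
    have "u \<oplus> v \<otimes> a \<in> carrier R" "\<ominus> v \<in> carrier R" using c ab by auto
    then show ?thesis using alpha(1) iN(2) by algebra
  qed
  also have "\<dots> \<in> K'" using c ab iN(1) by (intro K'I) auto
  finally show "inv x \<in> K'" .
qed

lemma dimension_K': "dimension 2 K K'"
proof -
  have "dimension (Suc 1) K (line_extension K \<alpha> K)"
    using Suc_dim[OF alpha(1,2)] dimension_one[OF subfield_K] by blast
  moreover have "line_extension K \<alpha> K = K'"
  proof (intro Set.set_eqI iffI)
    fix x assume "x \<in> line_extension K \<alpha> K"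
    then obtain v u where "v \<in> K" "u \<in> K" "x = v \<otimes> \<alpha> \<oplus> u" unfolding line_extension_mem_iff by blast
    then show "x \<in> K'" using K'I[of u v] alpha(1) by (simp add: a_comm)
  next
    fix x assume "x \<in> K'"
    then obtain u v where "u \<in> K" "v \<in> K" "x = v \<otimes> \<alpha> \<oplus> u" using alpha(1) by (auto elim!: K'E simp: a_comm)
    then show "x \<in> line_extension K \<alpha> K" unfolding line_extension_mem_iff by blast
  qed
  ultimately show ?thesis by (simp add: numeral_2_eq_2)
qed

text \<open>The nontrivial automorphism of \<open>K'\<close> over \<open>K\<close>; the choice is
  harmless since coordinates with respect to 1, \<alpha> are unique.\<close>

definition conj :: "'a \<Rightarrow> 'a" where
  "conj z = (SOME w. \<exists>u\<in>K. \<exists>v\<in>K. z = u \<oplus> v \<otimes> \<alpha> \<and> w = u \<oplus> v \<otimes> \<beta>)"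

lemma conj_rep: "u \<in> K \<Longrightarrow> v \<in> K \<Longrightarrow> conj (u \<oplus> v \<otimes> \<alpha>) = u \<oplus> v \<otimes> \<beta>"
  unfolding conj_def by (rule some_equality) (use rep_unique[OF alpha(1,2)] in blast)+

lemma conj_K: "u \<in> K \<Longrightarrow> conj u = u"
  using conj_rep[of u \<zero>] alpha(1) abc(3) by simp

lemma conj_alpha: "conj \<alpha> = \<beta>"
  using conj_rep[of \<zero> \<one>] alpha(1) abc(3) by simp

lemma conj_K': "z \<in> K' \<Longrightarrow> conj z \<in> K'"
proof -
  assume "z \<in> K'"
  then obtain u v where c: "u \<in> K" "v \<in> K" "z = u \<oplus> v \<otimes> \<alpha>" by (metis K'E)
  note F = subringE[OF subfieldE(1)[OF subfield_K']]
  show ?thesis unfolding c(3) conj_rep[OF c(1,2)] using F(6,7) K_subset_K' c beta_K' by blast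
qed

lemma conj_add: "x \<in> K' \<Longrightarrow> y \<in> K' \<Longrightarrow> conj (x \<oplus> y) = conj x \<oplus> conj y"
  and conj_mult: "x \<in> K' \<Longrightarrow> y \<in> K' \<Longrightarrow> conj (x \<otimes> y) = conj x \<otimes> conj y"
proof -
  assume "x \<in> K'" "y \<in> K'"
  then obtain u v u' v' where c: "u \<in> K" "v \<in> K" "u' \<in> K" "v' \<in> K" "x = u \<oplus> v \<otimes> \<alpha>" "y = u' \<oplus> v' \<otimes> \<alpha>"
    by (metis K'E)
  have m: "u \<otimes> u' \<ominus> v \<otimes> v' \<otimes> b \<in> K" "u \<otimes> v' \<oplus> v \<otimes> u' \<oplus> v \<otimes> v' \<otimes> a \<in> K" "u \<oplus> u' \<in> K" "v \<oplus> v' \<in> K"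
    using c ab by auto
  show "conj (x \<oplus> y) = conj x \<oplus> conj y"
    unfolding c(5,6) add_rep[OF alpha(1) c(1-4)] conj_rep[OF m(3,4)] conj_rep[OF c(1,2)] conj_rep[OF c(3,4)] add_rep[OF abc(3) c(1-4)] ..
  show "conj (x \<otimes> y) = conj x \<otimes> conj y"
    unfolding c(5,6) mult_rep[OF alpha(1) alpha_sq c(1-4)] conj_rep[OF m(1,2)] conj_rep[OF c(1,2)] conj_rep[OF c(3,4)] mult_rep[OF abc(3) beta_sq c(1-4)] ..
qed

lemma conj_beta: "conj \<beta> = \<alpha>"
proof -
  have "a = conj (\<alpha> \<oplus> \<beta>)" using conj_K ab alpha_beta by simp
  also have "\<dots> = \<beta> \<oplus> conj \<beta>" using conj_add[OF alpha_K' beta_K'] conj_alpha by simp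
  finally have e: "\<beta> \<oplus> conj \<beta> = a" ..
  have cb: "conj \<beta> \<in> carrier R" using conj_K'[OF beta_K'] K'_carrier by blast
  have "conj \<beta> = (\<beta> \<oplus> conj \<beta>) \<ominus> \<beta>" using cb abc(3) by algebra
  also have "\<dots> = \<alpha>" unfolding e unfolding \<beta>_def using abc alpha(1) by algebra
  finally show ?thesis .
qed

lemma conj_conj: "z \<in> K' \<Longrightarrow> conj (conj z) = z"
proof -
  assume "z \<in> K'"
  then obtain u v where c: "u \<in> K" "v \<in> K" "z = u \<oplus> v \<otimes> \<alpha>" by (metis K'E)
  note F = subringE[OF subfieldE(1)[OF subfield_K']]
  have "v \<otimes> \<beta> \<in> K'" using F(6) K_subset_K' c beta_K' by blast
  then have "conj (u \<oplus> v \<otimes> \<beta>) = u \<oplus> v \<otimes> \<alpha>"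
    using conj_add[of u "v \<otimes> \<beta>"] conj_mult[of v \<beta>] conj_beta conj_K K_subset_K' c beta_K' by simp
  then show ?thesis unfolding c(3) conj_rep[OF c(1,2)] .
qed

text \<open>Here separability enters: v \<beta> = v \<alpha> with \<alpha> \<noteq> \<beta> forces v
  = 0.\<close>

lemma conj_eq_self_imp: "z \<in> K' \<Longrightarrow> conj z = z \<Longrightarrow> z \<in> K"
proof -
  assume z: "z \<in> K'" "conj z = z"
  then obtain u v where c: "u \<in> K" "v \<in> K" "z = u \<oplus> v \<otimes> \<alpha>" by (metis K'E)
  have "v \<otimes> \<beta> = v \<otimes> \<alpha>" using z(2) unfolding c(3) conj_rep[OF c(1,2)] using c abc(3) alpha(1) by simp
  then have "v = \<zero>" using m_lcancel[of v \<beta> \<alpha>] alpha abc(3) c by (auto simp: \<beta>_def)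
  then show "z \<in> K" using c alpha(1) by simp
qed

lemma conj_pow: "z \<in> K' \<Longrightarrow> conj (z [^] (n::nat)) = conj z [^] n \<and> z [^] n \<in> K'"
proof (induct n)
  case 0
  then show ?case using conj_K K_subset_K' by simp
next
  case (Suc n)
  then show ?case using conj_mult subringE(6)[OF subfieldE(1)[OF subfield_K']] by simp
qed

lemma conj_eval:
  assumes z: "z \<in> K'" and p: "set p \<subseteq> K"
  shows "eval p (conj z) = conj (eval p z) \<and> eval p z \<in> K'"
  using p
proof (induct p)
  case Nil
  then show ?case using conj_K K_subset_K' by simp
next
  case (Cons c p)
  note F = subringE[OF subfieldE(1)[OF subfield_K']]
  have "c \<in> K" using Cons by simp
  then have c: "c \<in> K'" "conj c = c" using conj_K K_subset_K' by auto
  have "c \<otimes> z [^] length p \<in> K'" using F(6) c conj_pow[OF z] by blast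
  then show ?case using Cons conj_add[of "c \<otimes> z [^] length p" "eval p z"] conj_mult[OF c(1), of "z [^] length p"] conj_pow[OF z, of "length p"] c F(7) by simp
qed

lemma algebraic_K': "x \<in> K' \<Longrightarrow> (algebraic over K) x"
  using finite_dimension_imp_algebraic[OF subfield_K subfieldE(1)[OF subfield_K'] finite_dimensionI[OF dimension_K']] .

text \<open>The minimal polynomial has degree 1 or 2; in the quadratic case x and its conjugate are
  two distinct roots.\<close>

lemma separable_K':
  assumes x: "x \<in> K'"
  shows "separable_over K x"
proof -
  have xc: "x \<in> carrier R" using K'_carrier x .
  note alg = algebraic_K'[OF x]
  define p where "p = Irr K x"
  note Ir = IrrE[OF subfield_K xc alg, folded p_def]
  have pol: "set p \<subseteq> K" "p \<noteq> []"
    using Ir(1) polynomial_incl[of K p] pirreducibleE(1)[OF subfieldE(1)[OF subfield_K] Ir(1,2)]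
    by (auto simp: univ_poly_carrier[symmetric])
  have dimp: "dimension (degree p) K (simple_extension K x)"
    unfolding p_def using dimension_simple_extension[OF subfield_K xc alg] .
  have hdp: "p = \<one> # tl p" using Ir(3) pol(2) by (cases p) auto
  have "card {y. is_root p y} = degree p"
  proof (cases "x \<in> K")
    case True
    have "simple_extension K x = K"
      by (rule subset_antisym[OF simple_extension_subring_incl[OF subfieldE(1)[OF subfield_K] subset_refl True]
            simple_extension_incl[OF subfieldE(3)[OF subfield_K] xc]])
    then have "dimension (degree p) K K" using dimp by simp
    then have d: "degree p = 1" using dimension_is_inj[OF subfield_K _ dimension_one[OF subfield_K]] by blast
    then have "length (tl p) = 1" by simp
    then obtain c where "tl p = [c]" by (metis One_nat_def length_0_conv length_Suc_conv)
    then have p: "p = [\<one>, c]" using hdp by simp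
    have c: "c \<in> carrier R" using pol(1) p by auto
    have ev: "eval p y = y \<oplus> c" if "y \<in> carrier R" for y using that c by (simp add: p)
    have "{y. is_root p y} = {x}"
    proof (intro Set.set_eqI iffI)
      fix y assume "y \<in> {y. is_root p y}"
      then have y: "y \<in> carrier R" "y \<oplus> c = \<zero>" using ev by (auto simp: is_root_def)
      have "x \<oplus> c = \<zero>" using Ir(4) ev[OF xc] by simp
      then have "y \<oplus> c = x \<oplus> c" using y by simp
      then show "y \<in> {x}" using y xc c by simp
    qed (use Ir(4) xc pol(2) in \<open>auto simp: is_root_def\<close>)
    then show ?thesis using d by simp
  next
    case False
    obtain u v where c: "u \<in> K" "v \<in> K" "x = u \<oplus> v \<otimes> \<alpha>" using x by (metis K'E)
    have v0: "v \<noteq> \<zero>" using False c alpha(1) by auto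
    define S where "S = simple_extension K x"
    have S: "subfield S R" unfolding S_def using simple_extension_is_subfield[OF subfield_K xc] alg by simp
    have sub: "K \<subseteq> S" "x \<in> S" unfolding S_def
      using simple_extension_incl[OF subfieldE(3)[OF subfield_K] xc] simple_extension_mem[OF subfieldE(1)[OF subfield_K] xc] by auto
    note F = subringE[OF subfieldE(1)[OF S]]
    have iv: "inv v \<in> K" "inv v \<otimes> v = \<one>" "inv v \<in> carrier R" using c(2) v0 inv_nonzero[of v] by auto
    \<comment> \<open>\<alpha> is recovered from x, so x generates all of \<open>K'\<close> and its
      minimal polynomial has degree 2.\<close>
    have "\<alpha> = inv v \<otimes> (x \<ominus> u)"
    proof -
      have cc: "u \<in> carrier R" "v \<in> carrier R" using c by auto
      have "inv v \<otimes> (x \<ominus> u) = (inv v \<otimes> v) \<otimes> \<alpha>" unfolding c(3) using cc iv(3) alpha(1) by algebra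
      then show ?thesis using iv alpha(1) by simp
    qed
    also have "\<dots> \<in> S" using F(5,6,7) sub c iv by (simp add: a_minus_def subset_iff)
    finally have aS: "\<alpha> \<in> S" .
    have "S = K'"
    proof
      show "S \<subseteq> K'" unfolding S_def
        using simple_extension_subring_incl[OF subfieldE(1)[OF subfield_K'] _ x] K_subset_K' by blast
      show "K' \<subseteq> S"
      proof
        fix z assume "z \<in> K'"
        then obtain u v where c: "u \<in> K" "v \<in> K" "z = u \<oplus> v \<otimes> \<alpha>" by (metis K'E)
        have "u \<in> S" "v \<in> S" using sub c by auto
        then show "z \<in> S" unfolding c(3) using F(6,7) aS by metis
      qed
    qed
    then have "dimension (degree p) K K'" using dimp by (simp add: S_def)
    then have d: "degree p = 2" using dimension_is_inj[OF subfield_K _ dimension_K'] by blast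
    then have "length (tl p) = Suc (Suc 0)" by simp
    then obtain c1 c0 where "tl p = [c1, c0]" by (metis length_0_conv length_Suc_conv)
    then have p: "p = [\<one>, c1, c0]" using hdp by simp
    have cK: "c1 \<in> K" "c0 \<in> K" and cc: "c1 \<in> carrier R" "c0 \<in> carrier R" using pol(1) p by auto
    have ev: "eval p y = y \<otimes> y \<oplus> (c1 \<otimes> y \<oplus> c0)" if "y \<in> carrier R" for y
      using that cc by (simp add: p numeral_2_eq_2)
    have sx: "conj x \<in> K'" "conj x \<in> carrier R" "conj x \<noteq> x" using conj_K'[OF x] K'_carrier conj_eq_self_imp[OF x] False by auto
    have rx: "eval p x = \<zero>" "eval p (conj x) = \<zero>"
      using Ir(4) conj_eval[OF x pol(1)] conj_K[of \<zero>] by auto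
    \<comment> \<open>The difference of the two values of the monic quadratic factors. At y =
      \<open>conj x\<close> this gives the sum of the roots, and for general y it leaves no third
      root.\<close>
    have diff: "(y \<ominus> x) \<otimes> (y \<oplus> x \<oplus> c1) = \<zero>" if y: "y \<in> carrier R" "eval p y = \<zero>" for y
    proof -
      have "(y \<ominus> x) \<otimes> (y \<oplus> x \<oplus> c1) = (y \<otimes> y \<oplus> (c1 \<otimes> y \<oplus> c0)) \<ominus> (x \<otimes> x \<oplus> (c1 \<otimes> x \<oplus> c0))"
        using y(1) xc cc by algebra
      also have "\<dots> = \<zero>" unfolding ev[OF y(1), symmetric] ev[OF xc, symmetric] y(2) rx(1) by simp
      finally show ?thesis .
    qed
    have s0: "conj x \<oplus> x \<oplus> c1 = \<zero>"
      using diff[OF sx(2) rx(2)] integral[of "conj x \<ominus> x" "conj x \<oplus> x \<oplus> c1"] sx xc cc by auto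
    have "{y. is_root p y} = {x, conj x}"
    proof (intro Set.set_eqI iffI)
      fix y assume "y \<in> {y. is_root p y}"
      then have y: "y \<in> carrier R" "eval p y = \<zero>" by (auto simp: is_root_def)
      then consider "y \<ominus> x = \<zero>" | "y \<oplus> x \<oplus> c1 = \<zero>"
        using diff[OF y] integral[of "y \<ominus> x" "y \<oplus> x \<oplus> c1"] xc cc by auto
      then show "y \<in> {x, conj x}"
      proof cases
        case 1
        then show ?thesis using y xc by simp
      next
        case 2
        then have "y \<oplus> x \<oplus> c1 = conj x \<oplus> x \<oplus> c1" using s0 by simp
        then show ?thesis using y xc cc sx by simp
      qed
    qed (use rx xc sx pol(2) in \<open>auto simp: is_root_def\<close>)
    then show ?thesis using d sx(3) by simp
  qed
  then show ?thesis using alg unfolding separable_over_def p_def by blast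
qed

text \<open>
  A constant \<open>y\<close> of \<open>K'\<close> has trace and norm in \<open>k\<close>. The quadratic polynomial over \<open>k\<close> that it
  satisfies splits after reduction at \<open>Q\<close>, hence it splits over \<open>k\<close>.
\<close>

lemma constants_K':
  assumes Q: "Q \<in> places k K" "place_degree k K Q = 1" "a \<ominus> \<one> \<in> Q" "b \<in> Q"
    and y: "y \<in> K'" "(algebraic over k) y"
  shows "y \<in> k"
proof -
  interpret Q: place R k K Q using placeI[OF Q(1)] .
  obtain u v where c: "u \<in> K" "v \<in> K" "y = u \<oplus> v \<otimes> \<alpha>" using y by (metis K'E)
  have cc: "u \<in> carrier R" "v \<in> carrier R" using c by auto
  have yc: "y \<in> carrier R" "conj y \<in> carrier R" using K'_carrier conj_K' y by auto
  have cy: "conj y = u \<oplus> v \<otimes> \<beta>" using conj_rep[OF c(1,2)] c(3) by simp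
  obtain p where p: "p \<in> carrier (k[X])" "p \<noteq> []" "eval p y = \<zero>" using algebraicE[OF subring_k yc(1) y(2)] .
  have "set p \<subseteq> k" using polynomial_incl[of k p] p(1) by (simp add: univ_poly_carrier)
  then have "eval p (conj y) = \<zero>" using conj_eval[OF y(1), of p] p(3) conj_K[of \<zero>] by auto
  then have ya: "(algebraic over k) (conj y)" using algebraicI[OF p(1,2)] by blast
  note SA = subringE[OF subfieldE(1)[OF subfield_of_algebraics[OF subfield_k]]]
  define T where "T = y \<oplus> conj y"
  define N where "N = y \<otimes> conj y"
  have alg: "(algebraic over k) T" "(algebraic over k) N" unfolding T_def N_def
    using SA(6,7)[of y "conj y"] y ya yc by auto
  have T: "T = (u \<oplus> u) \<oplus> v \<otimes> a"
  proof -
    have "T = (u \<oplus> u) \<oplus> v \<otimes> (\<alpha> \<oplus> \<beta>)" unfolding T_def cy unfolding c(3) using cc alpha(1) abc(3) by algebra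
    then show ?thesis by (simp add: alpha_beta)
  qed
  have N: "N = u \<otimes> u \<oplus> u \<otimes> v \<otimes> a \<oplus> v \<otimes> v \<otimes> b" unfolding N_def cy unfolding c(3) using norm_rep[OF c(1,2)] .
  have "T \<in> K" unfolding T using c ab by auto
  moreover have "N \<in> K" unfolding N using c ab by auto
  ultimately have TN: "T \<in> k" "N \<in> k" using alg transcendental_k unfolding over_def by blast+
  have TNc: "T \<in> carrier R" "N \<in> carrier R" using TN by auto
  let ?f = "\<lambda>x. (x \<otimes> x \<ominus> T \<otimes> x) \<oplus> N"
  have fy: "?f x = (x \<ominus> y) \<otimes> (x \<ominus> conj y)" if "x \<in> carrier R" for x
    unfolding T_def N_def using that yc by algebra
  have abV: "a \<in> Q.V - Q" "b \<in> Q.V"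
  proof -
    have "a = (a \<ominus> \<one>) \<oplus> \<one>" using abc(1) by algebra
    then have "a = \<one> \<oplus> (a \<ominus> \<one>)" using abc(1) by (simp add: a_comm)
    then show "a \<in> Q.V - Q" using Q.one_plus_P[OF Q(3)] by simp
  qed (use Q in auto)
  \<comment> \<open>The discriminant a^2 - 4 b, a unit at \<open>Q\<close> since a is congruent to 1
    and b to 0.\<close>
  define D where "D = a \<otimes> a \<ominus> ((b \<oplus> b) \<oplus> (b \<oplus> b))"
  have D: "D \<in> Q.V - Q"
  proof
    have aa: "a \<otimes> a \<in> Q.V - Q" using Q.unit_mult abV by blast
    have bb: "(b \<oplus> b) \<oplus> (b \<oplus> b) \<in> Q" using Q(4) by auto
    show "D \<in> Q.V" unfolding D_def using aa bb by blast
    show "D \<notin> Q"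
    proof
      assume "D \<in> Q"
      then have "D \<oplus> ((b \<oplus> b) \<oplus> (b \<oplus> b)) \<in> Q" using bb by blast
      moreover have "D \<oplus> ((b \<oplus> b) \<oplus> (b \<oplus> b)) = a \<otimes> a" unfolding D_def using abc by algebra
      ultimately show False using aa by simp
    qed
  qed
  have D1: "D \<in> K" "D \<noteq> \<zero>" using D Q.V_K Q.P_closed(1) by blast+
  then have "Q.v D = 0" using D Q.v_nonneg_iff[OF D1] Q.v_pos_iff[OF D1] by simp
  note DK = D1 this
  \<comment> \<open>The next lines establish v^2 (a^2 - 4 b) = T^2 - 4 N, which expresses y - conj y
    = v (\<alpha> - \<beta>). As the right side is constant and the discriminant a unit, v has no
    pole at \<open>Q\<close>.\<close>
  define w where "w = v \<otimes> a"
  define m where "m = u \<otimes> (u \<oplus> w)"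
  define e where "e = v \<otimes> v \<otimes> b"
  have wme: "w \<in> carrier R" "m \<in> carrier R" "e \<in> carrier R" using cc abc by (auto simp: w_def m_def e_def)
  have Nme: "N = m \<oplus> e" unfolding N m_def w_def e_def using cc abc by algebra
  have "T \<otimes> T = (u \<oplus> u) \<otimes> (u \<oplus> w) \<oplus> (u \<oplus> u) \<otimes> (u \<oplus> w) \<oplus> w \<otimes> w"
    unfolding T w_def[symmetric] using cc wme(1) by algebra
  also have "\<dots> = (m \<oplus> m) \<oplus> (m \<oplus> m) \<oplus> w \<otimes> w" unfolding m_def using cc wme(1) by algebra
  finally have "T \<otimes> T \<ominus> ((N \<oplus> N) \<oplus> (N \<oplus> N)) = w \<otimes> w \<ominus> ((e \<oplus> e) \<oplus> (e \<oplus> e))"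
    unfolding Nme using wme by algebra
  moreover have "v \<otimes> v \<otimes> D = w \<otimes> w \<ominus> ((e \<oplus> e) \<oplus> (e \<oplus> e))"
    unfolding D_def w_def e_def using cc abc by algebra
  ultimately have "v \<otimes> v \<otimes> D = T \<otimes> T \<ominus> ((N \<oplus> N) \<oplus> (N \<oplus> N))" by simp
  then have vv: "v \<otimes> v \<otimes> D \<in> k" using TN by auto
  have vV: "v \<in> Q.V"
  proof (cases "v = \<zero>")
    case False
    then have nz: "v \<otimes> v \<noteq> \<zero>" "v \<otimes> v \<otimes> D \<noteq> \<zero>" using integral[of v v] integral[of "v \<otimes> v" D] cc DK by auto
    have "Q.v (v \<otimes> v \<otimes> D) = 2 * Q.v v"
      using Q.v_mult[of "v \<otimes> v" D] Q.v_mult[of v v] c False nz DK by simp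
    moreover have "Q.v (v \<otimes> v \<otimes> D) = 0" using Q.v_const[OF vv nz(2)] .
    ultimately show ?thesis using Q.v_nonneg_iff[OF c(2) False] by simp
  qed simp
  \<comment> \<open>u is a root of X^2 + v a X + (v^2 b - N), monic with coefficients integral at
    \<open>Q\<close>.\<close>
  have uV: "u \<in> Q.V"
  proof (rule ccontr)
    assume u: "u \<notin> Q.V"
    then have u0: "u \<noteq> \<zero>" by auto
    have iu: "inv u \<in> Q" "u \<otimes> inv u = \<one>" "inv u \<in> carrier R" using Q.not_V_inv_P[OF c(1) u] inv_nonzero[OF cc(1) u0] by auto
    have "u = (u \<otimes> inv u) \<otimes> u" using iu cc by simp
    also have "\<dots> = (N \<ominus> u \<otimes> v \<otimes> a \<ominus> v \<otimes> v \<otimes> b) \<otimes> inv u" unfolding N using cc abc iu(3) by algebra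
    also have "\<dots> = N \<otimes> inv u \<ominus> (u \<otimes> inv u) \<otimes> v \<otimes> a \<ominus> v \<otimes> v \<otimes> b \<otimes> inv u" using cc abc iu(3) TNc by algebra
    also have "\<dots> = N \<otimes> inv u \<ominus> v \<otimes> a \<ominus> v \<otimes> v \<otimes> b \<otimes> inv u" using iu cc by simp
    also have "\<dots> \<in> Q.V" using TN iu vV abV by blast
    finally show False using u by simp
  qed
  \<comment> \<open>At a place above \<open>Q\<close> where \<alpha> vanishes, y reduces to u. The
    residue d of u is thus the candidate for a root of \<open>?f\<close> in \<open>k\<close>, and
    \<open>?f d\<close> is a constant vanishing at \<open>Q\<close>, hence zero.\<close>
  obtain d where d: "d \<in> k" "u \<ominus> d \<in> Q" using Q.deg_one_iff Q(2) uV by blast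
  have dc: "d \<in> carrier R" using d by auto
  have "?f d = (u \<ominus> d) \<otimes> ((u \<ominus> d) \<oplus> v \<otimes> a) \<oplus> v \<otimes> v \<otimes> b"
    unfolding T N using dc cc abc by algebra
  also have "\<dots> \<in> Q"
  proof -
    have "(u \<ominus> d) \<oplus> v \<otimes> a \<in> Q.V" using d vV abV by blast
    then have "(u \<ominus> d) \<otimes> ((u \<ominus> d) \<oplus> v \<otimes> a) \<in> Q" using d(2) by blast
    moreover have "v \<otimes> v \<otimes> b \<in> Q" using vV Q(4) by blast
    ultimately show ?thesis by blast
  qed
  finally have "?f d \<in> Q" .
  moreover have "?f d \<in> k" using d TN by auto
  ultimately have "(d \<ominus> y) \<otimes> (d \<ominus> conj y) = \<zero>" using Q.k_inter_P fy[OF dc] by metis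
  then have "d \<ominus> y = \<zero> \<or> d \<ominus> conj y = \<zero>" by (rule integral) (use yc dc in auto)
  then show "y \<in> k"
  proof
    assume "d \<ominus> y = \<zero>"
    then show ?thesis using d yc dc by simp
  next
    assume "d \<ominus> conj y = \<zero>"
    then have "conj y = d" using yc dc by simp
    then have "y = d" using conj_conj[OF y(1)] conj_K[of d] d by simp
    then show ?thesis using d by simp
  qed
qed

text \<open>The absence of new constants is the one property that a quadratic extension may lack; it
  is left as a hypothesis, to be met through a split rational place.\<close>

lemma function_field_K':
  assumes const: "\<And>y. y \<in> K' \<Longrightarrow> (algebraic over k) y \<Longrightarrow> y \<in> k"
  shows "function_field k K'"
proof -
  have KK': "K \<subseteq> K'" using K_subset_K' by blast
  obtain S where S: "finite S" "S \<subseteq> K" "K = generate_field R (k \<union> S)" using ff by (auto simp: function_field_def)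
  obtain x where x: "x \<in> K" "(transcendental over k) x" "\<And>y. y \<in> K \<Longrightarrow> (algebraic over (generate_field R (insert x k))) y"
    using ff by (auto simp: function_field_def)
  let ?G = "generate_field R (k \<union> insert \<alpha> S)"
  have car: "k \<union> insert \<alpha> S \<subseteq> carrier R" using alpha(1) S(2) by auto
  have G: "subfield ?G R" by (rule generate_field_is_subfield[OF car])
  have KG: "K \<subseteq> ?G" unfolding S(3) by (rule mono_generate_field[OF _ car]) auto
  have aG: "\<alpha> \<in> ?G" by (rule generate_field.incl) simp
  have "K' = ?G"
  proof
    show "K' \<subseteq> ?G"
    proof
      fix z assume "z \<in> K'"
      then obtain u v where c: "u \<in> K" "v \<in> K" "z = u \<oplus> v \<otimes> \<alpha>" by (metis K'E)
      have "u \<in> ?G" "v \<in> ?G" using KG c by auto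
      then show "z \<in> ?G" unfolding c(3) using subringE(6,7)[OF subfieldE(1)[OF G]] aG by metis
    qed
    show "?G \<subseteq> K'" by (rule generate_field_min_subfield1[OF car subfield_K']) (use KK' alpha_K' S(2) in auto)
  qed
  moreover have "finite (insert \<alpha> S)" "insert \<alpha> S \<subseteq> K'" using S KK' alpha_K' by auto
  moreover have "(algebraic over (generate_field R (insert x k))) y" if y: "y \<in> K'" for y
  proof -
    let ?E = "generate_field R (insert x k)"
    have E: "subfield ?E R" by (rule generate_field_is_subfield) (use x(1) in auto)
    have fd: "finite_dimension ?E K"
      by (rule finite_dimension_if_algebraic[OF E _ generate_field_subset_K[OF x(1)] x(3)]) (auto intro: generate_field.incl)
    have "finite_dimension ?E K'"
      using telescopic_base_dim(1)[OF E subfield_K fd finite_dimensionI[OF dimension_K']] .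
    then show ?thesis using finite_dimension_imp_algebraic[OF E subfieldE(1)[OF subfield_K']] y by blast
  qed
  ultimately show ?thesis unfolding function_field_def
    using subfield_k subfield_K' k_subset_K KK' x const by blast
qed

end

section \<open>Places in extensions\<close>

context place
begin

lemma v_int_pow: "x \<in> K \<Longrightarrow> x \<noteq> \<zero> \<Longrightarrow> v (x [^] (n::int)) = n * v x"
proof -
  assume x: "x \<in> K" "x \<noteq> \<zero>"
  have xc: "x \<in> carrier R" using x by simp
  have nat: "v (x [^] int m) = int m * v x" for m
    unfolding int_pow_int using v_pow[OF x] by blast
  show ?thesis
  proof (cases n rule: int_cases2)
    case (nonneg m)
    show ?thesis unfolding nonneg by (rule nat)
  next
    case (nonpos m)
    have "v (x [^] (- int m)) = v (inv (x [^] int m))"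
      using int_pow_uminus[OF xc x(2)] by simp
    also have "\<dots> = - v (x [^] int m)"
      by (rule v_inv) (use x int_pow_closed_nonzero(2)[OF xc x(2)] in auto)
    finally show ?thesis unfolding nonpos using nat[of m] by simp
  qed
qed

text \<open>The value e is arbitrary because of two uses: e = 1 over \<open>K\<close> shows by
  parity that there is no root in \<open>K\<close>, and e equal to the ramification index shows
  above \<open>P\<close> that this index is even.\<close>

lemma eisenstein:
  assumes x: "x \<in> K" "x \<otimes> x = a \<otimes> x \<ominus> b" and a: "a \<in> val_ge P e" and b: "b \<in> K" "b \<noteq> \<zero>" "v b = e" and e: "e > 0"
  shows "x \<noteq> \<zero> \<and> 2 * v x = e"
proof -
  have aK: "a \<in> K" using a by blast
  have c: "a \<in> carrier R" "b \<in> carrier R" "x \<in> carrier R" using aK b x by auto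
  have x0: "x \<noteq> \<zero>"
  proof
    assume "x = \<zero>"
    then have "\<zero> = \<ominus> b" using x(2) c by (simp add: a_minus_def)
    then have "b = \<zero>" using c(2) by (metis minus_minus minus_zero)
    then show False using b by simp
  qed
  have v2: "x \<otimes> x \<noteq> \<zero>" "v (x \<otimes> x) = 2 * v x" using v_mult[OF x(1) x0 x(1) x0] integral[of x x] x0 c by auto
  have eq: "x \<otimes> x = \<ominus> b \<oplus> a \<otimes> x" using x(2) c by (simp add: a_minus_def a_comm)
  have nb: "\<ominus> b \<in> K" "\<ominus> b \<noteq> \<zero>" "v (\<ominus> b) = e" using b v_minus[OF b(1,2)] c by auto
  have main: "2 * v x = e" if lt: "v x > 0"
  proof (cases "a \<otimes> x = \<zero>")
    case True
    then show ?thesis using v2 eq nb c by simp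
  next
    case False
    then have a0: "a \<noteq> \<zero>" using c by auto
    have "v (a \<otimes> x) > e" using v_mult[OF aK a0 x(1) x0] a a0 lt by (simp add: val_ge_def)
    then have "v (\<ominus> b \<oplus> a \<otimes> x) = v (\<ominus> b)"
      using v_add_strict(2)[OF nb(1,2) _ False] aK x(1) nb(3) by simp
    then show ?thesis using v2(2) nb(3) by (simp only: eq)
  qed
  moreover have "v x > 0"
  proof (rule ccontr)
    assume le: "\<not> v x > 0"
    \<comment> \<open>If x had value at most 0, both terms of - b + a x would have value above 2
      v(x), the value of x^2.\<close>
    have m: "2 * v x + 1 \<le> e + v x" using le e by simp
    have "a \<otimes> x \<in> val_ge P (2 * v x + 1)"
      using val_ge_mono[OF val_ge_mult[OF a, of x "v x"] m] x(1) by (simp add: val_ge_def)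
    moreover have "\<ominus> b \<in> val_ge P (2 * v x + 1)" using nb le e by (simp add: val_ge_def)
    ultimately have "x \<otimes> x \<in> val_ge P (2 * v x + 1)" using val_ge_add eq by simp
    then show False using v2 by (simp add: val_ge_def)
  qed
  ultimately show ?thesis using x0 by blast
qed

end

context finite_function_field
begin

text \<open>If x were regular at \<open>P\<close> but had a pole at \<open>Q\<close>, then x^n t
  with t in \<open>P\<close> would lie in \<open>P\<close>, yet not in \<open>Q\<close> for large
  n.\<close>

lemma place_over_inter:
  assumes M: "finite_function_field R k M" "K \<subseteq> M" and P: "P \<in> places k K" and Q: "Q \<in> places k M" and sub: "P \<subseteq> Q"
  shows "Q \<inter> K = P" and "place_ring K P \<subseteq> place_ring M Q"
proof -
  interpret M: finite_function_field R k M using M(1) .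
  interpret P: place R k K P using placeI[OF P] .
  interpret Q: place R k M Q using M.placeI[OF Q] .
  obtain t where t: "t \<in> P" "t \<noteq> \<zero>" using P.exists_nonzero_P by blast
  have tM: "t \<in> M" using t P.V_K P.P_V M(2) by blast
  show sV: "P.V \<subseteq> Q.V"
  proof
    fix x assume x: "x \<in> P.V"
    have xM: "x \<in> M" using x P.V_K M(2) by blast
    show "x \<in> Q.V"
    proof (rule ccontr)
      assume nx: "x \<notin> Q.V"
      then have x0: "x \<noteq> \<zero>" using Q.V_closed(1) by metis
      have neg: "Q.v x \<le> -1" using Q.v_nonneg_iff[OF xM x0] nx by simp
      define n where "n = nat (Q.v t)"
      have "x [^] n \<otimes> t \<in> P" using x t P.V_pow P.P_smult by blast
      then have inQ: "x [^] n \<otimes> t \<in> Q" using sub by blast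
      note p = Q.v_pow[OF xM x0, of n]
      have pM: "x [^] n \<in> M" using M.K_pow[OF xM] .
      have nz: "x [^] n \<otimes> t \<noteq> \<zero>" using p integral[of "x [^] n" t] t tM pM M.K_carrier by blast
      have "Q.v (x [^] n \<otimes> t) > 0" using Q.v_pos_iff[of "x [^] n \<otimes> t"] inQ nz pM tM by simp
      then have "int n * Q.v x + Q.v t > 0" using Q.v_mult[OF pM _ tM t(2)] p by simp
      moreover have "int n * Q.v x \<le> int n * (-1)" using neg by (intro mult_left_mono) auto
      moreover have "int n \<ge> Q.v t" by (simp add: n_def)
      ultimately show False by linarith
    qed
  qed
  show "Q \<inter> K = P"
  proof
    show "P \<subseteq> Q \<inter> K" using sub P.V_K P.P_V by blast
    show "Q \<inter> K \<subseteq> P"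
    proof
      fix x assume x: "x \<in> Q \<inter> K"
      show "x \<in> P"
      proof (rule ccontr)
        assume nP: "x \<notin> P"
        then have x0: "x \<noteq> \<zero>" using P.P_closed(1) by metis
        have "inv x \<in> Q.V"
        proof (cases "x \<in> P.V")
          case True
          then show ?thesis using P.unit_iff[OF True] nP sV by blast
        next
          case False
          then show ?thesis using P.not_V_inv_P[of x] x sub Q.P_V by blast
        qed
        moreover have "x \<in> Q" using x by blast
        ultimately show False using Q.mem_P_iff[of x] x0 by blast
      qed
    qed
  qed
qed

text \<open>The index is the value at \<open>Q\<close> of a uniformizer of \<open>P\<close>, units
  of \<open>P\<close> being units of \<open>Q\<close>. This justifies the description operator in
  \<open>ramification_index\<close>.\<close>

lemma ramification_index_eq:
  assumes M: "finite_function_field R k M" "K \<subseteq> M" and P: "P \<in> places k K" and Q: "Q \<in> places k M" and sub: "P \<subseteq> Q"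
  shows "\<exists>e. e > 0 \<and> ramification_index K M P Q = e \<and> (\<forall>x\<in>K - {\<zero>}. place_val M Q x = int e * place_val K P x)"
proof -
  interpret M: finite_function_field R k M using M(1) .
  interpret P: place R k K P using placeI[OF P] .
  interpret Q: place R k M Q using M.placeI[OF Q] .
  note over = place_over_inter[OF M P Q sub]
  obtain t where t: "P.uniformizer t" using P.exists_uniformizer by blast
  have tP: "t \<in> P" "t \<noteq> \<zero>" "t \<in> K" using t P.V_K P.P_V by (auto simp: P.uniformizer_def)
  have tM: "t \<in> M" using tP M(2) by blast
  define e where "e = nat (Q.v t)"
  have tQ: "Q.v t > 0" using Q.v_pos_iff[OF tM tP(2)] sub tP(1) by blast
  have e: "int e = Q.v t" "e > 0" using tQ by (auto simp: e_def)
  have all: "\<forall>x\<in>K - {\<zero>}. place_val M Q x = int e * place_val K P x"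
  proof
    fix x assume "x \<in> K - {\<zero>}"
    then have x: "x \<in> K" "x \<noteq> \<zero>" by auto
    obtain u n where u: "u \<in> P.V - P" "x = u \<otimes> t [^] (n::int)" using P.exists_rep[OF t x] by blast
    have vx: "P.v x = n" unfolding u(2) by (rule P.v_rep[OF t u(1)])
    have uK: "u \<in> K" "u \<noteq> \<zero>" using u P.V_K P.P_closed(1) by blast+
    have uM: "u \<in> M" using uK M(2) by blast
    have "u \<notin> Q" using over(1) u uK by blast
    moreover have "u \<in> Q.V" using over(2) u by blast
    ultimately have "Q.v u = 0" using Q.v_pos_iff[OF uM uK(2)] Q.v_nonneg_iff[OF uM uK(2)] by simp
    moreover have tc: "t \<in> carrier R" using tP(3) by simp
    have "t [^] n \<noteq> \<zero>" using int_pow_closed_nonzero(2)[OF tc tP(2)] .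
    moreover have "t [^] n \<in> M" using M.K_int_pow[OF tM tP(2)] .
    ultimately have "Q.v x = n * Q.v t"
      unfolding u(2) using Q.v_mult[OF uM uK(2), of "t [^] n"] Q.v_int_pow[OF tM tP(2), of n] by simp
    then show "Q.v x = int e * P.v x" using vx e by simp
  qed
  have "ramification_index K M P Q = e"
    unfolding ramification_index_def
  proof (rule the_equality)
    show "\<forall>x\<in>K - {\<zero>}. place_val M Q x = int e * place_val K P x" by (rule all)
    fix e' assume "\<forall>x\<in>K - {\<zero>}. place_val M Q x = int e' * place_val K P x"
    then have "Q.v t = int e' * P.v t" using tP by blast
    then show "e' = e" using P.v_uniformizer[OF t] e(1) by simp
  qed
  then show ?thesis using e(2) all by blast
qed

end

section \<open>Places of a quadratic extension: lying over, ramification, splitting\<close>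

locale quadratic_function_field = quadratic_extension +
  assumes ff': "function_field k K'"

sublocale quadratic_function_field \<subseteq> E: finite_function_field R k K'
  by unfold_locales (use ff' finite_k in auto)

context quadratic_function_field
begin

lemma E_ff: "finite_function_field R k K'"
  by (rule E.finite_function_field_axioms)

lemma K_sub: "K \<subseteq> K'"
  using K_subset_K' by blast

text \<open>Chevalley's theorem is applied to the ring of \<open>P\<close> inside \<open>K'\<close>,
  avoiding the inverse of a uniformizer t, so that t and with it all of \<open>P\<close> stay
  nonunits.\<close>

lemma exists_place_over:
  assumes "P \<in> places k K"
  shows "\<exists>P'\<in>places k K'. P \<subseteq> P'"
proof -
  interpret P: place R k K P using placeI[OF assms] .
  obtain t where t: "P.uniformizer t" using P.exists_uniformizer by blast
  then have tP: "t \<in> P" "t \<noteq> \<zero>" and PV: "P = (\<otimes>) t ` P.V" by (auto simp: P.uniformizer_def)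
  have tV: "t \<in> P.V" and it: "inv t \<notin> P.V" using P.mem_P_iff[of t] tP by blast+
  have "P.V \<subseteq> K'" using P.V_K K_sub by blast
  then obtain W where W: "subring W R" "P.V \<subseteq> W" "W \<subseteq> K'" "inv t \<notin> W" "\<And>z. z \<in> K' \<Longrightarrow> z \<noteq> \<zero> \<Longrightarrow> z \<in> W \<or> inv z \<in> W"
    using exists_valuation_ring[OF subfield_K' P.V_props(1) _ tV tP(2) it] by metis
  have "t \<in> W" "t \<notin> k" "k \<subseteq> W" using W(2) tV P.P_nonconstant[OF tP] P.k_V by blast+
  moreover have "inv t \<in> K'" using E.K_closed(7)[of t] tP(2) W(2,3) tV by blast
  ultimately have VR: "valuation_ring k K' W" unfolding valuation_ring_def using W by blast
  have "P \<subseteq> nonunits W"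
  proof
    fix x assume "x \<in> P"
    then obtain w where w: "w \<in> P.V" "x = t \<otimes> w" using PV by blast
    have "t \<in> nonunits W" using \<open>t \<in> W\<close> W(4) by (simp add: mem_nonunits)
    then have "w \<otimes> t \<in> nonunits W" using nonunits_smult[OF VR, of w t] w W(2) by blast
    moreover have "x = w \<otimes> t" using w tP by (simp add: m_comm)
    ultimately show "x \<in> nonunits W" by simp
  qed
  then show ?thesis using E.nonunits_place(1)[OF VR] by blast
qed

text \<open>The point is that the restriction is not trivial. If \<open>K\<close> consisted of
  integral elements, the norm of a nonzero s in P' would be a unit; but \<open>conj s\<close>, trace
  minus s, would be integral, so the norm would lie in P'.\<close>

lemma place_restrict:
  assumes "P' \<in> places k K'"
  shows "P' \<inter> K \<in> places k K" and "place_ring K (P' \<inter> K) = place_ring K' P' \<inter> K"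
proof -
  interpret P: place R k K' P' using E.placeI[OF assms] .
  let ?W = "P.V \<inter> K"
  have "\<not> K \<subseteq> P.V"
  proof
    assume KV: "K \<subseteq> P.V"
    obtain s where s: "s \<in> P'" "s \<noteq> \<zero>" using P.exists_nonzero_P by blast
    have sK: "s \<in> K'" using s by blast
    have sc: "s \<in> carrier R" "conj s \<in> carrier R" using K'_carrier sK conj_K' by blast+
    obtain u w where c: "u \<in> K" "w \<in> K" "s = u \<oplus> w \<otimes> \<alpha>" using sK by (metis K'E)
    have cj: "conj s = u \<oplus> w \<otimes> \<beta>" using conj_rep[OF c(1,2)] c(3) by simp
    have cc: "u \<in> carrier R" "w \<in> carrier R" using c by auto
    have "s \<oplus> conj s = (u \<oplus> u) \<oplus> w \<otimes> (\<alpha> \<oplus> \<beta>)" unfolding cj unfolding c(3) using cc alpha(1) abc(3) by algebra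
    then have T: "s \<oplus> conj s \<in> K" using alpha_beta c ab by simp
    have N: "s \<otimes> conj s \<in> K" unfolding cj unfolding c(3) norm_rep[OF c(1,2)] using c ab by auto
    have "conj s \<noteq> \<zero>" using conj_conj[OF sK] conj_K[of \<zero>] s by auto
    then have N0: "s \<otimes> conj s \<noteq> \<zero>" using integral[OF _ sc] s by blast
    have "conj s = (s \<oplus> conj s) \<ominus> s" using sc by algebra
    moreover have "(s \<oplus> conj s) \<ominus> s \<in> P.V" using T KV s P.V_closed(6) by blast
    ultimately have "conj s \<in> P.V" by simp
    then have "s \<otimes> conj s \<in> P'" using s P.P_smult' by blast
    moreover have "inv (s \<otimes> conj s) \<in> P.V" using KV K_closed(7)[OF N N0] by blast
    ultimately show False using P.mem_P_iff N0 by blast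
  qed
  moreover obtain z where z: "z \<in> K" "z \<notin> k" using exists_nonconstant by blast
  note iz = inv_not_k[OF z]
  have "z \<in> P.V \<or> inv z \<in> P.V" using P.V_props(6)[of z] z K_sub iz by blast
  then have "k \<noteq> ?W" using z iz by blast
  moreover have "subring ?W R" using subring_inter[OF P.V_props(1) subfieldE(1)[OF subfield_K]] .
  moreover have "k \<subseteq> ?W" using P.k_V k_K by blast
  moreover have "x \<in> ?W \<or> inv x \<in> ?W" if "x \<in> K" "x \<noteq> \<zero>" for x
    using P.V_props(6)[of x] that K_sub K_closed(7) by blast
  ultimately have VR: "valuation_ring k K ?W" unfolding valuation_ring_def by blast
  have "x \<in> nonunits ?W \<longleftrightarrow> x \<in> P' \<inter> K" for x
  proof (cases "x \<in> K \<and> x \<noteq> \<zero>")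
    case True
    then have "inv x \<in> K" by auto
    then show ?thesis unfolding mem_nonunits using P.mem_P_iff[of x] True by blast
  next
    case False
    then show ?thesis unfolding mem_nonunits using P.mem_P_iff[of x] P.V_closed(1) K_closed(1) by blast
  qed
  then have "nonunits ?W = P' \<inter> K" by blast
  then show "P' \<inter> K \<in> places k K" "place_ring K (P' \<inter> K) = P.V \<inter> K" using nonunits_place[OF VR] by simp_all
qed

lemma rational_restrict:
  assumes P': "P' \<in> places k K'" and d: "place_degree k K' P' = 1"
  shows "place_degree k K (P' \<inter> K) = 1"
proof -
  note r = place_restrict[OF P']
  interpret P: place R k K' P' using E.placeI[OF P'] .
  interpret Q: place R k K "P' \<inter> K" using placeI[OF r(1)] .
  show ?thesis unfolding Q.deg_one_iff
  proof
    fix x assume "x \<in> Q.V"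
    then have x: "x \<in> P.V" "x \<in> K" using r(2) by auto
    then obtain c where c: "c \<in> k" "x \<ominus> c \<in> P'" using d P.deg_one_iff by blast
    then show "\<exists>c\<in>k. x \<ominus> c \<in> P' \<inter> K" using x(2) K_closed(6) k_K by blast
  qed
qed

lemma alpha_integral:
  assumes P': "P' \<in> places k K'" and "a \<in> place_ring K' P'" "b \<in> place_ring K' P'"
  shows "\<alpha> \<in> place_ring K' P'"
proof (rule ccontr)
  interpret P: place R k K' P' using E.placeI[OF P'] .
  assume nV: "\<alpha> \<notin> P.V"
  have i: "inv \<alpha> \<in> P.V" using P.not_V_inv_P[OF alpha_K' nV] by blast
  have a0: "\<alpha> \<noteq> \<zero>" using alpha(2) by auto
  note ia = inv_nonzero[OF alpha(1) a0]
  have "\<alpha> = (\<alpha> \<otimes> \<alpha>) \<otimes> inv \<alpha>" using ia alpha(1) by (simp add: m_assoc)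
  also have "\<dots> = a \<otimes> (\<alpha> \<otimes> inv \<alpha>) \<ominus> b \<otimes> inv \<alpha>"
    unfolding alpha_sq using ia[THEN conjunct1] alpha(1) abc(1,2) by algebra
  also have "\<dots> = a \<ominus> b \<otimes> inv \<alpha>" using ia abc by simp
  also have "\<dots> \<in> P.V" using assms(2,3) i by blast
  finally show False using nV by simp
qed

text \<open>The Eisenstein equation makes the index e = 2 m with m the value of \<alpha>. Elements
  of \<open>K\<close> have values divisible by 2 m, while w \<alpha> has an odd multiple of m, so no
  cancellation occurs and 1, \<alpha> is an integral basis at \<open>P\<close>.\<close>

lemma ramified_place:
  assumes P: "P \<in> places k K" "a \<in> P" "b \<noteq> \<zero>" "place_val K P b = 1"
    and P': "P' \<in> places k K'" "P \<subseteq> P'"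
  shows "ramification_index K K' P P' > 1"
    and "\<And>u w. u \<in> K \<Longrightarrow> w \<in> K \<Longrightarrow> u \<oplus> w \<otimes> \<alpha> \<in> place_ring K' P' \<longleftrightarrow> u \<in> place_ring K P \<and> w \<in> place_ring K P"
    and "\<alpha> \<in> P'"
proof -
  interpret P: place R k K P using placeI[OF P(1)] .
  interpret P': place R k K' P' using E.placeI[OF P'(1)] .
  note over = place_over_inter[OF E_ff K_sub P(1) P']
  obtain e where e: "e > 0" "ramification_index K K' P P' = e" "\<And>x. x \<in> K \<Longrightarrow> x \<noteq> \<zero> \<Longrightarrow> P'.v x = int e * P.v x"
    using ramification_index_eq[OF E_ff K_sub P(1) P'] by auto
  have aV: "a \<in> E.val_ge P' (int e)"
  proof (cases "a = \<zero>")
    case False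
    have "P.v a \<ge> 1" using P.v_pos_iff[OF ab(1) False] P(2) by simp
    then have "int e * 1 \<le> int e * P.v a" by (intro mult_left_mono) auto
    then show ?thesis using e(3)[OF ab(1) False] K_sub ab(1) unfolding E.val_ge_def by auto
  qed simp
  have vb: "P'.v b = int e" using e(3)[OF ab(2) P(3)] P(4) by simp
  have es: "\<alpha> \<noteq> \<zero> \<and> 2 * P'.v \<alpha> = int e"
    by (rule P'.eisenstein[OF alpha_K' alpha_sq aV _ P(3) vb]) (use ab K_sub e(1) in auto)
  define m where "m = P'.v \<alpha>"
  have em: "int e = 2 * m" "m \<ge> 1" using es e(1) unfolding m_def by linarith+
  then show "ramification_index K K' P P' > 1" using e(2) by linarith
  show "\<alpha> \<in> P'" using P'.v_pos_iff[OF alpha_K'] es em by (simp add: m_def)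
  then have aV': "\<alpha> \<in> P'.V" by blast
  have vu: "P'.v x = 2 * (m * P.v x)" "x \<in> P.V \<longleftrightarrow> P.v x \<ge> 0" if "x \<in> K" "x \<noteq> \<zero>" for x
    using e(3)[OF that] em P.v_nonneg_iff[OF that] by auto
  have pos: "P.v x \<ge> 0" if "m * P.v x \<ge> 0" for x
    using that em(2) by (simp add: zero_le_mult_iff)
  have pos2: "P.v x \<ge> 0" if "2 * (m * P.v x) + m \<ge> 0" for x
  proof (rule ccontr)
    assume "\<not> P.v x \<ge> 0"
    then have "m * P.v x \<le> m * (-1)" using em(2) by (intro mult_left_mono) auto
    then show False using that em(2) by linarith
  qed
  show "u \<oplus> w \<otimes> \<alpha> \<in> P'.V \<longleftrightarrow> u \<in> P.V \<and> w \<in> P.V" if uw: "u \<in> K" "w \<in> K" for u w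
  proof
    assume "u \<in> P.V \<and> w \<in> P.V"
    then have "u \<in> P'.V" "w \<in> P'.V" using over(2) by blast+
    then show "u \<oplus> w \<otimes> \<alpha> \<in> P'.V" using aV' by blast
  next
    assume z: "u \<oplus> w \<otimes> \<alpha> \<in> P'.V"
    have uwc: "u \<in> K'" "w \<in> K'" "u \<in> carrier R" "w \<in> carrier R" using uw K_sub by auto
    show "u \<in> P.V \<and> w \<in> P.V"
    proof (cases "w = \<zero>")
      case True
      then have "u \<in> P'.V" using z uwc alpha(1) by simp
      then show ?thesis using True place_restrict(2)[OF P'(1)] over(1) uw by auto
    next
      case w0: False
      have wa: "w \<otimes> \<alpha> \<in> K'" "w \<otimes> \<alpha> \<noteq> \<zero>" "P'.v (w \<otimes> \<alpha>) = 2 * (m * P.v w) + m"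
        using P'.v_mult[OF uwc(2) w0 alpha_K'] es vu(1)[OF uw(2) w0] uwc alpha_K' alpha(1) w0 integral[of w \<alpha>]
        by (auto simp: m_def)
      show ?thesis
      proof (cases "u = \<zero>")
        case True
        then have "w \<otimes> \<alpha> \<in> P'.V" using z wa(1) by simp
        then have "P.v w \<ge> 0" using P'.v_nonneg_iff[OF wa(1,2)] wa(3) pos2 by simp
        then show ?thesis using True vu(2)[OF uw(2) w0] P.V_closed(1) by simp
      next
        case u0: False
        \<comment> \<open>Equality would say 2 (v(u) - v(w)) = 1, after division by m.\<close>
        have ne: "P'.v u \<noteq> P'.v (w \<otimes> \<alpha>)"
        proof
          assume "P'.v u = P'.v (w \<otimes> \<alpha>)"
          then have "2 * (m * P.v u) = 2 * (m * P.v w) + m" using vu(1)[OF uw(1) u0] wa(3) by simp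
          then have "m * (2 * (P.v u - P.v w)) = m * 1" by (simp add: algebra_simps)
          then have "2 * (P.v u - P.v w) = 1" using em(2) by (subst (asm) mult_left_cancel) auto
          then show False by presburger
        qed
        have "P'.v u \<ge> 0 \<and> P'.v (w \<otimes> \<alpha>) \<ge> 0"
        proof (cases "P'.v u < P'.v (w \<otimes> \<alpha>)")
          case True
          note s = P'.v_add_strict[OF uwc(1) u0 wa(1,2) True]
          have "P'.v u \<ge> 0" using P'.v_nonneg_iff[of "u \<oplus> w \<otimes> \<alpha>"] s z uwc wa by auto
          then show ?thesis using True by linarith
        next
          case False
          then have lt: "P'.v (w \<otimes> \<alpha>) < P'.v u" using ne by linarith
          note s = P'.v_add_strict[OF wa(1,2) uwc(1) u0 lt]
          have "u \<oplus> w \<otimes> \<alpha> = w \<otimes> \<alpha> \<oplus> u" using uwc wa alpha(1) by (simp add: a_comm)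
          then have "P'.v (w \<otimes> \<alpha>) \<ge> 0" using P'.v_nonneg_iff[of "w \<otimes> \<alpha> \<oplus> u"] s z uwc wa by auto
          then show ?thesis using lt by linarith
        qed
        then have "P.v u \<ge> 0" "P.v w \<ge> 0" using vu(1)[OF uw(1) u0] wa(3) pos pos2 by auto
        then show ?thesis using vu(2) uw u0 w0 by blast
      qed
    qed
  qed
qed

lemma place_eqI: "P \<in> places k K' \<Longrightarrow> Q \<in> places k K' \<Longrightarrow> place_ring K' P = place_ring K' Q \<Longrightarrow> P = Q"
  using E.place_ring_subset_imp_eq by simp

text \<open>The integral basis describes the ring of any place above \<open>P\<close> in terms of
  \<open>P\<close> alone.\<close>

lemma ramified_unique:
  assumes P: "P \<in> places k K" "a \<in> P" "b \<noteq> \<zero>" "place_val K P b = 1"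
    and P1: "P1 \<in> places k K'" "P \<subseteq> P1" and P2: "P2 \<in> places k K'" "P \<subseteq> P2"
  shows "P1 = P2"
proof (rule place_eqI[OF P1(1) P2(1)], intro Set.set_eqI)
  fix z
  show "z \<in> place_ring K' P1 \<longleftrightarrow> z \<in> place_ring K' P2"
  proof (cases "z \<in> K'")
    case True
    then obtain u w where c: "u \<in> K" "w \<in> K" "z = u \<oplus> w \<otimes> \<alpha>" by (metis K'E)
    show ?thesis unfolding c(3) using ramified_place(2)[OF P P1 c(1,2)] ramified_place(2)[OF P P2 c(1,2)] by simp
  next
    case False
    then show ?thesis by (auto simp: place_ring_def)
  qed
qed

lemma ramified_rational:
  assumes P: "P \<in> places k K" "a \<in> P" "b \<noteq> \<zero>" "place_val K P b = 1"
    and P': "P' \<in> places k K'" "P \<subseteq> P'" and d: "place_degree k K P = 1"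
  shows "place_degree k K' P' = 1"
proof -
  interpret P: place R k K P using placeI[OF P(1)] .
  interpret P': place R k K' P' using E.placeI[OF P'(1)] .
  note over = place_over_inter[OF E_ff K_sub P(1) P']
  show ?thesis unfolding P'.deg_one_iff
  proof
    fix z assume z: "z \<in> P'.V"
    then obtain u w where c: "u \<in> K" "w \<in> K" "z = u \<oplus> w \<otimes> \<alpha>" by (metis P'.V_K K'E)
    have uw: "u \<in> P.V" "w \<in> P.V" using ramified_place(2)[OF P P' c(1,2)] z c(3) by blast+
    obtain d where d: "d \<in> k" "u \<ominus> d \<in> P" using uw(1) assms(7) P.deg_one_iff by blast
    have cc: "u \<in> carrier R" "w \<in> carrier R" "d \<in> carrier R" using c d by auto
    have "z \<ominus> d = (u \<ominus> d) \<oplus> w \<otimes> \<alpha>" unfolding c(3) using cc alpha(1) by algebra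
    moreover have "w \<otimes> \<alpha> \<in> P'" using ramified_place(3)[OF P P'] over(2) uw(2) P'.P_smult by blast
    moreover have "u \<ominus> d \<in> P'" using d P'(2) by blast
    ultimately have "z \<ominus> d \<in> P'" using P'.P_closed(2) by simp
    then show "\<exists>c\<in>k. z \<ominus> c \<in> P'" using d by blast
  qed
qed

text \<open>A preimage, which is also the image because \<open>conj\<close> is an
  involution.\<close>

definition conj_place :: "'a set \<Rightarrow> 'a set" where
  "conj_place P' = {z \<in> K'. conj z \<in> P'}"

lemma conj_inv: "z \<in> K' \<Longrightarrow> z \<noteq> \<zero> \<Longrightarrow> conj (inv z) = inv (conj z) \<and> conj z \<noteq> \<zero>"
proof -
  assume z: "z \<in> K'" "z \<noteq> \<zero>"
  note iz = inv_nonzero[OF K'_carrier[OF z(1)] z(2)]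
  have iK: "inv z \<in> K'" using E.K_closed(7)[OF z] .
  have c0: "conj z \<noteq> \<zero>" using conj_conj[OF z(1)] conj_K[of \<zero>] z by auto
  have "conj z \<otimes> conj (inv z) = \<one>" using conj_mult[OF z(1) iK] iz conj_K[of \<one>] by simp
  then have "inv (conj z) = conj (inv z)"
    using conj_K'[OF z(1)] conj_K'[OF iK] K'_carrier by (intro comm_inv_char) auto
  then show ?thesis using c0 by simp
qed

lemma conj_place:
  assumes P': "P' \<in> places k K'"
  shows "conj_place P' \<in> places k K'" and "place_ring K' (conj_place P') = {z \<in> K'. conj z \<in> place_ring K' P'}"
proof -
  interpret P: place R k K' P' using E.placeI[OF P'] .
  let ?W = "{z \<in> K'. conj z \<in> P.V}"
  have uminus: "conj (\<ominus> z) = \<ominus> (conj z)" if z: "z \<in> K'" for z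
    using conj_mult[of "\<ominus> \<one>" z] conj_K[of "\<ominus> \<one>"] z K'_carrier[OF z] K'_carrier[OF conj_K'[OF z]] by (simp add: l_minus)
  have W: "subring ?W R"
    by (rule subringI) (use conj_K K_sub conj_add conj_mult uminus K'_carrier in \<open>auto\<close>)
  have "k \<subseteq> ?W" using conj_K K_sub k_K P.k_V by auto
  moreover obtain z where z: "z \<in> K" "z \<notin> k" using exists_nonconstant by blast
  note iz = inv_not_k[OF z]
  have "z \<in> P.V \<or> inv z \<in> P.V" using P.V_props(6)[of z] z K_sub iz by blast
  then have "z \<in> ?W \<or> inv z \<in> ?W" using conj_K z iz K_sub by auto
  then have "k \<noteq> ?W" using z iz by blast
  moreover have "?W \<noteq> K'"
  proof
    assume W: "?W = K'"
    have "K' \<subseteq> P.V"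
    proof
      fix x assume x: "x \<in> K'"
      then have "conj x \<in> ?W" using conj_K' W by blast
      then show "x \<in> P.V" using conj_conj[OF x] by simp
    qed
    then show False using P.V_props(4,5) by blast
  qed
  moreover have "x \<in> ?W \<or> inv x \<in> ?W" if x: "x \<in> K'" "x \<noteq> \<zero>" for x
    using P.V_props(6)[OF conj_K'[OF x(1)]] conj_inv[OF x] E.K_closed(7)[OF x] x by auto
  ultimately have VR: "valuation_ring k K' ?W" unfolding valuation_ring_def using W by blast
  have "nonunits ?W = conj_place P'"
  proof (intro Set.set_eqI)
    fix x show "x \<in> nonunits ?W \<longleftrightarrow> x \<in> conj_place P'"
    proof (cases "x \<in> K' \<and> x \<noteq> \<zero>")
      case True
      then show ?thesis unfolding mem_nonunits conj_place_def
        using conj_inv[of x] P.mem_P_iff[of "conj x"] E.K_closed(7)[of x] by auto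
    next
      case False
      then show ?thesis unfolding mem_nonunits conj_place_def
        using conj_K[of \<zero>] P.P_closed(1) P.V_closed(1) by auto
    qed
  qed
  then show "conj_place P' \<in> places k K'" "place_ring K' (conj_place P') = ?W"
    using E.nonunits_place[OF VR] by simp_all
qed

lemma conj_place_conj_place: "P' \<in> places k K' \<Longrightarrow> conj_place (conj_place P') = P'"
proof -
  assume P': "P' \<in> places k K'"
  interpret P: place R k K' P' using E.placeI[OF P'] .
  have "P' \<subseteq> K'" by blast
  then show ?thesis unfolding conj_place_def using conj_conj conj_K' by auto
qed

lemma conj_place_inter: "P' \<in> places k K' \<Longrightarrow> conj_place P' \<inter> K = P' \<inter> K"
  unfolding conj_place_def using conj_K K_sub by auto

lemma conj_place_rational:
  assumes P': "P' \<in> places k K'" and d: "place_degree k K' P' = 1"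
  shows "place_degree k K' (conj_place P') = 1"
proof -
  interpret P: place R k K' P' using E.placeI[OF P'] .
  interpret C: place R k K' "conj_place P'" using E.placeI[OF conj_place(1)[OF P']] .
  show ?thesis unfolding C.deg_one_iff
  proof
    fix z assume "z \<in> C.V"
    then have "z \<in> {z \<in> K'. conj z \<in> P.V}" by (simp only: conj_place(2)[OF P'])
    then have z: "z \<in> K'" "conj z \<in> P.V" by blast+
    then obtain c where c: "c \<in> k" "conj z \<ominus> c \<in> P'" using d P.deg_one_iff by blast
    have "\<ominus> c \<in> k" using c(1) by (rule k_closed(5))
    then have cK: "c \<in> K'" "\<ominus> c \<in> K'" "\<ominus> c \<in> K" using c(1) E.k_K k_K by blast+
    have "conj (z \<ominus> c) = conj z \<ominus> c" unfolding a_minus_def using conj_add[OF z(1) cK(2)] conj_K[OF cK(3)] by simp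
    moreover have "z \<ominus> c \<in> K'" using E.K_closed(6)[OF z(1) cK(1)] .
    ultimately have "z \<ominus> c \<in> conj_place P'" unfolding conj_place_def using c(2) by simp
    then show "\<exists>c\<in>k. z \<ominus> c \<in> conj_place P'" using c by blast
  qed
qed

text \<open>The product \<alpha> \<beta> = b vanishes at \<open>Q\<close> while the sum \<alpha> +
  \<beta> = a is a unit, so exactly one of the two roots vanishes above.\<close>

lemma split_place:
  assumes Q: "Q \<in> places k K" "a \<ominus> \<one> \<in> Q" "b \<in> Q" and Q': "Q' \<in> places k K'" "Q \<subseteq> Q'"
  shows "\<alpha> \<in> Q' \<and> \<beta> \<notin> Q' \<or> \<beta> \<in> Q' \<and> \<alpha> \<notin> Q'" and "\<alpha> \<in> place_ring K' Q'" and "\<beta> \<in> place_ring K' Q'"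
proof -
  interpret Q: place R k K Q using placeI[OF Q(1)] .
  interpret Q': place R k K' Q' using E.placeI[OF Q'(1)] .
  note over = place_over_inter[OF E_ff K_sub Q(1) Q']
  have "a \<oplus> \<zero> = \<one> \<oplus> (a \<ominus> \<one>)" using abc(1) by algebra
  then have "a = \<one> \<oplus> (a \<ominus> \<one>)" using abc(1) by simp
  then have a: "a \<in> Q.V - Q" using Q.one_plus_P[OF Q(2)] by metis
  have aV: "a \<in> Q'.V" "b \<in> Q'.V" using a over(2) Q(3) by blast+
  show al: "\<alpha> \<in> Q'.V" using alpha_integral[OF Q'(1) aV] .
  show be: "\<beta> \<in> Q'.V" unfolding \<beta>_def using al aV by blast
  have "\<alpha> \<otimes> \<beta> \<in> Q'" using alpha_beta(2) Q(3) Q'(2) by auto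
  then have "\<alpha> \<in> Q' \<or> \<beta> \<in> Q'" using Q'.unit_mult[of \<alpha> \<beta>] al be by blast
  moreover have "\<not> (\<alpha> \<in> Q' \<and> \<beta> \<in> Q')"
  proof
    assume "\<alpha> \<in> Q' \<and> \<beta> \<in> Q'"
    then have "\<alpha> \<oplus> \<beta> \<in> Q'" by blast
    then have "a \<in> Q' \<inter> K" using alpha_beta(1) ab by simp
    then show False using over(1) a by blast
  qed
  ultimately show "\<alpha> \<in> Q' \<and> \<beta> \<notin> Q' \<or> \<beta> \<in> Q' \<and> \<alpha> \<notin> Q'" by blast
qed

text \<open>
  If \<open>w\<close> is not integral at \<open>Q\<close>, then \<open>z = u + w \<alpha>\<close> is treated through
  \<open>z = w N(y) / conj y\<close> with \<open>y = u / w + \<alpha>\<close>, where \<open>conj y\<close> is a unit at \<open>Q'\<close>.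
\<close>

lemma split_cases:
  assumes Q: "Q \<in> places k K" "a \<ominus> \<one> \<in> Q" "b \<in> Q" and Q': "Q' \<in> places k K'" "Q \<subseteq> Q'" and al: "\<alpha> \<in> Q'"
    and z: "z \<in> place_ring K' Q'"
  obtains u w where "u \<in> place_ring K Q" "w \<in> place_ring K Q" "z = u \<oplus> w \<otimes> \<alpha>"
  | s r where "s \<in> Q" "r \<in> place_ring K Q" "z \<otimes> (s \<oplus> \<beta>) = r"
proof -
  interpret Q: place R k K Q using placeI[OF Q(1)] .
  interpret Q': place R k K' Q' using E.placeI[OF Q'(1)] .
  note over = place_over_inter[OF E_ff K_sub Q(1) Q']
  have res: "x \<in> Q.V" if "x \<in> Q'.V" "x \<in> K" for x using place_restrict(2)[OF Q'(1)] over(1) that by auto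
  note sp = split_place[OF Q Q']
  obtain u w where c: "u \<in> K" "w \<in> K" "z = u \<oplus> w \<otimes> \<alpha>" using z by (metis Q'.V_K K'E)
  have cc: "u \<in> carrier R" "w \<in> carrier R" using c by auto
  show thesis
  proof (cases "w \<in> Q.V")
    case True
    have "w \<otimes> \<alpha> \<in> Q'.V" using True over(2) sp(2) by blast
    then have "z \<ominus> w \<otimes> \<alpha> \<in> Q'.V" using z by blast
    moreover have "z \<ominus> w \<otimes> \<alpha> = u" unfolding c(3) using cc alpha(1) by algebra
    ultimately have "u \<in> Q.V" using res c(1) by simp
    then show thesis using that(1) True c(3) by blast
  next
    case False
    have w0: "w \<noteq> \<zero>" using False Q.V_closed(1) by metis
    have iw: "inv w \<in> Q" using Q.not_V_inv_P[OF c(2) False] .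
    note jw = inv_nonzero[OF cc(2) w0]
    have iwc: "inv w \<in> carrier R" "inv w \<in> K" using jw iw by auto
    define s where "s = u \<otimes> inv w"
    have sK: "s \<in> K" using c iwc by (simp add: s_def)
    have "z \<otimes> inv w = u \<otimes> inv w \<oplus> (w \<otimes> inv w) \<otimes> \<alpha>" unfolding c(3) using cc iwc(1) alpha(1) by algebra
    then have e: "z \<otimes> inv w = s \<oplus> \<alpha>" using jw alpha(1) by (simp add: s_def)
    have "inv w \<in> Q'" using iw Q'(2) by blast
    then have "z \<otimes> inv w \<in> Q'" using z by blast
    then have "(s \<oplus> \<alpha>) \<ominus> \<alpha> \<in> Q'" using e al by auto
    moreover have sc: "s \<in> carrier R" using sK by simp
    have "(s \<oplus> \<alpha>) \<ominus> \<alpha> = s" using sc alpha(1) by algebra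
    ultimately have sQ: "s \<in> Q" using over(1) sK by auto
    have sQ': "s \<in> Q'.V" using sQ Q'(2) by blast
    define r where "r = z \<otimes> (s \<oplus> \<beta>)"
    have rV: "r \<in> Q'.V" unfolding r_def using z sQ' sp(3) by blast
    have "z = w \<otimes> (s \<oplus> \<alpha>)"
    proof -
      have zc: "z \<in> carrier R" using z by auto
      have "w \<otimes> (z \<otimes> inv w) = (w \<otimes> inv w) \<otimes> z" using zc cc iwc(1) by algebra
      then show ?thesis using e jw zc by simp
    qed
    \<comment> \<open>r equals w times the norm of s + \<alpha>. It therefore lies in
      \<open>K\<close>, and being integral at Q' it is integral at \<open>Q\<close>.\<close>
    then have "r = w \<otimes> ((s \<oplus> \<alpha>) \<otimes> (s \<oplus> \<beta>))"
      unfolding r_def using cc sc alpha(1) abc(3) by (simp add: m_assoc)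
    also have "(s \<oplus> \<alpha>) \<otimes> (s \<oplus> \<beta>) = s \<otimes> s \<oplus> s \<otimes> \<one> \<otimes> a \<oplus> \<one> \<otimes> \<one> \<otimes> b"
      using norm_rep[OF sK K_closed(2)] alpha(1) abc(3) by simp
    also have "w \<otimes> \<dots> \<in> K" using c sK ab by auto
    finally have "r \<in> Q.V" using res rV by blast
    then show thesis by (rule that(2)[OF sQ _ r_def[symmetric]])
  qed
qed

lemma split_unit:
  assumes Q: "Q \<in> places k K" "a \<ominus> \<one> \<in> Q" "b \<in> Q" and Q': "Q' \<in> places k K'" "Q \<subseteq> Q'" and al: "\<alpha> \<in> Q'" and s: "s \<in> Q"
  shows "s \<oplus> \<beta> \<in> place_ring K' Q' - Q'"
proof -
  interpret Q': place R k K' Q' using E.placeI[OF Q'(1)] .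
  note sp = split_place[OF Q Q']
  have sQ: "s \<in> Q'" using s Q' by blast
  have "s \<oplus> \<beta> \<in> Q'.V" using sQ sp(3) by blast
  moreover have "s \<oplus> \<beta> \<notin> Q'"
  proof
    assume "s \<oplus> \<beta> \<in> Q'"
    then have "(s \<oplus> \<beta>) \<ominus> s \<in> Q'" using sQ by blast
    moreover have sc: "s \<in> carrier R" using sQ by auto
    have "(s \<oplus> \<beta>) \<ominus> s = \<beta>" using sc abc(3) by algebra
    ultimately show False using sp(1) al by simp
  qed
  ultimately show ?thesis by blast
qed

text \<open>Both forms provided by \<open>split_cases\<close> refer to Q1 only through \<alpha>
  being in it: u + w \<alpha>, or r / (s + \<beta>) with a denominator that is a unit at every such
  place. Hence Q2 admits the same elements.\<close>

lemma split_place_ring_subset: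
  assumes Q: "Q \<in> places k K" "a \<ominus> \<one> \<in> Q" "b \<in> Q"
    and Q1: "Q1 \<in> places k K'" "Q \<subseteq> Q1" "\<alpha> \<in> Q1" and Q2: "Q2 \<in> places k K'" "Q \<subseteq> Q2" "\<alpha> \<in> Q2"
  shows "Q1 = Q2"
proof (rule E.place_ring_subset_imp_eq[OF Q1(1) Q2(1)], rule subsetI)
  interpret Q1: place R k K' Q1 using E.placeI[OF Q1(1)] .
  interpret Q2: place R k K' Q2 using E.placeI[OF Q2(1)] .
  note over = place_over_inter(2)[OF E_ff K_sub Q(1) Q2(1,2)]
  fix z assume z: "z \<in> Q1.V"
  show "z \<in> Q2.V"
  proof (rule split_cases[OF Q Q1(1,2,3) z])
    fix u w assume "u \<in> place_ring K Q" "w \<in> place_ring K Q" "z = u \<oplus> w \<otimes> \<alpha>"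
    then show ?thesis using over Q2(3) by blast
  next
    fix s r assume sr: "s \<in> Q" "r \<in> place_ring K Q" "z \<otimes> (s \<oplus> \<beta>) = r"
    have u: "s \<oplus> \<beta> \<in> Q2.V - Q2" using split_unit[OF Q Q2 sr(1)] .
    note iu = Q2.unit_inv[OF u]
    have nz: "s \<oplus> \<beta> \<noteq> \<zero>" using u Q2.P_closed(1) by (metis DiffD2)
    have c: "z \<in> carrier R" "s \<oplus> \<beta> \<in> carrier R" "inv (s \<oplus> \<beta>) \<in> carrier R" using z u iu by auto
    have "z = (z \<otimes> (s \<oplus> \<beta>)) \<otimes> inv (s \<oplus> \<beta>)" using c inv_nonzero[OF c(2) nz] by (simp add: m_assoc)
    also have "\<dots> = r \<otimes> inv (s \<oplus> \<beta>)" using sr(3) by simp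
    also have "\<dots> \<in> Q2.V" using over sr(2) iu by blast
    finally show ?thesis .
  qed
qed

text \<open>Every regular z is congruent to an element of \<open>K\<close> regular at
  \<open>Q\<close>, so the residue field does not grow.\<close>

lemma split_rational:
  assumes Q: "Q \<in> places k K" "a \<ominus> \<one> \<in> Q" "b \<in> Q" and d: "place_degree k K Q = 1"
    and Q': "Q' \<in> places k K'" "Q \<subseteq> Q'" "\<alpha> \<in> Q'"
  shows "place_degree k K' Q' = 1"
proof -
  interpret Q: place R k K Q using placeI[OF Q(1)] .
  interpret Q': place R k K' Q' using E.placeI[OF Q'(1)] .
  note over = place_over_inter(2)[OF E_ff K_sub Q(1) Q'(1,2)]
  show ?thesis unfolding Q'.deg_one_iff
  proof
    fix z assume z: "z \<in> Q'.V"
    have zc: "z \<in> carrier R" using z by auto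
    have "\<exists>x\<in>Q.V. z \<ominus> x \<in> Q'"
    proof (rule split_cases[OF Q Q'(1,2,3) z])
      fix u w assume c: "u \<in> Q.V" "w \<in> Q.V" "z = u \<oplus> w \<otimes> \<alpha>"
      have "u \<in> carrier R" "w \<in> carrier R" using c by auto
      then have "z \<ominus> u = w \<otimes> \<alpha>" unfolding c(3) using alpha(1) by algebra
      moreover have "w \<otimes> \<alpha> \<in> Q'" using c(2) over Q'(3) by blast
      ultimately show ?thesis using c(1) by (intro bexI[of _ u]) simp_all
    next
      fix s r assume sr: "s \<in> Q" "r \<in> Q.V" "z \<otimes> (s \<oplus> \<beta>) = r"
      have sc: "s \<in> carrier R" using sr by auto
      have "z \<ominus> r = z \<otimes> (\<one> \<ominus> (s \<oplus> \<beta>))" unfolding sr(3)[symmetric] using sc zc abc(3) by algebra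
      \<comment> \<open>Since \<alpha> and s vanish and a is congruent to 1, the denominator s +
        \<beta> is congruent to 1 and z to r.\<close>
      also have "\<one> \<ominus> (s \<oplus> \<beta>) = (\<alpha> \<ominus> s) \<ominus> (a \<ominus> \<one>)" unfolding \<beta>_def using sc abc(1) alpha(1) by algebra
      also have "z \<otimes> \<dots> \<in> Q'" using z sr(1) Q(2) Q' by blast
      finally show ?thesis using sr(2) by blast
    qed
    then obtain x where x: "x \<in> Q.V" "z \<ominus> x \<in> Q'" by blast
    obtain c where c: "c \<in> k" "x \<ominus> c \<in> Q" using x(1) d Q.deg_one_iff by blast
    have cc: "x \<in> carrier R" "c \<in> carrier R" using x c by auto
    have "z \<ominus> c = (z \<ominus> x) \<oplus> (x \<ominus> c)" using zc cc by algebra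
    also have "\<dots> \<in> Q'" using x(2) c(2) Q'(2) by blast
    finally show "\<exists>c\<in>k. z \<ominus> c \<in> Q'" using c(1) by blast
  qed
qed

text \<open>A place above \<open>Q\<close> is determined by which of \<alpha>, \<beta> vanishes
  there, and conjugation interchanges the two possibilities.\<close>

lemma split_fibre:
  assumes Q: "Q \<in> places k K" "a \<ominus> \<one> \<in> Q" "b \<in> Q" and d: "place_degree k K Q = 1"
  shows "card {Q' \<in> places k K'. Q \<subseteq> Q' \<and> place_degree k K' Q' = 1} = 2"
proof -
  have inter: "Q' \<inter> K = Q" if "Q' \<in> places k K'" "Q \<subseteq> Q'" for Q'
    using place_over_inter(1)[OF E_ff K_sub Q(1) that] .
  have cp: "conj_place Q' \<in> places k K' \<and> Q \<subseteq> conj_place Q'" if "Q' \<in> places k K'" "Q \<subseteq> Q'" for Q'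
    using conj_place(1)[OF that(1)] conj_place_inter[OF that(1)] inter[OF that] by blast
  have sw: "\<beta> \<in> Q' \<Longrightarrow> \<alpha> \<in> conj_place Q'" for Q'
    unfolding conj_place_def using alpha_K' conj_alpha by simp
  have sw': "\<alpha> \<in> Q' \<Longrightarrow> \<beta> \<in> conj_place Q'" for Q'
    unfolding conj_place_def using beta_K' conj_beta by simp
  obtain Q0 where Q0: "Q0 \<in> places k K'" "Q \<subseteq> Q0" using exists_place_over[OF Q(1)] by blast
  obtain A where A: "A \<in> places k K'" "Q \<subseteq> A" "\<alpha> \<in> A"
  proof (cases "\<alpha> \<in> Q0")
    case False
    then have "\<beta> \<in> Q0" using split_place(1)[OF Q Q0] by blast
    then show thesis using that[of "conj_place Q0"] cp[OF Q0] sw by blast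
  qed (use that Q0 in blast)
  have Ad: "place_degree k K' A = 1" using split_rational[OF Q d A] .
  have ne: "A \<noteq> conj_place A" using sw'[OF A(3)] split_place(1)[OF Q A(1,2)] A(3) by blast
  have "{Q' \<in> places k K'. Q \<subseteq> Q' \<and> place_degree k K' Q' = 1} = {A, conj_place A}"
  proof (intro Set.equalityI subsetI)
    fix B assume "B \<in> {Q' \<in> places k K'. Q \<subseteq> Q' \<and> place_degree k K' Q' = 1}"
    then have B: "B \<in> places k K'" "Q \<subseteq> B" by auto
    show "B \<in> {A, conj_place A}"
    proof (cases "\<alpha> \<in> B")
      case True
      then show ?thesis using split_place_ring_subset[OF Q A B] by simp
    next
      case False
      then have "\<beta> \<in> B" using split_place(1)[OF Q B] by blast
      then have "conj_place B = A" using split_place_ring_subset[OF Q _ _ _ A, of "conj_place B"] cp[OF B] sw by blast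
      then show ?thesis using conj_place_conj_place[OF B(1)] by auto
    qed
  next
    fix B assume "B \<in> {A, conj_place A}"
    then show "B \<in> {Q' \<in> places k K'. Q \<subseteq> Q' \<and> place_degree k K' Q' = 1}"
      using A Ad cp[OF A(1,2)] conj_place_rational[OF A(1) Ad] by blast
  qed
  then show ?thesis using ne by simp
qed

text \<open>Rational places restrict to rational ones, so the count runs over fibres: 1 over a
  rational \<open>P\<close>, 2 elsewhere. The correction stands on the left to avoid subtraction of
  natural numbers.\<close>

lemma card_rational_K':
  assumes fin: "finite {Q \<in> places k K. place_degree k K Q = 1}"
    and P: "P \<in> places k K" "a \<in> P" "b \<noteq> \<zero>" "place_val K P b = 1"
    and sp: "\<And>Q. Q \<in> places k K \<Longrightarrow> place_degree k K Q = 1 \<Longrightarrow> Q \<noteq> P \<Longrightarrow> a \<ominus> \<one> \<in> Q \<and> b \<in> Q"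
  shows "num_rational_places k K' + (if place_degree k K P = 1 then 1 else 0) = 2 * num_rational_places k K"
proof -
  let ?N = "{Q \<in> places k K. place_degree k K Q = 1}"
  let ?F = "\<lambda>Q. {Q' \<in> places k K'. Q \<subseteq> Q' \<and> place_degree k K' Q' = 1}"
  have cP: "card (?F P) = 1" if d: "place_degree k K P = 1"
  proof -
    obtain P' where P': "P' \<in> places k K'" "P \<subseteq> P'" using exists_place_over[OF P(1)] by blast
    have "?F P = {P'}" using ramified_unique[OF P P'] ramified_rational[OF P P' d] P' by blast
    then show ?thesis by simp
  qed
  have cQ: "card (?F Q) = 2" if "Q \<in> ?N" "Q \<noteq> P" for Q
    using split_fibre[of Q] sp[of Q] that by blast
  have "{Q' \<in> places k K'. place_degree k K' Q' = 1} = (\<Union>Q\<in>?N. ?F Q)"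
  proof (intro Set.equalityI subsetI)
    fix Q' assume "Q' \<in> {Q' \<in> places k K'. place_degree k K' Q' = 1}"
    then have Q': "Q' \<in> places k K'" "place_degree k K' Q' = 1" by auto
    have "Q' \<inter> K \<in> ?N" using place_restrict(1)[OF Q'(1)] rational_restrict[OF Q'] by blast
    moreover have "Q' \<in> ?F (Q' \<inter> K)" using Q' by blast
    ultimately show "Q' \<in> (\<Union>Q\<in>?N. ?F Q)" by (rule UN_I)
  qed auto
  moreover have "card (\<Union>Q\<in>?N. ?F Q) = (\<Sum>Q\<in>?N. card (?F Q))"
  proof (rule card_UN_disjoint[OF fin])
    show "\<forall>Q\<in>?N. finite (?F Q)"
    proof
      fix Q assume Q: "Q \<in> ?N"
      have "card (?F Q) \<noteq> 0" using cP cQ[OF Q] Q by (cases "Q = P") auto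
      then have "card (?F Q) > 0" by (rule neq0_conv[THEN iffD1])
      then show "finite (?F Q)" by (rule card_ge_0_finite)
    qed
    show "\<forall>Q\<in>?N. \<forall>Q2\<in>?N. Q \<noteq> Q2 \<longrightarrow> ?F Q \<inter> ?F Q2 = {}"
    proof (intro ballI impI, rule ccontr)
      fix Q Q2 assume Q: "Q \<in> ?N" "Q2 \<in> ?N" "Q \<noteq> Q2" "?F Q \<inter> ?F Q2 \<noteq> {}"
      then obtain S where S: "S \<in> places k K'" "Q \<subseteq> S" "Q2 \<subseteq> S" by blast
      have QP: "Q \<in> places k K" "Q2 \<in> places k K" using Q(1,2) by blast+
      have "S \<inter> K = Q" "S \<inter> K = Q2"
        using place_over_inter(1)[OF E_ff K_sub QP(1) S(1,2)] place_over_inter(1)[OF E_ff K_sub QP(2) S(1,3)] by blast+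
      then show False using Q(3) by simp
    qed
  qed
  ultimately have e: "num_rational_places k K' = (\<Sum>Q\<in>?N. card (?F Q))" by (simp add: num_rational_places_def)
  show ?thesis
  proof (cases "place_degree k K P = 1")
    case True
    then have PN: "P \<in> ?N" using P by blast
    have "(\<Sum>Q\<in>?N. card (?F Q)) = card (?F P) + (\<Sum>Q\<in>?N - {P}. card (?F Q))" by (rule sum.remove[OF fin PN])
    also have "(\<Sum>Q\<in>?N - {P}. card (?F Q)) = (\<Sum>Q\<in>?N - {P}. 2)" by (rule sum.cong[OF refl]) (use cQ in blast)
    also have "\<dots> = 2 * (card ?N - 1)" using card_Diff_singleton[OF PN] by simp
    finally have "(\<Sum>Q\<in>?N. card (?F Q)) = 1 + 2 * (card ?N - 1)" using cP[OF True] by simp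
    moreover have "card ?N \<ge> 1" using PN fin by (metis One_nat_def Suc_leI card_gt_0_iff empty_iff)
    ultimately show ?thesis using e True by (simp add: num_rational_places_def)
  next
    case False
    have "(\<Sum>Q\<in>?N. card (?F Q)) = (\<Sum>Q\<in>?N. 2)" by (rule sum.cong[OF refl]) (use cQ False in blast)
    then show ?thesis using e False by (simp add: num_rational_places_def)
  qed
qed

end

section \<open>Embedding a function field into an algebraically closed field\<close>

text \<open>The given field is its own ambient ring, whereas the tower needs an ambient field with
  roots of quadratic polynomials. Everything is transported along an embedding
  \<open>h\<close>.\<close>

locale function_field_embedding = F: finite_function_field F k "carrier F" + S: field S
  for F (structure) and S (structure) and k +
  fixes h
  assumes hom: "h \<in> ring_hom F S"

sublocale function_field_embedding \<subseteq> h: ring_hom_ring F S h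
  by (rule ring_hom_ringI2[OF F.ring_axioms S.ring_axioms hom])

context function_field_embedding
begin

lemma inj_h: "inj_on h (carrier F)"
  using non_trivial_field_hom_is_inj[OF hom F.field_axioms S.field_axioms] .

lemma h_zero_iff: "x \<in> carrier F \<Longrightarrow> h x = \<zero>\<^bsub>S\<^esub> \<longleftrightarrow> x = \<zero>\<^bsub>F\<^esub>"
  using inj_onD[OF inj_h, of x "\<zero>\<^bsub>F\<^esub>"] by auto

lemma h_inv: "x \<in> carrier F \<Longrightarrow> x \<noteq> \<zero>\<^bsub>F\<^esub> \<Longrightarrow> h (inv\<^bsub>F\<^esub> x) = inv\<^bsub>S\<^esub> (h x)"
proof -
  assume x: "x \<in> carrier F" "x \<noteq> \<zero>\<^bsub>F\<^esub>"
  note i = F.inv_nonzero[OF x]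
  have "h x \<otimes>\<^bsub>S\<^esub> h (inv\<^bsub>F\<^esub> x) = h (x \<otimes>\<^bsub>F\<^esub> inv\<^bsub>F\<^esub> x)" by (rule h.hom_mult[symmetric]) (use x i in auto)
  also have "\<dots> = \<one>\<^bsub>S\<^esub>" using i h.hom_one by simp
  finally show ?thesis using S.comm_inv_char[of "h x" "h (inv\<^bsub>F\<^esub> x)"] x i h.hom_closed by auto
qed

lemma subfield_image: "subfield E F \<Longrightarrow> subfield (h ` E) S"
  using h.img_is_subfield(2) S.one_not_zero by blast

lemma generate_field_image:
  assumes H: "H \<subseteq> carrier F"
  shows "h ` generate_field F H = generate_field S (h ` H)"
proof
  have HS: "h ` H \<subseteq> carrier S" using H h.hom_closed by auto
  have c: "x \<in> generate_field F H \<Longrightarrow> x \<in> carrier F" for x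
    using F.generate_field_in_carrier[OF H] .
  have "x \<in> generate_field F H \<Longrightarrow> h x \<in> generate_field S (h ` H)" for x
  proof (induct rule: generate_field.induct)
    case one
    then show ?case using generate_field.one[of S] by simp
  next
    case (incl x)
    then show ?case by (intro generate_field.incl) simp
  next
    case (a_inv x)
    then show ?case using generate_field.a_inv[of "h x" S] c by simp
  next
    case (m_inv x)
    then show ?case using generate_field.m_inv[of "h x" S] c h_inv h_zero_iff by simp
  next
    case (eng_add x y)
    then show ?case using generate_field.eng_add[of "h x" S] c by simp
  next
    case (eng_mult x y)
    then show ?case using generate_field.eng_mult[of "h x" S] c by simp
  qed
  then show "h ` generate_field F H \<subseteq> generate_field S (h ` H)" by blast
  show "generate_field S (h ` H) \<subseteq> h ` generate_field F H"
  proof (rule S.generate_field_min_subfield1[OF HS subfield_image[OF F.generate_field_is_subfield[OF H]]])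
    show "h ` H \<subseteq> h ` generate_field F H" by (rule image_mono) (auto intro: generate_field.incl)
  qed
qed

text \<open>The coefficients of an annihilating polynomial are lifted along \<open>h\<close>. This
  direction is needed for transcendence of the image of x and for the field of constants.\<close>

lemma algebraic_pullback:
  assumes E: "subfield E F" and x: "x \<in> carrier F" and alg: "(S.algebraic over (h ` E)) (h x)"
  shows "(F.algebraic over E) x"
proof -
  have Ec: "E \<subseteq> carrier F" using subfieldE(3)[OF E] .
  obtain p where p: "p \<in> carrier (univ_poly S (h ` E))" "p \<noteq> []" "S.eval p (h x) = \<zero>\<^bsub>S\<^esub>"
    using S.algebraicE[OF subfieldE(1)[OF subfield_image[OF E]] _ alg] x h.hom_closed by blast
  then have pol: "polynomial\<^bsub>S\<^esub> (h ` E) p" by (simp add: univ_poly_carrier)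
  have sp: "set p \<subseteq> h ` E" "lead_coeff p \<noteq> \<zero>\<^bsub>S\<^esub>" using pol p(2) by (auto simp: polynomial_def)
  define q where "q = map (inv_into E h) p"
  have pq: "map h q = p" unfolding q_def using sp(1)
    by (induct p) (auto simp: f_inv_into_f)
  have qE: "set q \<subseteq> E" unfolding q_def using sp(1) by (auto intro: inv_into_into)
  have q0: "q \<noteq> []" using p(2) by (simp add: q_def)
  have "h (hd q) = hd p" using pq q0 by (metis hd_map)
  then have "hd q \<noteq> \<zero>\<^bsub>F\<^esub>" using sp(2) by auto
  then have "q \<in> carrier (univ_poly F E)" using qE q0 by (simp add: univ_poly_carrier[symmetric] polynomial_def)
  moreover have "h (F.eval q x) = \<zero>\<^bsub>S\<^esub>" using h.eval_hom'[OF x, of q] qE Ec pq p(3) by auto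
  then have "F.eval q x = \<zero>\<^bsub>F\<^esub>" using h_zero_iff F.eval_in_carrier[OF _ x, of q] qE Ec by auto
  ultimately show ?thesis using F.algebraicI q0 by blast
qed

lemma function_field_image: "S.function_field (h ` k) (h ` carrier F)"
proof -
  note ff = F.ff[unfolded F.function_field_def]
  obtain T where T: "finite T" "T \<subseteq> carrier F" "carrier F = generate_field F (k \<union> T)" using ff by blast
  obtain x where x: "x \<in> carrier F" "(F.transcendental over k) x"
    "\<And>y. y \<in> carrier F \<Longrightarrow> (F.algebraic over (generate_field F (insert x k))) y" using ff by blast
  have kc: "k \<subseteq> carrier F" using F.k_subset_K .
  have "h ` carrier F = generate_field S (h ` k \<union> h ` T)"
  proof -
    have "k \<union> T \<subseteq> carrier F" using kc T(2) by blast
    then have "h ` generate_field F (k \<union> T) = generate_field S (h ` (k \<union> T))" by (rule generate_field_image)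
    then show ?thesis by (simp only: T(3)[symmetric] image_Un)
  qed
  moreover have "(S.transcendental over (h ` k)) (h x)"
  proof (rule ccontr)
    assume "\<not> (S.transcendental over (h ` k)) (h x)"
    then have "(S.algebraic over (h ` k)) (h x)" by (simp add: over_def)
    then have "(F.algebraic over k) x" by (rule algebraic_pullback[OF F.subfield_k x(1)])
    then show False using x(2) by (simp add: over_def)
  qed
  moreover have "(S.algebraic over (generate_field S (insert (h x) (h ` k)))) y" if y: "y \<in> h ` carrier F" for y
  proof -
    obtain z where z: "z \<in> carrier F" "y = h z" using y by blast
    have i: "insert x k \<subseteq> carrier F" using x(1) kc by blast
    have "(S.algebraic over (h ` generate_field F (insert x k))) (h z)"
      by (rule algebraic_hom[OF hom F.field_axioms S.field_axioms F.generate_field_is_subfield[OF i] z(1) x(3)[OF z(1)]])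
    then show ?thesis unfolding z(2) generate_field_image[OF i] by simp
  qed
  moreover have "y \<in> h ` k" if y: "y \<in> h ` carrier F" "(S.algebraic over (h ` k)) y" for y
  proof -
    obtain z where z: "z \<in> carrier F" "y = h z" using y by blast
    have "(F.algebraic over k) z" using algebraic_pullback[OF F.subfield_k z(1)] y(2) z(2) by simp
    then have "z \<in> k" using F.transcendental_k[OF z(1)] by (auto simp: over_def)
    then show ?thesis using z(2) by blast
  qed
  moreover have "finite (h ` T)" "h ` T \<subseteq> h ` carrier F" "h ` k \<subseteq> h ` carrier F" "h x \<in> h ` carrier F"
    using T kc x(1) by auto
  ultimately show ?thesis unfolding S.function_field_def
    using subfield_image[OF F.subfield_k] subfield_image[OF F.subfield_K] by blast
qed

lemma finite_function_field_image: "finite_function_field S (h ` k) (h ` carrier F)"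
  by unfold_locales (use function_field_image F.finite_k in auto)

text \<open>A single rational place has to be carried over; genus, counts and ramification are
  studied only in the image.\<close>

lemma rational_place_image:
  assumes P: "P \<in> F.places k (carrier F)" "F.place_degree k (carrier F) P = 1"
  shows "h ` P \<in> S.places (h ` k) (h ` carrier F)" "S.place_degree (h ` k) (h ` carrier F) (h ` P) = 1"
proof -
  interpret P: place F k "carrier F" P using F.placeI[OF P(1)] .
  interpret G: finite_function_field S "h ` k" "h ` carrier F" using finite_function_field_image .
  have mem: "h x \<in> h ` A \<longleftrightarrow> x \<in> A" if "x \<in> carrier F" "A \<subseteq> carrier F" for x A
    using inj_on_image_mem_iff[OF inj_h that] .
  have Vc: "P.V \<subseteq> carrier F" and kc: "k \<subseteq> carrier F" using P.V_props(4) F.k_subset_K by blast+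
  have Pc: "P \<subseteq> carrier F" using Vc P.P_V by blast
  have VR: "S.valuation_ring (h ` k) (h ` carrier F) (h ` P.V)"
    unfolding S.valuation_ring_def
  proof (intro conjI)
    show "subring (h ` P.V) S" using h.img_is_subring[OF P.V_props(1)] .
    show "h ` k \<subset> h ` P.V"
      using P.V_props(2,3) inj_on_image_eq_iff[OF inj_h kc Vc] by blast
    show "h ` P.V \<subset> h ` carrier F"
      using P.V_props(4,5) inj_on_image_eq_iff[OF inj_h Vc subset_refl] by blast
    show "\<forall>z\<in>h ` carrier F - {\<zero>\<^bsub>S\<^esub>}. z \<in> h ` P.V \<or> inv\<^bsub>S\<^esub> z \<in> h ` P.V"
    proof
      fix z assume "z \<in> h ` carrier F - {\<zero>\<^bsub>S\<^esub>}"
      then obtain x where x: "x \<in> carrier F" "z = h x" "x \<noteq> \<zero>\<^bsub>F\<^esub>" using h_zero_iff by blast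
      then show "z \<in> h ` P.V \<or> inv\<^bsub>S\<^esub> z \<in> h ` P.V"
        using P.V_props(6)[OF x(1,3)] h_inv[OF x(1,3)] by (metis image_eqI)
    qed
  qed
  have nu: "S.nonunits (h ` P.V) = h ` P"
  proof (intro Set.equalityI subsetI)
    fix z assume "z \<in> S.nonunits (h ` P.V)"
    then have z: "z \<in> h ` P.V" "z = \<zero>\<^bsub>S\<^esub> \<or> inv\<^bsub>S\<^esub> z \<notin> h ` P.V" unfolding S.mem_nonunits by blast+
    then obtain x where x: "x \<in> P.V" "z = h x" by blast
    have xc: "x \<in> carrier F" using x(1) Vc by blast
    have "x \<in> P"
    proof (cases "x = \<zero>\<^bsub>F\<^esub>")
      case False
      then have "inv\<^bsub>S\<^esub> (h x) \<notin> h ` P.V" using z(2) x(2) h_zero_iff[OF xc] by simp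
      then have "inv\<^bsub>F\<^esub> x \<notin> P.V" using h_inv[OF xc False] by (metis image_eqI)
      then show ?thesis using P.mem_P_iff[of x] x(1) by blast
    qed (use P.P_closed(1) in simp)
    then show "z \<in> h ` P" using x(2) by blast
  next
    fix z assume "z \<in> h ` P"
    then obtain x where x: "x \<in> P" "z = h x" by blast
    have xc: "x \<in> carrier F" using x(1) Pc by blast
    have xV: "x \<in> P.V" "x = \<zero>\<^bsub>F\<^esub> \<or> inv\<^bsub>F\<^esub> x \<notin> P.V" using P.mem_P_iff[of x] x(1) by blast+
    have "inv\<^bsub>S\<^esub> z \<notin> h ` P.V" if "z \<noteq> \<zero>\<^bsub>S\<^esub>"
    proof -
      have x0: "x \<noteq> \<zero>\<^bsub>F\<^esub>" using that x(2) h_zero_iff[OF xc] by blast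
      then have "inv\<^bsub>F\<^esub> x \<in> carrier F" using F.inv_nonzero[OF xc] by blast
      then show ?thesis using mem[OF _ Vc, of "inv\<^bsub>F\<^esub> x"] xV(2) x0 h_inv[OF xc x0] x(2) by simp
    qed
    then show "z \<in> S.nonunits (h ` P.V)" unfolding S.mem_nonunits using x(2) xV(1) by blast
  qed
  show hP: "h ` P \<in> S.places (h ` k) (h ` carrier F)" using G.nonunits_place(1)[OF VR] nu by simp
  have Vh: "S.place_ring (h ` carrier F) (h ` P) = h ` P.V" using G.nonunits_place(2)[OF VR] nu by simp
  interpret Q: place S "h ` k" "h ` carrier F" "h ` P" using G.placeI[OF hP] .
  show "S.place_degree (h ` k) (h ` carrier F) (h ` P) = 1"
    unfolding Q.deg_one_iff
  proof
    fix z assume "z \<in> Q.V"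
    then obtain x where x: "x \<in> P.V" "z = h x" using Vh by blast
    then obtain c where c: "c \<in> k" "x \<ominus>\<^bsub>F\<^esub> c \<in> P" using P(2) P.deg_one_iff by blast
    have cc: "x \<in> carrier F" "c \<in> carrier F" using x(1) c(1) Vc kc by blast+
    have "h (x \<ominus>\<^bsub>F\<^esub> c) = z \<ominus>\<^bsub>S\<^esub> h c" unfolding x(2) a_minus_def using cc by simp
    then show "\<exists>c\<in>h ` k. z \<ominus>\<^bsub>S\<^esub> c \<in> h ` P" using c by (metis image_eqI)
  qed
qed

end

lemma (in algebraically_closed) exists_quadratic_root:
  assumes "a \<in> carrier L" "b \<in> carrier L"
  shows "\<exists>x\<in>carrier L. x \<otimes> x = a \<otimes> x \<ominus> b"
proof -
  let ?p = "[\<one>, \<ominus> a, b]"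
  have p: "?p \<in> carrier (poly_ring L)"
    using assms by (simp add: univ_poly_carrier[symmetric] polynomial_def)
  have "size (roots ?p) = 2" using roots_over_carrier[OF p] by (simp add: splitted_def)
  then obtain x where "x \<in># roots ?p" by fastforce
  then have "is_root ?p x" using roots_mem_iff_is_root[OF p] by simp
  then have x: "x \<in> carrier L" "x \<otimes> x \<oplus> (\<ominus> a \<otimes> x \<oplus> b) = \<zero>"
    using assms by (auto simp: is_root_def numeral_2_eq_2)
  have "x \<otimes> x = (x \<otimes> x \<oplus> (\<ominus> a \<otimes> x \<oplus> b)) \<oplus> (a \<otimes> x \<ominus> b)" using x(1) assms by algebra
  also have "\<dots> = a \<otimes> x \<ominus> b" unfolding x(2) using x(1) assms by simp
  finally show ?thesis using x(1) by blast
qed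

section \<open>The basic step of the tower\<close>

context finite_function_field
begin

text \<open>The two inequalities 2 N - 1 <= N' <= 2 N cover rational and nonrational ramified places
  alike. The last clause lets places be lifted through the tower.\<close>

definition tower_step :: "'a set \<Rightarrow> bool" where
  "tower_step M \<longleftrightarrow> K \<subset> M \<and> function_field_extension k K M \<and> dimension 2 K M \<and>
     num_rational_places k M \<le> 2 * num_rational_places k K \<and>
     2 * num_rational_places k K \<le> num_rational_places k M + 1 \<and>
     (\<forall>Q\<in>places k K. \<exists>Q'\<in>places k M. Q \<subseteq> Q')"

text \<open>The second place \<open>Q0\<close> has two duties: a is congruent to 1 there and hence
  nonzero, and \<open>Q0\<close> splits, which rules out new constants.\<close>

theorem exists_tower_step:
  assumes root: "\<And>a b. a \<in> carrier R \<Longrightarrow> b \<in> carrier R \<Longrightarrow> \<exists>x\<in>carrier R. x \<otimes> x = a \<otimes> x \<ominus> b"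
    and P: "P \<in> places k K" and Q0: "Q0 \<in> places k K" "pd Q0 = 1" "Q0 \<noteq> P"
  shows "\<exists>M. tower_step M \<and> num_rational_places k M + (if pd P = 1 then 1 else 0) = 2 * num_rational_places k K \<and>
    (\<exists>P'\<in>places k M. P \<subseteq> P' \<and> ramification_index K M P P' > 1)"
proof -
  let ?N = "{Q \<in> places k K. pd Q = 1}"
  have fin: "finite ?N" using rational_place_bound[OF Q0(1,2)] by blast
  interpret P: place R k K P using placeI[OF P] .
  interpret Q0: place R k K Q0 using placeI[OF Q0(1)] .
  have S: "finite (insert P ?N)" "insert P ?N \<subseteq> places k K" using fin P by auto
  \<comment> \<open>The trace a: congruent to 0 at \<open>P\<close> and to 1 at all other rational
    places.\<close>
  have "\<exists>x\<in>K. \<forall>Q\<in>insert P ?N. x \<ominus> (if Q = P then \<zero> else \<one>) \<in> val_ge Q 1"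
    by (rule weak_approximation[OF S]) auto
  then obtain a where a0: "a \<in> K" "\<And>Q. Q \<in> insert P ?N \<Longrightarrow> a \<ominus> (if Q = P then \<zero> else \<one>) \<in> val_ge Q 1" by blast
  have "a \<ominus> \<zero> \<in> val_ge P 1" using a0(2)[of P] by simp
  then have aP: "a \<in> val_ge P 1" using a0(1) by (simp add: a_minus_def)
  then have aP': "a \<in> P" using P.val_ge_1 by simp
  have aQ: "a \<ominus> \<one> \<in> Q" if "Q \<in> ?N" "Q \<noteq> P" for Q
    using a0(2)[of Q] that place.val_ge_1[OF placeI, of Q] by auto
  obtain t where t: "t \<in> K" "t \<noteq> \<zero>" "P.v t = 1" using P.exists_v by blast
  \<comment> \<open>The norm b: precision 2 makes its value at \<open>P\<close> exactly that of t,
    namely 1, while it vanishes at the other rational places.\<close>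
  have "\<exists>x\<in>K. \<forall>Q\<in>insert P ?N. x \<ominus> (if Q = P then t else \<zero>) \<in> val_ge Q 2"
    by (rule weak_approximation[OF S]) (use t in auto)
  then obtain b where b0: "b \<in> K" "\<And>Q. Q \<in> insert P ?N \<Longrightarrow> b \<ominus> (if Q = P then t else \<zero>) \<in> val_ge Q 2" by blast
  have bt: "b \<ominus> t \<in> val_ge P 2" using b0(2)[of P] by simp
  have bv: "b \<noteq> \<zero> \<and> P.v b = 1"
  proof (cases "b \<ominus> t = \<zero>")
    case True
    then have "b = t" using b0(1) t(1) by simp
    then show ?thesis using t by simp
  next
    case False
    have "P.v t < P.v (b \<ominus> t)" using bt False t(3) by (simp add: val_ge_def)
    note s = P.v_add_strict[OF t(1,2) K_closed(6)[OF b0(1) t(1)] False this]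
    have c: "b \<in> carrier R" "t \<in> carrier R" using b0 t by auto
    have "t \<oplus> (b \<ominus> t) = b" using c by algebra
    then show ?thesis using s t(3) by simp
  qed
  have bQ: "b \<in> Q" if Q: "Q \<in> ?N" "Q \<noteq> P" for Q
  proof -
    have "b \<ominus> \<zero> \<in> val_ge Q 2" using b0(2)[of Q] Q by simp
    then have "b \<in> val_ge Q 2" using b0(1) by (simp add: a_minus_def)
    then have "b \<in> val_ge Q 1" by (rule val_ge_mono) simp
    then show ?thesis using place.val_ge_1[OF placeI, of Q] Q by auto
  qed
  have Q0N: "Q0 \<in> ?N" using Q0 by blast
  have abc: "a \<in> carrier R" "b \<in> carrier R" using a0 b0 by auto
  have a_nz: "a \<noteq> \<zero>"
  proof
    assume "a = \<zero>"
    then have "\<ominus> \<one> \<in> Q0" using aQ[OF Q0N Q0(3)] by (simp add: a_minus_def)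
    then have "\<ominus> (\<ominus> \<one>) \<in> Q0" by (rule Q0.P_closed(3))
    then show False by simp
  qed
  obtain \<alpha> where al: "\<alpha> \<in> carrier R" "\<alpha> \<otimes> \<alpha> = a \<otimes> \<alpha> \<ominus> b" using root abc by blast
  have alK: "\<alpha> \<notin> K"
  proof
    assume "\<alpha> \<in> K"
    then have "2 * P.v \<alpha> = 1" using P.eisenstein[OF _ al(2) aP b0(1)] bv by simp
    then show False by presburger
  qed
  \<comment> \<open>A double root would satisfy 2 \<alpha> = a. In characteristic 2 this contradicts
    a being nonzero; otherwise it puts \<alpha> = a / 2 into \<open>K\<close>.\<close>
  have sep: "\<alpha> \<noteq> a \<ominus> \<alpha>"
  proof
    assume e: "\<alpha> = a \<ominus> \<alpha>"
    have "(\<one> \<oplus> \<one>) \<otimes> \<alpha> = \<alpha> \<oplus> \<alpha>" using al(1) by algebra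
    also have "\<dots> = (a \<ominus> \<alpha>) \<oplus> \<alpha>" using e by simp
    also have "\<dots> = a" using abc(1) al(1) by algebra
    finally have two: "(\<one> \<oplus> \<one>) \<otimes> \<alpha> = a" .
    show False
    proof (cases "\<one> \<oplus> \<one> = \<zero>")
      case True
      then show False using two a_nz al(1) by simp
    next
      case False
      have c: "\<one> \<oplus> \<one> \<in> carrier R" by simp
      note i = inv_nonzero[OF c False]
      have "\<alpha> = (inv (\<one> \<oplus> \<one>) \<otimes> (\<one> \<oplus> \<one>)) \<otimes> \<alpha>" using i al(1) by simp
      also have "\<dots> = inv (\<one> \<oplus> \<one>) \<otimes> ((\<one> \<oplus> \<one>) \<otimes> \<alpha>)" by (rule m_assoc) (use i al(1) in auto)
      also have "\<dots> = inv (\<one> \<oplus> \<one>) \<otimes> a" by (simp only: two)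
      also have "\<dots> \<in> K" by (intro K_closed(4,7) K_closed(3) K_closed(2) a0(1) False)
      finally show False using alK by simp
    qed
  qed
  interpret q: quadratic_extension R k K \<alpha> a b
    by unfold_locales (use al alK sep a0 b0 in auto)
  have ffM: "function_field k q.K'"
    by (rule q.function_field_K', rule q.constants_K'[OF Q0(1,2) aQ[OF Q0N Q0(3)] bQ[OF Q0N Q0(3)]])
  interpret q: quadratic_function_field R k K \<alpha> a b
    by unfold_locales (rule ffM)
  have ext: "function_field_extension k K q.K'"
    unfolding function_field_extension_def
    using ff ffM q.K_sub finite_dimensionI[OF q.dimension_K'] q.separable_K' by blast
  have num: "num_rational_places k q.K' + (if pd P = 1 then 1 else 0) = 2 * num_rational_places k K"
    by (rule q.card_rational_K'[OF fin P aP']) (use bv aQ bQ in auto)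
  obtain P' where P': "P' \<in> places k q.K'" "P \<subseteq> P'" using q.exists_place_over[OF P] by blast
  have ram: "ramification_index K q.K' P P' > 1"
    using q.ramified_place(1)[OF P aP' _ _ P'] bv by blast
  have "K \<subset> q.K'" using q.K_sub q.alpha_K' alK by blast
  then have "tower_step q.K'" unfolding tower_step_def
    using ext q.dimension_K' num q.exists_place_over by (auto split: if_splits)
  then show ?thesis using num P' ram by blast
qed

end

section \<open>Countability of the set of places\<close>

text \<open>The set is closed under the field operations in countably many rounds, each preserving
  countability. Inverting zero as well does no harm, as only an upper bound is wanted.\<close>

lemma countable_generate_field:
  assumes "countable H"
  shows "countable (generate_field R H)"
proof -
  define A where "A = rec_nat (insert \<one>\<^bsub>R\<^esub> H) (\<lambda>_ B. B \<union> (\<lambda>x. \<ominus>\<^bsub>R\<^esub> x) ` B \<union> (\<lambda>x. inv\<^bsub>R\<^esub> x) ` B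
      \<union> (\<lambda>(x, y). x \<oplus>\<^bsub>R\<^esub> y) ` (B \<times> B) \<union> (\<lambda>(x, y). x \<otimes>\<^bsub>R\<^esub> y) ` (B \<times> B))"
  have A0: "A 0 = insert \<one>\<^bsub>R\<^esub> H" by (simp add: A_def)
  have AS: "A (Suc n) = A n \<union> (\<lambda>x. \<ominus>\<^bsub>R\<^esub> x) ` A n \<union> (\<lambda>x. inv\<^bsub>R\<^esub> x) ` A n
      \<union> (\<lambda>(x, y). x \<oplus>\<^bsub>R\<^esub> y) ` (A n \<times> A n) \<union> (\<lambda>(x, y). x \<otimes>\<^bsub>R\<^esub> y) ` (A n \<times> A n)" for n
    by (simp add: A_def)
  have "countable (A n)" for n
    by (induct n) (use assms in \<open>auto simp: A0 AS\<close>)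
  then have c: "countable (\<Union>n. A n)" by simp
  have mono: "m \<le> n \<Longrightarrow> x \<in> A m \<Longrightarrow> x \<in> A n" for m n x
    by (induct rule: dec_induct) (auto simp: AS)
  have two: "\<exists>n. x \<in> A n \<and> y \<in> A n" if xy: "x \<in> (\<Union>n. A n)" "y \<in> (\<Union>n. A n)" for x y
  proof -
    obtain m n where "x \<in> A m" "y \<in> A n" using xy by blast
    then have "x \<in> A (max m n)" "y \<in> A (max m n)" using mono[OF max.cobounded1] mono[OF max.cobounded2] by blast+
    then show ?thesis by blast
  qed
  have "x \<in> generate_field R H \<Longrightarrow> x \<in> (\<Union>n. A n)" for x
  proof (induct rule: generate_field.induct)
    case one
    then show ?case using A0 by blast
  next
    case (incl h)
    then show ?case using A0 by blast
  next
    case (a_inv h)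
    then obtain n where "h \<in> A n" by blast
    then have "\<ominus>\<^bsub>R\<^esub> h \<in> A (Suc n)" unfolding AS by blast
    then show ?case by blast
  next
    case (m_inv h)
    then obtain n where "h \<in> A n" by blast
    then have "inv\<^bsub>R\<^esub> h \<in> A (Suc n)" unfolding AS by blast
    then show ?case by blast
  next
    case (eng_add x y)
    then obtain n where "x \<in> A n" "y \<in> A n" using two by blast
    then have "x \<oplus>\<^bsub>R\<^esub> y \<in> A (Suc n)" unfolding AS by (intro UnI1 UnI2 image_eqI[of _ _ "(x, y)"]) auto
    then show ?case by blast
  next
    case (eng_mult x y)
    then obtain n where "x \<in> A n" "y \<in> A n" using two by blast
    then have "x \<otimes>\<^bsub>R\<^esub> y \<in> A (Suc n)" unfolding AS by (intro UnI2 image_eqI[of _ _ "(x, y)"]) auto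
    then show ?case by blast
  qed
  then show ?thesis using countable_subset[OF _ c] by blast
qed

context finite_function_field
begin

text \<open>Every place contains a nonconstant function, each of these has finitely many zeros, and
  \<open>K\<close> is countable, being finitely generated over a finite field.\<close>

lemma countable_places: "countable (places k K)"
proof -
  obtain S where S: "finite S" "K = generate_field R (k \<union> S)" using ff by (auto simp: function_field_def)
  have "countable (generate_field R (k \<union> S))"
    by (rule countable_generate_field) (use S(1) finite_k in \<open>auto intro: countable_finite\<close>)
  then have cK: "countable K" using S(2) by simp
  have "places k K \<subseteq> (\<Union>z\<in>K - k. {P \<in> places k K. z \<in> P})"
  proof
    fix P assume P: "P \<in> places k K"
    interpret P: place R k K P using placeI[OF P] .
    obtain z where z: "z \<in> P" "z \<noteq> \<zero>" using P.exists_nonzero_P by blast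
    then have "z \<in> K - k" using P.P_nonconstant[OF z] by blast
    then show "P \<in> (\<Union>z\<in>K - k. {P \<in> places k K. z \<in> P})" using P z by blast
  qed
  moreover have "countable (\<Union>z\<in>K - k. {P \<in> places k K. z \<in> P})"
  proof (rule countable_UN)
    show "countable (K - k)" using cK by (rule countable_subset[rotated]) blast
    show "countable {P \<in> places k K. z \<in> P}" if "z \<in> K - k" for z
      using card_zeros_le[of z] that by (intro countable_finite) blast
  qed
  ultimately show ?thesis by (rule countable_subset)
qed

definition nth_place :: "nat \<Rightarrow> 'a set" where
  "nth_place m = from_nat_into (places k K) m"

lemma nth_place: "nth_place m \<in> places k K"
  unfolding nth_place_def using infinite_places by (intro from_nat_into) auto

lemma exists_nth_place: "P \<in> places k K \<Longrightarrow> \<exists>m. nth_place m = P"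
  unfolding nth_place_def using from_nat_into_surj[OF countable_places] .

end


section \<open>The tower\<close>

context field
begin

context
  fixes k K0 K1
  assumes K0: "finite_function_field R k K0"
    and root: "\<And>a b. a \<in> carrier R \<Longrightarrow> b \<in> carrier R \<Longrightarrow> \<exists>x\<in>carrier R. x \<otimes> x = a \<otimes> x \<ominus> b"
    and K1: "finite_function_field.tower_step R k K0 K1" "num_rational_places k K1 \<ge> 2"
begin

text \<open>
  A stage of the construction is a sequence whose entries up to index \<open>Suc n\<close> are already final. The
  step from stage \<open>n\<close> ramifies the \<open>m\<close>-th place of the \<open>i\<close>-th field, where \<open>n\<close> encodes \<open>(i, m)\<close>.
\<close>

definition stage :: "nat \<Rightarrow> (nat \<Rightarrow> 'a set) \<Rightarrow> bool" where
  "stage n h \<longleftrightarrow> h 0 = K0 \<and> h 1 = K1 \<and> (\<forall>i\<le>n. finite_function_field.tower_step R k (h i) (h (Suc i)))"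

definition ramified_above :: "'a set \<Rightarrow> 'a set \<Rightarrow> 'a set \<Rightarrow> bool" where
  "ramified_above L M P \<longleftrightarrow> (\<exists>P'\<in>places k M. P \<subseteq> P' \<and> ramification_index L M P P' > 1)"

text \<open>Since i is at most \<open>prod_encode (i, m)\<close>, the field whose place is treated
  is already final. Every pair gets its turn, so each place of each field is handled once its code
  is reached.\<close>

definition next_stage :: "nat \<Rightarrow> (nat \<Rightarrow> 'a set) \<Rightarrow> (nat \<Rightarrow> 'a set) \<Rightarrow> bool" where
  "next_stage n h h' \<longleftrightarrow> (\<forall>i\<le>Suc n. h' i = h i) \<and>
     (\<forall>i m. prod_encode (i, m) = n \<longrightarrow>
        ramified_above (h i) (h' (Suc (Suc n))) (finite_function_field.nth_place R k (h i) m))"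

lemma tower_stepD:
  assumes L: "finite_function_field R k L" and st: "finite_function_field.tower_step R k L M"
  shows "L \<subset> M" "function_field_extension k L M" "dimension 2 L M"
    "num_rational_places k M \<le> 2 * num_rational_places k L"
    "2 * num_rational_places k L \<le> num_rational_places k M + 1"
    "\<And>Q. Q \<in> places k L \<Longrightarrow> \<exists>Q'\<in>places k M. Q \<subseteq> Q'"
    "finite_function_field R k M"
proof -
  interpret L: finite_function_field R k L using L .
  note d = st[unfolded L.tower_step_def]
  show "L \<subset> M" "function_field_extension k L M" "dimension 2 L M"
    "num_rational_places k M \<le> 2 * num_rational_places k L"
    "2 * num_rational_places k L \<le> num_rational_places k M + 1" using d by blast+
  show "\<exists>Q'\<in>places k M. Q \<subseteq> Q'" if "Q \<in> places k L" for Q using d that by blast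
  show "finite_function_field R k M"
    by unfold_locales (use d L.finite_k in \<open>auto simp: function_field_extension_def\<close>)
qed

lemma stage_field: "stage n h \<Longrightarrow> i \<le> Suc n \<Longrightarrow> finite_function_field R k (h i)"
proof (induct i)
  case 0
  then show ?case using K0 by (simp add: stage_def)
next
  case (Suc i)
  then have "finite_function_field.tower_step R k (h i) (h (Suc i))" by (simp add: stage_def)
  then show ?case using tower_stepD(7) Suc by simp
qed

text \<open>The quantity N - 1 at least doubles, because 2 N - 1 - 1 = 2 (N - 1); it starts at 1 or
  more for \<open>K1\<close>. In particular a second rational place is available at every
  step.\<close>

lemma stage_num: "stage n h \<Longrightarrow> i \<le> n \<Longrightarrow> 2 ^ i + 1 \<le> num_rational_places k (h (Suc i))"
proof (induct i)
  case 0
  then show ?case using K1 by (simp add: stage_def)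
next
  case (Suc i)
  have "finite_function_field.tower_step R k (h (Suc i)) (h (Suc (Suc i)))" using Suc by (simp add: stage_def)
  from tower_stepD(5)[OF stage_field[OF Suc(2)] this]
  have "2 * num_rational_places k (h (Suc i)) \<le> num_rational_places k (h (Suc (Suc i))) + 1" using Suc by simp
  moreover have "2 ^ i + 1 \<le> num_rational_places k (h (Suc i))" using Suc by simp
  ultimately show ?case by simp
qed

lemma stage_chain:
  assumes h: "stage n h" and ij: "i \<le> j" and j: "j \<le> Suc n" and P: "P \<in> places k (h i)"
  shows "h i \<subseteq> h j \<and> (\<exists>P'\<in>places k (h j). P \<subseteq> P')"
  using ij j
proof (induct rule: dec_induct)
  case base
  then show ?case using P by blast
next
  case (step j)
  then obtain P' where P': "P' \<in> places k (h j)" "P \<subseteq> P'" "h i \<subseteq> h j" by auto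
  have st: "finite_function_field.tower_step R k (h j) (h (Suc j))" using h step(4) by (simp add: stage_def)
  have F: "finite_function_field R k (h j)" using stage_field[OF h] step(4) by simp
  obtain P2 where "P2 \<in> places k (h (Suc j))" "P' \<subseteq> P2" using tower_stepD(6)[OF F st P'(1)] by blast
  then show ?case using P' tower_stepD(1)[OF F st] by blast
qed

text \<open>The place to be treated belongs to an earlier field, so a place P1 above it in the last
  field is ramified instead. Ramification passes down because indices multiply.\<close>

lemma stage_step:
  assumes h: "stage n h"
  shows "\<exists>h'. stage (Suc n) h' \<and> next_stage n h h'"
proof -
  obtain i m where im: "prod_encode (i, m) = n" by (metis prod_decode_inverse surj_pair)
  have i: "i \<le> Suc n" using le_prod_encode_1[of i m] im by simp
  let ?L = "h (Suc n)"
  have FL: "finite_function_field R k ?L" and Fi: "finite_function_field R k (h i)"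
    using stage_field[OF h] i by auto
  interpret L: finite_function_field R k ?L using FL .
  define P where "P = finite_function_field.nth_place R k (h i) m"
  have P: "P \<in> places k (h i)" unfolding P_def using finite_function_field.nth_place[OF Fi] .
  obtain P1 where P1: "P1 \<in> places k ?L" "P \<subseteq> P1" and sub: "h i \<subseteq> ?L" using stage_chain[OF h i order_refl P] by blast
  have "2 ^ n + 1 \<le> num_rational_places k ?L" using stage_num[OF h order_refl] .
  moreover have "(2::nat) ^ n \<ge> 1" by simp
  ultimately have "num_rational_places k ?L \<ge> 2" by linarith
  then have c2: "card {Q \<in> places k ?L. L.pd Q = 1} \<ge> 2" by (simp add: num_rational_places_def)
  have "\<not> {Q \<in> places k ?L. L.pd Q = 1} \<subseteq> {P1}"
  proof
    assume "{Q \<in> places k ?L. L.pd Q = 1} \<subseteq> {P1}"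
    then have "card {Q \<in> places k ?L. L.pd Q = 1} \<le> card {P1}" by (intro card_mono) auto
    then show False using c2 by simp
  qed
  then obtain Q0 where Q0: "Q0 \<in> places k ?L" "L.pd Q0 = 1" "Q0 \<noteq> P1" by blast
  obtain M P' where M: "L.tower_step M" and P': "P' \<in> places k M" "P1 \<subseteq> P'" "ramification_index ?L M P1 P' > 1"
    using L.exists_tower_step[OF root P1(1) Q0] by blast
  note stM = tower_stepD[OF FL M]
  define h' where "h' = h(Suc (Suc n) := M)"
  have h'S: "stage (Suc n) h'"
    unfolding stage_def
  proof (intro conjI allI impI)
    show "h' 0 = K0" "h' 1 = K1" using h by (auto simp: h'_def stage_def)
    fix j assume "j \<le> Suc n"
    then show "finite_function_field.tower_step R k (h' j) (h' (Suc j))"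
      using h M by (cases "j = Suc n") (auto simp: h'_def stage_def)
  qed
  have sLM: "?L \<subseteq> M" using stM(1) by blast
  obtain e1 where e1: "e1 > 0" "\<forall>x\<in>h i - {\<zero>}. place_val ?L P1 x = int e1 * place_val (h i) P x"
    using finite_function_field.ramification_index_eq[OF Fi FL sub P P1] by blast
  obtain e2 where e2: "ramification_index ?L M P1 P' = e2" "\<forall>x\<in>?L - {\<zero>}. place_val M P' x = int e2 * place_val ?L P1 x"
    using finite_function_field.ramification_index_eq[OF FL stM(7) sLM P1(1) P'(1,2)] by blast
  have sM: "h i \<subseteq> M" and PP': "P \<subseteq> P'" using sub sLM P1 P' by blast+
  obtain e where e: "ramification_index (h i) M P P' = e" "\<forall>x\<in>h i - {\<zero>}. place_val M P' x = int e * place_val (h i) P x"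
    using finite_function_field.ramification_index_eq[OF Fi stM(7) sM P P'(1) PP'] by blast
  \<comment> \<open>Evaluation at an element of value 1 turns the three proportionality relations
    into e = e2 e1.\<close>
  obtain x where x: "x \<in> h i" "x \<noteq> \<zero>" "place_val (h i) P x = 1"
    using place.exists_v[OF finite_function_field.placeI[OF Fi P], of 1] by blast
  have "int e = place_val M P' x" using e(2) x by simp
  also have "\<dots> = int e2 * place_val ?L P1 x" using e2(2) x sub by blast
  also have "place_val ?L P1 x = int e1" using e1(2) x by simp
  finally have "e = e2 * e1" by (simp flip: of_nat_mult)
  moreover have "e2 > 1" using e2(1) P'(3) by simp
  moreover have "e2 * 1 \<le> e2 * e1" using e1(1) by (intro mult_le_mono2) simp
  ultimately have "e > 1" by linarith
  then have "ramified_above (h i) M P" unfolding ramified_above_def using P' PP' e(1) by blast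
  then have "next_stage n h h'"
    unfolding next_stage_def using im by (auto simp: h'_def P_def)
  then show ?thesis using h'S by blast
qed

lemma exists_ramified_tower:
  "\<exists>K. K 0 = K0 \<and> (\<forall>i. finite_function_field R k (K i)) \<and> (\<forall>i. finite_function_field.tower_step R k (K i) (K (Suc i))) \<and>
     (\<forall>i. 2 ^ i + 1 \<le> num_rational_places k (K (Suc i))) \<and> everywhere_ramified k K"
proof -
  have 0: "\<exists>h. stage 0 h"
    by (intro exI[of _ "\<lambda>i. if i = 0 then K0 else K1"]) (use K1 in \<open>simp add: stage_def\<close>)
  have "\<exists>f. \<forall>n. stage n (f n) \<and> next_stage n (f n) (f (Suc n))"
    by (rule dependent_nat_choice[OF 0 stage_step])
  then obtain f where f: "\<And>n. stage n (f n)" "\<And>n. next_stage n (f n) (f (Suc n))" by blast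
  \<comment> \<open>Diagonal sequence: later stages no longer change an entry that has become
    final.\<close>
  define K where "K i = f i i" for i
  have stable: "f (Suc n) i = f n i" if "i \<le> Suc n" for n i using f(2)[of n] that by (simp add: next_stage_def)
  have ge: "i \<le> n \<Longrightarrow> f n i = K i" for i n
    by (induct rule: dec_induct) (simp_all add: K_def stable)
  \<comment> \<open>Stage n has one final entry beyond n, so the agreement reaches index n +
    1.\<close>
  have agree: "f n i = K i" if "i \<le> Suc n" for i n
    using ge[of i "Suc n"] stable[OF that] that by simp
  have FK: "finite_function_field R k (K i)" for i using stage_field[OF f(1), of i i] agree[of i i] by simp
  have st: "finite_function_field.tower_step R k (K i) (K (Suc i))" for i
  proof -
    have "finite_function_field.tower_step R k (f i i) (f i (Suc i))" using f(1)[of i] by (simp add: stage_def)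
    moreover have "f i i = K i" "f i (Suc i) = K (Suc i)" using agree[of i i] agree[of "Suc i" i] by auto
    ultimately show ?thesis by (simp only:)
  qed
  have "everywhere_ramified k K"
    unfolding everywhere_ramified_def
  proof (intro allI ballI)
    fix i P assume P: "P \<in> places k (K i)"
    obtain m where m: "finite_function_field.nth_place R k (K i) m = P"
      using finite_function_field.exists_nth_place[OF FK P] by blast
    define n where "n = prod_encode (i, m)"
    have i: "i \<le> n" using le_prod_encode_1[of i m] by (simp add: n_def)
    have "ramified_above (f n i) (f (Suc n) (Suc (Suc n))) (finite_function_field.nth_place R k (f n i) m)"
      using f(2)[of n] unfolding next_stage_def n_def by blast
    then have "ramified_above (K i) (K (Suc (Suc n))) P"
      using agree[of i n] agree[of "Suc (Suc n)" "Suc n"] i m by simp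
    then show "\<exists>j>i. ramifies k (K i) (K j) P"
      unfolding ramified_above_def ramifies_def using i by (intro exI[of _ "Suc (Suc n)"]) auto
  qed
  moreover have "K 0 = K0" using f(1)[of 0] by (simp add: K_def stage_def)
  moreover have "2 ^ i + 1 \<le> num_rational_places k (K (Suc i))" for i
    using stage_num[OF f(1), of i i] agree[of "Suc i" i] by simp
  ultimately show ?thesis using FK st by blast
qed

end

theorem exists_everywhere_ramified_tower:
  assumes K0: "finite_function_field R k K0"
    and root: "\<And>a b. a \<in> carrier R \<Longrightarrow> b \<in> carrier R \<Longrightarrow> \<exists>x\<in>carrier R. x \<otimes> x = a \<otimes> x \<ominus> b"
    and Q: "Q \<in> places k K0" "place_degree k K0 Q = 1"
  shows "\<exists>K. K 0 = K0 \<and> function_field_tower k K \<and> everywhere_ramified k K \<and>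
    (\<exists>l::real. l > 0 \<and> (\<lambda>i. real (num_rational_places k (K i)) / real (dim (K 0) (K i))) \<longlonglongrightarrow> l)"
proof -
  interpret K0: finite_function_field R k K0 using K0 .
  have fin: "finite {P \<in> places k K0. K0.pd P = 1}" using K0.rational_place_bound[OF Q] by blast
  have N0: "num_rational_places k K0 \<ge> 1"
    unfolding num_rational_places_def using fin Q by (metis (mono_tags, lifting) One_nat_def Suc_leI card_gt_0_iff empty_iff mem_Collect_eq)
  \<comment> \<open>The first step ramifies a nonrational place, so that N doubles exactly and
    reaches 2 even when N_0 = 1.\<close>
  have "\<not> places k K0 \<subseteq> {P \<in> places k K0. K0.pd P = 1}" using K0.infinite_places fin finite_subset by blast
  then obtain P where P: "P \<in> places k K0" "K0.pd P \<noteq> 1" by blast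
  then have "Q \<noteq> P" using Q by blast
  then obtain K1 where K1: "K0.tower_step K1" "num_rational_places k K1 = 2 * num_rational_places k K0"
    using K0.exists_tower_step[OF root P(1) Q] P(2) by auto
  have K1': "num_rational_places k K1 \<ge> 2" using K1(2) N0 by simp
  obtain K where K: "K 0 = K0" "\<And>i. finite_function_field R k (K i)"
    "\<And>i. finite_function_field.tower_step R k (K i) (K (Suc i))"
    "\<And>i. 2 ^ i + 1 \<le> num_rational_places k (K (Suc i))" "everywhere_ramified k K"
    using exists_ramified_tower[OF K0 root K1(1) K1'] by blast
  note st = tower_stepD[OF K0 root K1(1) K1' K(2,3)]
  define N where "N i = num_rational_places k (K i)" for i
  have sf: "subfield (K i) R" for i using finite_function_field.subfield_K[OF K(2)] .
  have dimK: "dimension (2 ^ i) (K 0) (K i)" for i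
  proof (induct i)
    case 0
    then show ?case using dimension_one[OF sf] by simp
  next
    case (Suc i)
    have "dimension (2 ^ i * 2) (K 0) (K (Suc i))" by (rule telescopic_base[OF sf sf Suc st(3)])
    then show ?case by (simp add: mult.commute)
  qed
  have dim: "dim (K 0) (K i) = 2 ^ i" for i using dimI[OF sf dimK] by (simp add: over_def)
  \<comment> \<open>The normalized count decreases because N at most doubles. It stays above 1/2
    since N_i exceeds 2^(i-1) for i >= 1 and N_0 is at least 1.\<close>
  define rr where "rr i = real (N i) / 2 ^ i" for i
  have N_le: "N (Suc i) \<le> 2 * N i" for i using st(4) by (simp add: N_def)
  have dec: "decseq rr"
  proof (rule decseq_SucI)
    fix i
    have "real (N (Suc i)) \<le> 2 * real (N i)" using N_le[of i] by linarith
    then show "rr (Suc i) \<le> rr i" by (simp add: rr_def field_simps)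
  qed
  have low: "1 / 2 \<le> rr i" for i
  proof (cases i)
    case 0
    then show ?thesis using N0 K(1) by (simp add: rr_def N_def)
  next
    case (Suc j)
    have "2 ^ j + 1 \<le> N i" using K(4)[of j] Suc by (simp add: N_def)
    then have "real (2 ^ j + 1) \<le> real (N i)" by (simp only: of_nat_le_iff)
    moreover have "real (2 ^ j + 1) = 2 ^ j + 1" by simp
    ultimately have "2 ^ j \<le> real (N i)" by linarith
    then show ?thesis by (simp add: rr_def Suc field_simps)
  qed
  obtain l where l: "rr \<longlonglongrightarrow> l" using decseq_convergent[OF dec, of "1 / 2"] low by blast
  have "1 / 2 \<le> l" by (rule LIMSEQ_le_const[OF l]) (use low in blast)
  then have lim: "\<exists>l::real. l > 0 \<and> (\<lambda>i. real (num_rational_places k (K i)) / real (dim (K 0) (K i))) \<longlonglongrightarrow> l"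
  proof (intro exI[of _ l] conjI)
    have "rr = (\<lambda>i. real (num_rational_places k (K i)) / real (dim (K 0) (K i)))"
      by (rule ext) (simp add: rr_def N_def dim)
    then show "(\<lambda>i. real (num_rational_places k (K i)) / real (dim (K 0) (K i))) \<longlonglongrightarrow> l"
      using l by simp
  qed (use \<open>1 / 2 \<le> l\<close> in simp)
  \<comment> \<open>The exponential growth of N is weakened to N >= i + 1, which suffices for
    divergence of the genus.\<close>
  have genus_bound: "int i \<le> int (card k) * (genus k (K (Suc i)) + 1)" for i
  proof -
    interpret F: finite_function_field R k "K (Suc i)" using K(2) .
    have "N (Suc i) \<noteq> 0" using K(4)[of i] by (simp add: N_def)
    then have "card {P \<in> places k (K (Suc i)). F.pd P = 1} \<noteq> 0" by (simp add: N_def num_rational_places_def)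
    then have "{P \<in> places k (K (Suc i)). F.pd P = 1} \<noteq> {}" by (metis card.empty)
    then obtain P where P: "P \<in> places k (K (Suc i))" "F.pd P = 1" by blast
    have "int (N (Suc i)) \<le> 1 + int (card k) * (genus k (K (Suc i)) + 1)"
      using F.rational_place_bound[OF P] by (simp add: N_def)
    moreover have "i + 1 \<le> N (Suc i)" using K(4)[of i] less_exp[of i] unfolding N_def by linarith
    ultimately show ?thesis by linarith
  qed
  have gen: "filterlim (\<lambda>i. genus k (K i)) at_top sequentially"
    unfolding filterlim_at_top
  proof
    fix Z :: int
    have "Z \<le> genus k (K i)" if i: "i \<ge> Suc (nat (int (card k) * \<bar>Z\<bar> + 1))" for i
    proof (rule ccontr)
      assume "\<not> Z \<le> genus k (K i)"
      then have g: "genus k (K i) + 1 \<le> \<bar>Z\<bar>" by linarith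
      obtain j where j: "i = Suc j" using i by (cases i) auto
      have "int j \<le> int (card k) * (genus k (K i) + 1)" using genus_bound[of j] j by simp
      also have "\<dots> \<le> int (card k) * \<bar>Z\<bar>" by (rule mult_left_mono[OF g]) simp
      finally show False using i j by linarith
    qed
    then show "eventually (\<lambda>i. Z \<le> genus k (K i)) sequentially" unfolding eventually_sequentially by blast
  qed
  have "function_field_tower k K" unfolding function_field_tower_def using st(1,2) gen by blast
  then show ?thesis using K(1,5) lim by blast
qed

end

theorem theorem1p3:
  fixes F :: "'a ring" and k :: "'a set" and q :: nat
  assumes "primepow q"
    and "field F"
    and "card k = q"
    and "field.function_field F k (carrier F)"
    and "\<exists>P \<in> field.places F k (carrier F). field.place_degree F k (carrier F) P = 1"
  shows "let \<Omega> = field.alg_closure F; \<iota> = ring.indexed_const F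
         in \<exists>K. K 0 = \<iota> ` carrier F \<and>
              field.function_field_tower \<Omega> (\<iota> ` k) K \<and>
              field.everywhere_ramified \<Omega> (\<iota> ` k) K \<and>
              (\<exists>l::real. l > 0 \<and>
                 (\<lambda>i. real (field.num_rational_places \<Omega> (\<iota> ` k) (K i)) /
                      real (ring.dim \<Omega> (K 0) (K i))) \<longlonglongrightarrow> l)"
proof -
  interpret F: field F by fact
  interpret C: algebraic_closure F.alg_closure "F.indexed_const ` carrier F"
    by (rule F.alg_closureE(1))
  \<comment> \<open>An infinite set has cardinality 0 in HOL, so positivity of q yields finiteness
    of \<open>k\<close>.\<close>
  have "card k > 0" using assms(1,3) primepow_gt_Suc_0[of q] by simp
  then have "finite k" by (rule card_ge_0_finite)
  then interpret F: finite_function_field F k "carrier F"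
    using assms(4) by unfold_locales
  interpret function_field_embedding F F.alg_closure k F.indexed_const
    by unfold_locales (rule F.alg_closureE(2))
  obtain P where P: "P \<in> F.places k (carrier F)" "F.place_degree k (carrier F) P = 1"
    using assms(5) by blast
  show ?thesis
    unfolding Let_def
    by (rule C.exists_everywhere_ramified_tower[OF finite_function_field_image
          C.exists_quadratic_root rational_place_image[OF P]])
qed

end
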